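(* Let $A\supset P$ be an inclusion of separable unital $C^*$-algebras and $E$ a conditional expectation from $A$ onto $P$ with a finite index. If $A$ is an AF algebra and $E$ has the Rohlin property, then $P$ is also an AF algebra.
   Context: Inclusions of unital $C^*$-algebras have a common unit. For a conditional expectation $E:A\to P$, a quasi-basis is a finite set $\{(u_i,v_i)\}_{i=1}^n\subset A\times A$ with $a=\sum_i u_iE(v_ia)=\sum_i E(au_i)v_i$ for all $a\in A$. If one exists, $E$ has a finite index and $\mathrm{Index}\,E=\sum_i u_iv_i$ (independent of the choice; a positive central invertible element of $A$). Put $A^\infty=\ell^\infty(\mathbb{N},A)/c_0(A)$, $A$ being identified with the classes of constant sequences, and $A_\infty=A^\infty\cap A'$; $P^\infty$ is regarded as a subalgebra of $A^\infty$, and $E^\infty:A^\infty\to P^\infty$ is the termwise induced conditional expectation. A conditional expectation $E:A\to P$ with a finite index has the Rohlin property if there is a projection $e\in A_\infty$ with $E^\infty(e)=(\mathrm{Index}\,E)^{-1}\cdot1$ and such that the map $A\ni x\mapsto xe$ is injective. *)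

theory Defs
  imports "HOL-Analysis.Analysis"
begin

section \<open>Unital C*-algebras\<close>

class scaleC =
  fixes scaleC :: "complex \<Rightarrow> 'a \<Rightarrow> 'a"  (infixr \<open>*\<^sub>C\<close> 75)

class adj =
  fixes adj :: "'a \<Rightarrow> 'a"

text \<open>
  As usual, a unital C*-algebra is understood to satisfy \<open>1 \<noteq> 0\<close>, hence \<open>norm 1 = 1\<close>; both come
  with \<^class>\<open>real_normed_algebra_1\<close>, as does the submultiplicativity of the norm.
  Completeness comes with \<^class>\<open>banach\<close>.
\<close>

class cstar_algebra = real_normed_algebra_1 + banach + scaleC + adj +
  assumes scaleC_add_right: "c *\<^sub>C (x + y) = c *\<^sub>C x + c *\<^sub>C y"
    and scaleC_add_left: "(c + d) *\<^sub>C x = c *\<^sub>C x + d *\<^sub>C x"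
    and scaleC_scaleC: "c *\<^sub>C d *\<^sub>C x = (c * d) *\<^sub>C x"
    and scaleC_one: "1 *\<^sub>C x = x"
    and scaleR_scaleC: "r *\<^sub>R x = complex_of_real r *\<^sub>C x"
    and norm_scaleC: "norm (c *\<^sub>C x) = cmod c * norm x"
    and mult_scaleC_left: "(c *\<^sub>C x) * y = c *\<^sub>C (x * y)"
    and mult_scaleC_right: "x * (c *\<^sub>C y) = c *\<^sub>C (x * y)"
    and adj_adj: "adj (adj x) = x"
    and adj_add: "adj (x + y) = adj x + adj y"
    and adj_scaleC: "adj (c *\<^sub>C x) = cnj c *\<^sub>C adj x"
    and adj_mult: "adj (x * y) = adj y * adj x"
    and norm_adj_mult_self: "norm (adj x * x) = (norm x)\<^sup>2"

instantiation complex :: cstar_algebra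
begin
definition "scaleC c (x :: complex) = c * x"
definition "adj (x :: complex) = cnj x"
instance
  by standard
    (auto simp: scaleC_complex_def adj_complex_def algebra_simps scaleR_conv_of_real norm_mult
        power2_eq_square)
end

interpretation cvec: vector_space "scaleC :: complex \<Rightarrow> 'a \<Rightarrow> 'a::cstar_algebra"
  by standard (simp_all add: scaleC_add_right scaleC_add_left scaleC_scaleC scaleC_one)

lemma adj_zero [simp]: "adj 0 = (0 :: 'a::cstar_algebra)"
  using adj_add[of 0 "0::'a"] by simp

lemma adj_one [simp]: "adj 1 = (1 :: 'a::cstar_algebra)"
  by (metis adj_adj adj_mult mult_1_left mult_1_right)

lemma adj_minus: "adj (- x) = - adj (x :: 'a::cstar_algebra)"
  by (metis add.right_inverse adj_add adj_zero minus_unique)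

lemma adj_diff: "adj (x - y) = adj x - adj (y :: 'a::cstar_algebra)"
  by (metis adj_add adj_minus diff_conv_add_uminus)

lemma norm_adj [simp]: "norm (adj x) = norm (x :: 'a::cstar_algebra)"
proof -
  have le: "norm y \<le> norm (adj y)" for y :: 'a
  proof (cases "y = 0")
    case False
    have "norm y * norm y = norm (adj y * y)"
      by (simp add: norm_adj_mult_self power2_eq_square)
    also have "\<dots> \<le> norm (adj y) * norm y"
      by (rule norm_mult_ineq)
    finally show ?thesis
      using False by simp
  qed simp
  show ?thesis
    using le[of x] le[of "adj x"] by (simp add: adj_adj)
qed

definition cstar_subalgebra :: "'a::cstar_algebra set \<Rightarrow> bool" where
  "cstar_subalgebra B \<longleftrightarrow>
     cvec.subspace B \<and> closed B \<and> (\<forall>x\<in>B. \<forall>y\<in>B. x * y \<in> B) \<and> (\<forall>x\<in>B. adj x \<in> B)"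

text \<open>
  An inclusion of unital C*-algebras \<open>A \<supseteq> P\<close> is rendered by the type \<open>'a\<close> (for \<open>A\<close>) and a set
  \<open>P\<close> of elements of this type.
\<close>

definition unital_cstar_subalgebra :: "'a::cstar_algebra set \<Rightarrow> bool" where
  "unital_cstar_subalgebra B \<longleftrightarrow> cstar_subalgebra B \<and> 1 \<in> B"

definition finite_dim :: "'a::cstar_algebra set \<Rightarrow> bool" where
  "finite_dim B \<longleftrightarrow> (\<exists>S. finite S \<and> B = cvec.span S)"

text \<open>The approximating subalgebras are not required to contain the unit.\<close>

definition AF_algebra :: "'a::cstar_algebra set \<Rightarrow> bool" where
  "AF_algebra B \<longleftrightarrow> cstar_subalgebra B \<and>
     (\<exists>F :: nat \<Rightarrow> 'a set. incseq F \<and> (\<forall>n. cstar_subalgebra (F n) \<and> finite_dim (F n)) \<and>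
        B = closure (\<Union>n. F n))"


section \<open>Conditional expectations of finite index\<close>

definition positive :: "'a::cstar_algebra \<Rightarrow> bool" where
  "positive x \<longleftrightarrow> (\<exists>y. x = adj y * y)"

definition conditional_expectation :: "'a::cstar_algebra set \<Rightarrow> ('a \<Rightarrow> 'a) \<Rightarrow> bool" where
  "conditional_expectation P E \<longleftrightarrow>
     Vector_Spaces.linear scaleC scaleC E \<and>
     (\<forall>a. E a \<in> P) \<and> (\<forall>p\<in>P. E p = p) \<and>
     (\<forall>p\<in>P. \<forall>q\<in>P. \<forall>a. E (p * a * q) = p * E a * q) \<and>
     (\<forall>a. positive a \<longrightarrow> positive (E a)) \<and>
     (\<forall>a. norm (E a) \<le> norm a)"

definition quasi_basis :: "('a::cstar_algebra \<Rightarrow> 'a) \<Rightarrow> nat \<Rightarrow> (nat \<Rightarrow> 'a) \<Rightarrow> (nat \<Rightarrow> 'a) \<Rightarrow> bool" where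
  "quasi_basis E n u v \<longleftrightarrow>
     (\<forall>a. a = (\<Sum>i<n. u i * E (v i * a)) \<and> a = (\<Sum>i<n. E (a * u i) * v i))"

definition finite_index :: "('a::cstar_algebra \<Rightarrow> 'a) \<Rightarrow> bool" where
  "finite_index E \<longleftrightarrow> (\<exists>n u v. quasi_basis E n u v)"

definition index_of :: "('a::cstar_algebra \<Rightarrow> 'a) \<Rightarrow> 'a" where
  "index_of E = (THE c. \<exists>n u v. quasi_basis E n u v \<and> c = (\<Sum>i<n. u i * v i))"

lemma quasi_basis_sum_unique:
  assumes "quasi_basis E n u v" and "quasi_basis E m s t"
  shows "(\<Sum>i<n. u i * v i) = (\<Sum>j<m. s j * t j)"
proof -
  have "(\<Sum>i<n. u i * v i) = (\<Sum>i<n. u i * (\<Sum>j<m. E (v i * s j) * t j))"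
    using assms(2) unfolding quasi_basis_def by metis
  also have "\<dots> = (\<Sum>j<m. (\<Sum>i<n. u i * E (v i * s j)) * t j)"
    unfolding sum_distrib_left sum_distrib_right mult.assoc by (rule sum.swap)
  also have "\<dots> = (\<Sum>j<m. s j * t j)"
    using assms(1) unfolding quasi_basis_def by metis
  finally show ?thesis .
qed

lemma index_of_eq:
  assumes "quasi_basis E n u v"
  shows "index_of E = (\<Sum>i<n. u i * v i)"
  unfolding index_of_def using assms quasi_basis_sum_unique by (intro the_equality) blast+


section \<open>The sequence algebra\<close>

text \<open>
  \<open>'a seq_alg\<close> is the quotient of the bounded sequences by the null sequences.
\<close>

definition seq_rel :: "(nat \<Rightarrow> 'a::cstar_algebra) \<Rightarrow> (nat \<Rightarrow> 'a) \<Rightarrow> bool" where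
  "seq_rel f g \<longleftrightarrow> Bseq f \<and> Bseq g \<and> (\<lambda>n. f n - g n) \<longlonglongrightarrow> 0"

lemma part_equivp_seq_rel: "part_equivp (seq_rel :: (nat \<Rightarrow> 'a::cstar_algebra) \<Rightarrow> _)"
proof (rule part_equivpI)
  show "\<exists>x :: nat \<Rightarrow> 'a. seq_rel x x"
    by (rule exI[of _ "\<lambda>_. 0"]) (simp add: seq_rel_def)
  show "symp (seq_rel :: (nat \<Rightarrow> 'a) \<Rightarrow> _)"
    using tendsto_minus by (fastforce simp: symp_def seq_rel_def)
  show "transp (seq_rel :: (nat \<Rightarrow> 'a) \<Rightarrow> _)"
  proof (rule transpI)
    fix f g h :: "nat \<Rightarrow> 'a"
    assume "seq_rel f g" "seq_rel g h"
    then show "seq_rel f h"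
      using tendsto_add[of "\<lambda>n. f n - g n" 0 sequentially "\<lambda>n. g n - h n" 0]
      by (simp add: seq_rel_def)
  qed
qed

quotient_type (overloaded) 'a seq_alg = "nat \<Rightarrow> 'a::cstar_algebra" / partial: seq_rel
  by (rule part_equivp_seq_rel)

lemma Bseq_plus:
  fixes f g :: "nat \<Rightarrow> 'a::real_normed_vector"
  assumes "Bseq f" "Bseq g"
  shows "Bseq (\<lambda>n. f n + g n)"
proof -
  obtain K L where "\<And>n. norm (f n) \<le> K" "\<And>n. norm (g n) \<le> L"
    using assms unfolding Bseq_def by blast
  then have "norm (f n + g n) \<le> K + L" for n
    by (meson add_mono norm_triangle_ineq order_trans)
  then show ?thesis
    by (rule BseqI')
qed

lemma Bseq_times:
  fixes f g :: "nat \<Rightarrow> 'a::real_normed_algebra"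
  assumes "Bseq f" "Bseq g"
  shows "Bseq (\<lambda>n. f n * g n)"
proof -
  obtain K L where "K > 0" "\<And>n. norm (f n) \<le> K" "\<And>n. norm (g n) \<le> L"
    using assms unfolding Bseq_def by blast
  then have "norm (f n * g n) \<le> K * L" for n
    by (intro order_trans[OF norm_mult_ineq] mult_mono) auto
  then show ?thesis
    by (rule BseqI')
qed

lemma seq_rel_plus: "seq_rel f f' \<Longrightarrow> seq_rel g g' \<Longrightarrow> seq_rel (\<lambda>n. f n + g n) (\<lambda>n. f' n + g' n)"
  using tendsto_add[of "\<lambda>n. f n - f' n" 0 sequentially "\<lambda>n. g n - g' n" 0]
  by (simp add: seq_rel_def Bseq_plus algebra_simps)

lemma seq_rel_uminus: "seq_rel f f' \<Longrightarrow> seq_rel (\<lambda>n. - f n) (\<lambda>n. - f' n)"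
  using tendsto_minus[of "\<lambda>n. f n - f' n" 0 sequentially]
  by (simp add: seq_rel_def Bseq_minus_iff)

lemma seq_rel_times:
  fixes f g :: "nat \<Rightarrow> 'a::cstar_algebra"
  assumes "seq_rel f f'" "seq_rel g g'"
  shows "seq_rel (\<lambda>n. f n * g n) (\<lambda>n. f' n * g' n)"
proof -
  interpret m: bounded_bilinear "(*) :: 'a \<Rightarrow> 'a \<Rightarrow> 'a"
    by (rule bounded_bilinear_mult)
  have "Zfun (\<lambda>n. f n * (g n - g' n)) sequentially"
    using assms by (intro m.Bfun_prod_Zfun) (auto simp: seq_rel_def tendsto_Zfun_iff)
  moreover have "Zfun (\<lambda>n. (f n - f' n) * g' n) sequentially"
    using assms by (intro m.Zfun_prod_Bfun) (auto simp: seq_rel_def tendsto_Zfun_iff)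
  ultimately have "Zfun (\<lambda>n. f n * (g n - g' n) + (f n - f' n) * g' n) sequentially"
    by (rule Zfun_add)
  then show ?thesis
    using assms by (simp add: seq_rel_def Bseq_times tendsto_Zfun_iff algebra_simps)
qed

lemma seq_rel_adj:
  assumes "seq_rel f g"
  shows "seq_rel (\<lambda>n. adj (f n)) (\<lambda>n. adj (g n))"
proof -
  have "(\<lambda>n. norm (f n - g n)) \<longlonglongrightarrow> 0"
    using assms by (simp add: seq_rel_def tendsto_norm_zero)
  then have "(\<lambda>n. norm (adj (f n) - adj (g n))) \<longlonglongrightarrow> 0"
    by (simp add: adj_diff[symmetric])
  then have "(\<lambda>n. adj (f n) - adj (g n)) \<longlonglongrightarrow> 0"
    by (rule tendsto_norm_zero_cancel)
  then show ?thesis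
    using assms by (simp add: seq_rel_def Bseq_def)
qed

instantiation seq_alg :: (cstar_algebra) "{ring_1, adj}"
begin

lift_definition zero_seq_alg :: "'a seq_alg" is "\<lambda>_. 0"
  by (simp add: seq_rel_def)

lift_definition one_seq_alg :: "'a seq_alg" is "\<lambda>_. 1"
  by (simp add: seq_rel_def)

lift_definition plus_seq_alg :: "'a seq_alg \<Rightarrow> 'a seq_alg \<Rightarrow> 'a seq_alg" is "\<lambda>f g n. f n + g n"
  by (rule seq_rel_plus)

lift_definition uminus_seq_alg :: "'a seq_alg \<Rightarrow> 'a seq_alg" is "\<lambda>f n. - f n"
  by (rule seq_rel_uminus)

definition minus_seq_alg :: "'a seq_alg \<Rightarrow> 'a seq_alg \<Rightarrow> 'a seq_alg" where
  "x - y = x + - y" for x y :: "'a seq_alg"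

lift_definition times_seq_alg :: "'a seq_alg \<Rightarrow> 'a seq_alg \<Rightarrow> 'a seq_alg" is "\<lambda>f g n. f n * g n"
  by (rule seq_rel_times)

lift_definition adj_seq_alg :: "'a seq_alg \<Rightarrow> 'a seq_alg" is "\<lambda>f n. adj (f n)"
  by (rule seq_rel_adj)

instance
proof
  fix a b c :: "'a seq_alg"
  show "a + b + c = a + (b + c)"
    by transfer (auto simp: seq_rel_def Bseq_plus algebra_simps)
  show "a + b = b + a"
    by transfer (auto simp: seq_rel_def Bseq_plus algebra_simps)
  show "0 + a = a"
    by transfer (auto simp: seq_rel_def)
  show "- a + a = 0"
    by transfer (auto simp: seq_rel_def)
  show "a - b = a + - b"
    by (rule minus_seq_alg_def)
  show "a * b * c = a * (b * c)"
    by transfer (auto simp: seq_rel_def Bseq_times algebra_simps)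
  show "(a + b) * c = a * c + b * c"
    by transfer (auto simp: seq_rel_def Bseq_plus Bseq_times algebra_simps)
  show "a * (b + c) = a * b + a * c"
    by transfer (auto simp: seq_rel_def Bseq_plus Bseq_times algebra_simps)
  show "1 * a = a"
    by transfer (auto simp: seq_rel_def)
  show "a * 1 = a"
    by transfer (auto simp: seq_rel_def)
  show "(0 :: 'a seq_alg) \<noteq> 1"
    by transfer (auto simp: seq_rel_def LIMSEQ_const_iff)
qed

end

lift_definition seq_const :: "'a::cstar_algebra \<Rightarrow> 'a seq_alg" is "\<lambda>a _. a"
  by (simp add: seq_rel_def)

text \<open>
  The termwise induced map is formed on a representative; for a conditional expectation the choice
  is irrelevant, as the lemma following the definition shows.
\<close>

definition seq_map :: "('a::cstar_algebra \<Rightarrow> 'a) \<Rightarrow> 'a seq_alg \<Rightarrow> 'a seq_alg" where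
  "seq_map E x = abs_seq_alg (\<lambda>n. E (rep_seq_alg x n))"

lemma seq_rel_conditional_expectation:
  assumes E: "conditional_expectation P E" and fg: "seq_rel f g"
  shows "seq_rel (\<lambda>n. E (f n)) (\<lambda>n. E (g n))"
proof -
  interpret lin: Vector_Spaces.linear scaleC scaleC E
    using E by (simp add: conditional_expectation_def)
  have le: "norm (E a) \<le> norm a" for a
    using E by (simp add: conditional_expectation_def)
  have null: "(\<lambda>n. E (f n) - E (g n)) \<longlonglongrightarrow> 0"
  proof (rule Lim_null_comparison)
    show "\<forall>\<^sub>F n in sequentially. norm (E (f n) - E (g n)) \<le> norm (f n - g n)"
      using le[of "f n - g n" for n] by (simp add: lin.diff)
    show "(\<lambda>n. norm (f n - g n)) \<longlonglongrightarrow> 0"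
      using fg by (auto simp: seq_rel_def intro: tendsto_norm_zero)
  qed
  have "Bseq (\<lambda>n. E (h n))" if h: "Bseq h" for h
  proof -
    obtain K where "\<And>n. norm (h n) \<le> K"
      using h unfolding Bseq_def by blast
    then show ?thesis
      by (intro BseqI'[of _ K] order_trans[OF le])
  qed
  with null fg show ?thesis
    by (simp add: seq_rel_def)
qed

lemma seq_map_abs:
  assumes "conditional_expectation P E" "Bseq f"
  shows "seq_map E (abs_seq_alg f) = abs_seq_alg (\<lambda>n. E (f n))"
proof -
  have "seq_rel f f"
    using assms(2) by (simp add: seq_rel_def)
  then have "seq_rel (rep_seq_alg (abs_seq_alg f)) f"
    by (rule rep_abs_rsp_left[OF Quotient3_seq_alg])
  then have "seq_rel (\<lambda>n. E (rep_seq_alg (abs_seq_alg f) n)) (\<lambda>n. E (f n))"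
    by (rule seq_rel_conditional_expectation[OF assms(1)])
  then show ?thesis
    unfolding seq_map_def by (rule Quotient3_rel_abs[OF Quotient3_seq_alg])
qed

definition central_seq :: "'a::cstar_algebra seq_alg set" where
  "central_seq = {x. \<forall>a. x * seq_const a = seq_const a * x}"

definition projection :: "'a::cstar_algebra seq_alg \<Rightarrow> bool" where
  "projection e \<longleftrightarrow> e * e = e \<and> adj e = e"

text \<open>The element \<open>c\<close> below is the inverse of the index.\<close>

definition rohlin_property :: "('a::cstar_algebra \<Rightarrow> 'a) \<Rightarrow> bool" where
  "rohlin_property E \<longleftrightarrow>
     (\<exists>e\<in>central_seq. projection e \<and>
        (\<exists>c. c * index_of E = 1 \<and> index_of E * c = 1 \<and> seq_map E e = seq_const c) \<and>
        inj (\<lambda>x. seq_const x * e))"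

end

theory Submission
  imports Defs "HOL-Computational_Algebra.Fundamental_Theorem_Algebra"
begin

text \<open>
  The Rohlin projection \<open>e\<close> satisfies \<open>e x = (Index E) e E\<^sup>\<infinity>(e x)\<close> for \<open>x \<in> A\<close>, so
  \<open>x \<mapsto> (Index E) E\<^sup>\<infinity>(x e)\<close> is a unital *-homomorphism \<open>A \<rightarrow> P\<^sup>\<infinity>\<close> that restricts to the identity
  on \<open>P\<close>. A finite-dimensional subalgebra of \<open>A\<close> that almost contains given elements of \<open>P\<close> is thus
  mapped into \<open>P\<close> by almost multiplicative maps that almost fix these elements. Such maps are close
  to *-homomorphisms: Newton's iteration corrects them, using the separability idempotent that
  the trace of the regular representation yields. Hence \<open>P\<close> is locally finite-dimensional, and an
  intertwining argument makes the local subalgebras of a separable algebra increasing.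

  The order on \<open>A\<close> is obtained without functional calculus: norm estimates for sums of squares hold
  in finite-dimensional algebras by the spectral theorem and the trace, and pass to the AF algebra
  \<open>A\<close> by approximation.
\<close>

text \<open>The identity for \<open>e\<close> is an equality case. For the inner product
  \<open>E (adj x * y)\<close> the map sending x to (Index E) e E(e x) is the projection onto the
  submodule generated by \<open>e\<close>. Its difference \<open>T\<close> from left multiplication
  by \<open>e\<close> has a positive form, whose diagonal sum over a self-dual frame z of
  \<open>A\<close> over \<open>P\<close> is zero, because the products of z and \<open>adj z\<close>
  add up to Index E and \<open>E\<close> maps \<open>e\<close> to its inverse. Positive terms with
  sum zero vanish. An exact self-dual frame needs the inverse square root of the frame operator.
  With polynomials only, the frame is approximate; its size grows with the accuracy, so the error
  must be bounded independently of the size, and a positive summand must be bounded in norm by the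
  whole sum. This is the main use of the order on \<open>A\<close>. Identities in the sequence
  algebra hold only pointwise in the limit. On a finite-dimensional algebra they become uniform, and
  the tolerance of the stability theorem depends on the source, a norm bound and the accuracy, never
  on the target. The regular trace is preferred to other traces because the products of its basis
  and dual basis add up to exactly 1.\<close>

lemma adj_sum: "adj (sum f I) = (\<Sum>i\<in>I. adj (f i :: 'a::cstar_algebra))"
  by (induction I rule: infinite_finite_induct) (simp_all add: adj_add)

lemma adj_scaleR: "adj (r *\<^sub>R x) = r *\<^sub>R adj (x :: 'a::cstar_algebra)"
  by (simp add: scaleR_scaleC adj_scaleC)

lemma bounded_linear_adj: "bounded_linear (adj :: 'a \<Rightarrow> 'a::cstar_algebra)"
  by (rule bounded_linear_intro[where K = 1]) (simp_all add: adj_add adj_scaleR)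

lemmas tendsto_adj = bounded_linear.tendsto[OF bounded_linear_adj]

lemma bounded_bilinear_scaleC:
  "bounded_bilinear (scaleC :: complex \<Rightarrow> 'a \<Rightarrow> 'a::cstar_algebra)"
proof
  show "\<exists>K. \<forall>a b. norm (a *\<^sub>C b :: 'a) \<le> norm a * norm b * K"
    by (rule exI[of _ 1]) (simp add: norm_scaleC)
  show "(r *\<^sub>R a) *\<^sub>C (b :: 'a) = r *\<^sub>R a *\<^sub>C b" for r a b
    by (simp add: scaleR_conv_of_real[where 'a=complex] scaleR_scaleC[where 'a='a] scaleC_scaleC)
  show "a *\<^sub>C r *\<^sub>R b = r *\<^sub>R a *\<^sub>C (b :: 'a)" for r a b
    by (simp add: scaleR_scaleC scaleC_scaleC mult.commute)
qed (simp_all add: scaleC_add_left scaleC_add_right)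

lemmas tendsto_scaleC = bounded_bilinear.tendsto[OF bounded_bilinear_scaleC]

lemma adj_mult_self_eq_0: "adj x * x = 0 \<longleftrightarrow> x = (0 :: 'a::cstar_algebra)"
  by (metis mult_zero_right norm_adj_mult_self norm_eq_zero zero_eq_power2)

lemma norm_selfadj_square: "adj h = h \<Longrightarrow> norm (h * h) = (norm (h :: 'a::cstar_algebra))\<^sup>2"
  using norm_adj_mult_self[of h] by simp

text \<open>Each use of the C*-identity doubles the exponent, hence powers of two only. Together
  with \<open>le_of_power_bound\<close> this replaces the spectral radius formula: a bound for all
  these powers up to a fixed constant yields the bound without the constant.\<close>

lemma norm_selfadj_power:
  assumes "adj h = (h :: 'a::cstar_algebra)"
  shows "norm (h ^ (2 ^ k)) = norm h ^ (2 ^ k)"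
proof -
  have "adj (h ^ (2 ^ k)) = h ^ (2 ^ k) \<and> norm (h ^ (2 ^ k)) = norm h ^ (2 ^ k)"
  proof (induction k)
    case (Suc k)
    have eq: "h ^ (2 ^ Suc k) = h ^ (2 ^ k) * h ^ (2 ^ k)"
      by (simp add: power_add[symmetric] mult_2)
    with Suc show ?case
      by (simp only: eq adj_mult norm_selfadj_square)
         (simp add: power2_eq_square power_add[symmetric] mult_2)
  qed (simp add: assms)
  then show ?thesis ..
qed

lemma le_of_power_bound:
  fixes a r :: real
  assumes "0 \<le> a" "0 \<le> r" and bound: "\<And>k. a ^ (2 ^ k) \<le> C * r ^ (2 ^ k)"
  shows "a \<le> r"
proof (rule ccontr)
  assume "\<not> a \<le> r"
  then have "a > r" by simp
  show False
  proof (cases "r = 0")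
    case True
    then show False
      using bound[of 0] \<open>a > r\<close> by simp
  next
    case False
    then have "r > 0" using assms by simp
    have le: "(a / r) ^ (2 ^ k) \<le> C" for k
      using bound[of k] \<open>r > 0\<close> by (simp add: power_divide divide_simps)
    have "1 < a / r" using \<open>a > r\<close> \<open>r > 0\<close> by simp
    then obtain n where n: "C < (a / r) ^ n"
      using real_arch_pow by blast
    have "(a / r) ^ n \<le> (a / r) ^ (2 ^ n)"
      using \<open>1 < a / r\<close> by (intro power_increasing) (auto simp: less_imp_le)
    with n le[of n] show False by simp
  qed
qed


section \<open>Finite-dimensional algebras\<close>

text \<open>The unit is that of the ambient algebra. Closedness is a consequence, see
  \<open>fdalg_closed\<close>.\<close>

definition fdalg :: "'a::cstar_algebra set \<Rightarrow> bool" where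
  "fdalg B \<longleftrightarrow> cvec.subspace B \<and> (\<forall>x\<in>B. \<forall>y\<in>B. x * y \<in> B) \<and> (\<forall>x\<in>B. adj x \<in> B) \<and> 1 \<in> B \<and>
     finite_dim B"

lemma fdalgD:
  assumes "fdalg B"
  shows "cvec.subspace B" "\<And>x y. x \<in> B \<Longrightarrow> y \<in> B \<Longrightarrow> x * y \<in> B" "\<And>x. x \<in> B \<Longrightarrow> adj x \<in> B"
    "1 \<in> B" "finite_dim B" "0 \<in> B"
    "\<And>x y. x \<in> B \<Longrightarrow> y \<in> B \<Longrightarrow> x + y \<in> B" "\<And>x y. x \<in> B \<Longrightarrow> y \<in> B \<Longrightarrow> x - y \<in> B"
    "\<And>c x. x \<in> B \<Longrightarrow> c *\<^sub>C x \<in> B" "\<And>r x. x \<in> B \<Longrightarrow> r *\<^sub>R x \<in> B"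
    "\<And>f I. (\<And>i. i \<in> I \<Longrightarrow> f i \<in> B) \<Longrightarrow> sum f I \<in> B"
  using assms
  by (auto simp: fdalg_def scaleR_scaleC cvec.subspace_0 cvec.subspace_add cvec.subspace_diff
      cvec.subspace_scale cvec.subspace_sum)

section \<open>Linear maps on a subspace and the trace of the regular representation\<close>

definition lin_on :: "'a::cstar_algebra set \<Rightarrow> ('a \<Rightarrow> 'a) \<Rightarrow> bool" where
  "lin_on B f \<longleftrightarrow> (\<forall>x\<in>B. \<forall>y\<in>B. f (x + y) = f x + f y) \<and> (\<forall>c. \<forall>x\<in>B. f (c *\<^sub>C x) = c *\<^sub>C f x)"

lemma lin_onD:
  assumes "lin_on B f"
  shows "\<And>x y. x \<in> B \<Longrightarrow> y \<in> B \<Longrightarrow> f (x + y) = f x + f y"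
    "\<And>c x. x \<in> B \<Longrightarrow> f (c *\<^sub>C x) = c *\<^sub>C f x"
  using assms by (auto simp: lin_on_def)

lemma lin_on_sum:
  assumes "cvec.subspace B" "lin_on B f" "\<And>i. i \<in> I \<Longrightarrow> g i \<in> B"
  shows "f (\<Sum>i\<in>I. c i *\<^sub>C g i) = (\<Sum>i\<in>I. c i *\<^sub>C f (g i))"
proof -
  have f0: "f 0 = 0"
    using lin_onD(2)[OF assms(2) cvec.subspace_0[OF assms(1)], of 0] by simp
  show ?thesis
    using assms(3)
  proof (induction I rule: infinite_finite_induct)
    case (insert i I)
    then have "c i *\<^sub>C g i \<in> B" "(\<Sum>i\<in>I. c i *\<^sub>C g i) \<in> B"
      by (auto intro!: cvec.subspace_scale cvec.subspace_sum assms(1))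
    with insert show ?case
      by (simp add: lin_onD[OF assms(2)])
  qed (simp_all add: f0)
qed

lemma lin_on_diff:
  assumes "cvec.subspace B" "lin_on B f" "x \<in> B" "y \<in> B"
  shows "f (x - y) = f x - f y"
proof -
  have "f (x - y) + f y = f x"
    using lin_onD(1)[OF assms(2), of "x - y" y] assms cvec.subspace_diff by fastforce
  then show ?thesis by (simp add: algebra_simps)
qed

text \<open>Allowing two different bases gives two facts at once: with \<open>Y\<close> the
  identity, independence of the basis; with \<open>S = T\<close>, cyclicity. The reason is the swap
  of a double sum of matrix entries.\<close>

lemma trace_swap:
  fixes S T :: "'a::cstar_algebra set"
  assumes S: "cvec.independent S" "finite S" "cvec.span S = B"
    and T: "cvec.independent T" "finite T" "cvec.span T = B"
    and X: "lin_on B X" "\<And>x. x \<in> B \<Longrightarrow> X x \<in> B" and Y: "lin_on B Y" "\<And>x. x \<in> B \<Longrightarrow> Y x \<in> B"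
  shows "(\<Sum>b\<in>S. cvec.representation S (X (Y b)) b) = (\<Sum>t\<in>T. cvec.representation T (Y (X t)) t)"
proof -
  have sub: "cvec.subspace B" using S(3) cvec.subspace_span by metis
  have key: "cvec.representation S (X z) b =
      (\<Sum>t\<in>T. cvec.representation T z t * cvec.representation S (X t) b)"
    if S: "cvec.independent S" "finite S" "cvec.span S = B"
    and T: "cvec.independent T" "finite T" "cvec.span T = B"
    and X: "lin_on B X" "\<And>x. x \<in> B \<Longrightarrow> X x \<in> B" and z: "z \<in> B" for S T X z b
  proof -
    have TB: "t \<in> B" if "t \<in> T" for t
      using T(3) that cvec.span_base by metis
    have "z = (\<Sum>t\<in>T. cvec.representation T z t *\<^sub>C t)"
      using cvec.sum_representation_eq[OF T(1), of z T] T z by simp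
    then have "X z = (\<Sum>t\<in>T. cvec.representation T z t *\<^sub>C X t)"
      using lin_on_sum[OF sub X(1), of T "\<lambda>t. t" "cvec.representation T z"] TB by metis
    moreover have "cvec.representation S (\<Sum>t\<in>T. cvec.representation T z t *\<^sub>C X t) =
        (\<lambda>b. \<Sum>t\<in>T. cvec.representation T z t * cvec.representation S (X t) b)"
    proof (subst cvec.representation_sum[OF S(1)])
      show "cvec.representation T z t *\<^sub>C X t \<in> cvec.span S" if "t \<in> T" for t
        using TB[OF that] X(2) S(3) by (metis cvec.span_scale)
      show "(\<lambda>b. \<Sum>t\<in>T. cvec.representation S (cvec.representation T z t *\<^sub>C X t) b) =
          (\<lambda>b. \<Sum>t\<in>T. cvec.representation T z t * cvec.representation S (X t) b)"
        using TB X(2) S by (intro ext sum.cong refl) (simp add: cvec.representation_scale)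
    qed
    ultimately show ?thesis by simp
  qed
  have SB: "b \<in> B" if "b \<in> S" for b using S(3) that cvec.span_base by metis
  have TB: "t \<in> B" if "t \<in> T" for t using T(3) that cvec.span_base by metis
  have "(\<Sum>b\<in>S. cvec.representation S (X (Y b)) b) =
      (\<Sum>b\<in>S. \<Sum>t\<in>T. cvec.representation T (Y b) t * cvec.representation S (X t) b)"
    using SB Y(2) by (intro sum.cong refl key[OF S T X]) auto
  also have "\<dots> = (\<Sum>t\<in>T. \<Sum>b\<in>S. cvec.representation S (X t) b * cvec.representation T (Y b) t)"
    by (subst sum.swap) (simp add: mult.commute)
  also have "\<dots> = (\<Sum>t\<in>T. cvec.representation T (Y (X t)) t)"
    using TB X(2) by (intro sum.cong refl key[OF T S Y, symmetric]) auto
  finally show ?thesis .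
qed

definition fb :: "'a::cstar_algebra set \<Rightarrow> 'a set" where
  "fb B = (SOME S. finite S \<and> cvec.independent S \<and> cvec.span S = B)"

lemma fb:
  assumes "fdalg B"
  shows "finite (fb B)" "cvec.independent (fb B)" "cvec.span (fb B) = B"
proof -
  obtain S0 where S0: "finite S0" "B = cvec.span S0"
    using fdalgD(5)[OF assms] unfolding finite_dim_def by blast
  obtain S where S: "S \<subseteq> S0" "cvec.independent S" "S0 \<subseteq> cvec.span S"
    using cvec.maximal_independent_subset by metis
  have "cvec.span S = B"
    using S S0(2) by (metis cvec.span_mono cvec.span_span subset_antisym)
  then have "\<exists>S. finite S \<and> cvec.independent S \<and> cvec.span S = B"
    using S S0 finite_subset by blast
  from someI_ex[OF this]
  show "finite (fb B)" "cvec.independent (fb B)" "cvec.span (fb B) = B"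
    unfolding fb_def by auto
qed

lemma fb_mem: "fdalg B \<Longrightarrow> s \<in> fb B \<Longrightarrow> s \<in> B"
  using fb(3) cvec.span_base by metis

text \<open>The trace of left multiplication by \<open>x\<close> on \<open>B\<close>, that is, the
  character of the left regular representation.\<close>

definition ftr :: "'a::cstar_algebra set \<Rightarrow> 'a \<Rightarrow> complex" where
  "ftr B x = (\<Sum>b\<in>fb B. cvec.representation (fb B) (x * b) b)"

lemma ftr_add:
  assumes B: "fdalg B" and "x \<in> B" "y \<in> B"
  shows "ftr B (x + y) = ftr B x + ftr B y"
proof -
  have "cvec.representation (fb B) ((x + y) * b) b =
      cvec.representation (fb B) (x * b) b + cvec.representation (fb B) (y * b) b" if "b \<in> fb B" for b
    using assms fb[OF B] fb_mem[OF B that] fdalgD(2)[OF B]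
    by (simp add: distrib_right cvec.representation_add)
  then show ?thesis by (simp add: ftr_def sum.distrib)
qed

lemma ftr_scaleC:
  assumes B: "fdalg B" and "x \<in> B"
  shows "ftr B (c *\<^sub>C x) = c * ftr B x"
proof -
  have "cvec.representation (fb B) ((c *\<^sub>C x) * b) b = c * cvec.representation (fb B) (x * b) b"
    if "b \<in> fb B" for b
    using assms fb[OF B] fb_mem[OF B that] fdalgD(2)[OF B]
    by (simp add: mult_scaleC_left cvec.representation_scale)
  then show ?thesis by (simp add: ftr_def sum_distrib_left)
qed

lemma ftr_scaleR: "fdalg B \<Longrightarrow> x \<in> B \<Longrightarrow> ftr B (r *\<^sub>R x) = of_real r * ftr B x"
  by (simp add: scaleR_scaleC ftr_scaleC)

lemma ftr_0: "fdalg B \<Longrightarrow> ftr B 0 = 0"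
  using ftr_scaleC[of B 0 0] fdalgD(6) by force

lemma ftr_diff: "fdalg B \<Longrightarrow> x \<in> B \<Longrightarrow> y \<in> B \<Longrightarrow> ftr B (x - y) = ftr B x - ftr B y"
  using ftr_add[of B "x - y" y] fdalgD(8) by fastforce

lemma ftr_sum:
  assumes "fdalg B" "\<And>i. i \<in> I \<Longrightarrow> f i \<in> B"
  shows "ftr B (sum f I) = (\<Sum>i\<in>I. ftr B (f i))"
  using assms(2)
proof (induction I rule: infinite_finite_induct)
  case (insert i I)
  then show ?case
    using ftr_add[OF assms(1), of "f i" "sum f I"] fdalgD(11)[OF assms(1), of I f] by simp
qed (simp_all add: ftr_0[OF assms(1)])

lemma lin_on_mult: "lin_on B ((*) x)"
  by (simp add: lin_on_def distrib_left mult_scaleC_right)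

lemma ftr_comm:
  assumes "fdalg B" "x \<in> B" "y \<in> B"
  shows "ftr B (x * y) = ftr B (y * x)"
  using trace_swap[OF fb(2,1,3)[OF assms(1)] fb(2,1,3)[OF assms(1)] lin_on_mult _ lin_on_mult, of x y]
    assms fdalgD(2) by (fastforce simp: ftr_def mult.assoc)

text \<open>Left multiplication by \<open>p\<close> projects \<open>B\<close> onto
  \<open>p B\<close>, so its trace is the dimension of \<open>p B\<close>: in a basis
  \<open>T\<close> extending a basis \<open>S1\<close> of \<open>p B\<close> the diagonal entries
  are 1 on \<open>S1\<close> and 0 elsewhere.\<close>

lemma ftr_idem:
  assumes B: "fdalg B" and p: "p \<in> B" "p * p = p" "p \<noteq> 0"
  obtains n :: nat where "ftr B p = of_nat n" "n > 0"
proof -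
  let ?V = "((*) p) ` B"
  have V: "cvec.subspace ?V"
  proof (rule cvec.subspaceI)
    show "0 \<in> ?V" using fdalgD(6)[OF B] by (metis imageI mult_zero_right)
    show "x + y \<in> ?V" if "x \<in> ?V" "y \<in> ?V" for x y
      using that fdalgD(7)[OF B] by (auto simp: distrib_left[symmetric])
    show "c *\<^sub>C x \<in> ?V" if "x \<in> ?V" for c x
      using that fdalgD(9)[OF B] by (auto simp: mult_scaleC_right[symmetric])
  qed
  have VB: "?V \<subseteq> B" using fdalgD(2)[OF B p(1)] by auto
  obtain S1 where S1: "S1 \<subseteq> ?V" "cvec.independent S1" "?V \<subseteq> cvec.span S1"
    using cvec.maximal_independent_subset by metis
  have spS1: "cvec.span S1 = ?V"
    using S1 V by (metis cvec.span_minimal subset_antisym)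
  obtain T where T: "S1 \<subseteq> T" "T \<subseteq> B" "cvec.independent T" "B \<subseteq> cvec.span T"
    using cvec.maximal_independent_subset_extend[of S1 B] S1 VB by blast
  have spT: "cvec.span T = B"
    using T fdalgD(1)[OF B] by (metis cvec.span_minimal subset_antisym)
  have finT: "finite T"
    using cvec.independent_span_bound[OF fb(1)[OF B] T(3)] T(2) fb(3)[OF B] by blast
  \<comment> \<open>\<open>trace_swap\<close> with multiplication by 1 as the second map is the
    change of basis from \<open>fb B\<close> to \<open>T\<close>.\<close>
  have eq: "ftr B p = (\<Sum>t\<in>T. cvec.representation T (p * t) t)"
    using trace_swap[OF fb(2,1,3)[OF B] T(3) finT spT lin_on_mult[of B p] _ lin_on_mult[of B 1]]
      fdalgD(2)[OF B p(1)] by (simp add: ftr_def)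
  have "cvec.representation T (p * t) t = (if t \<in> S1 then 1 else 0)" if "t \<in> T" for t
  proof (cases "t \<in> S1")
    case True
    then obtain b where "t = p * b" using S1(1) by auto
    then have "p * t = t" by (metis mult.assoc p(2))
    then show ?thesis
      using True that T(3) by (simp add: cvec.representation_basis)
  next
    case False
    have "p * t \<in> cvec.span S1" using spS1 that T(2) by auto
    then have "cvec.representation T (p * t) = cvec.representation S1 (p * t)"
      using cvec.representation_extend T by blast
    then show ?thesis using False cvec.representation_ne_zero by force
  qed
  then have "ftr B p = (\<Sum>t\<in>T. if t \<in> S1 then 1 else 0)"
    by (simp add: eq)
  also have "\<dots> = of_nat (card S1)"
    using finT T(1) by (simp add: sum.If_cases Int_absorb1)
  finally have "ftr B p = of_nat (card S1)" .
  moreover have "card S1 > 0"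
  proof -
    have "p \<in> ?V" using p by (metis imageI)
    then have "S1 \<noteq> {}" using spS1 p(3) by auto
    then show ?thesis using finT T(1) finite_subset by (simp add: card_gt_0_iff) blast
  qed
  ultimately show ?thesis using that by blast
qed

section \<open>Polynomials in one element and the spectral theorem\<close>

definition pev :: "'a::cstar_algebra \<Rightarrow> complex poly \<Rightarrow> 'a" where
  "pev h q = fold_coeffs (\<lambda>a b. a *\<^sub>C 1 + h * b) q 0"

lemma pev_0 [simp]: "pev h 0 = 0"
  by (simp add: pev_def)

lemma pev_pCons: "pev h (pCons a q) = a *\<^sub>C 1 + h * pev h q"
  by (cases "q = 0 \<and> a = 0") (auto simp: pev_def)

lemma pev_add: "pev h (p + q) = pev h p + pev h q"
  by (induction p q rule: poly_induct2) (simp_all add: pev_pCons scaleC_add_left algebra_simps)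

lemma pev_smult: "pev h (smult c q) = c *\<^sub>C pev h q"
  by (induction q) (simp_all add: pev_pCons scaleC_add_right mult_scaleC_right scaleC_scaleC)

lemma pev_linear_mult: "pev h ([:- c, 1:] * q) = (h - c *\<^sub>C 1) * pev h q"
proof -
  have "[:- c, 1:] * q = smult (- c) q + pCons 0 q" by simp
  then show ?thesis
    by (simp only: pev_add pev_smult pev_pCons)
       (simp add: mult_scaleC_left left_diff_distrib)
qed

lemma pev_commute: "pev h q * h = h * pev h q"
  by (induction q) (simp_all add: pev_pCons algebra_simps mult_scaleC_left mult_scaleC_right)

lemma pev_monom: "pev h (monom c n) = c *\<^sub>C h ^ n"
  by (induction n) (simp_all add: monom_0 monom_Suc pev_pCons mult_scaleC_right)

lemma pev_sum: "pev h (sum f I) = (\<Sum>i\<in>I. pev h (f i))"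
  by (induction I rule: infinite_finite_induct) (simp_all add: pev_add)

lemma fdalg_power: "fdalg B \<Longrightarrow> h \<in> B \<Longrightarrow> h ^ n \<in> B"
  by (induction n) (simp_all add: fdalgD)

lemma annihilating_poly:
  assumes B: "fdalg B" and h: "h \<in> B"
  obtains q where "q \<noteq> 0" "pev h q = 0"
proof -
  define n where "n = card (fb B)"
  have "\<exists>q. q \<noteq> 0 \<and> pev h q = 0"
  proof (cases "inj_on (\<lambda>i. h ^ i) {..n}")
    case True
    let ?S = "(\<lambda>i. h ^ i) ` {..n}"
    have "card ?S = Suc n" using True by (simp add: card_image)
    moreover have "?S \<subseteq> cvec.span (fb B)"
      using fdalg_power[OF B h] fb(3)[OF B] by auto
    ultimately have "cvec.dependent ?S"
      using cvec.independent_span_bound[OF fb(1)[OF B], of ?S] n_def by linarith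
    then obtain u i where u: "i \<le> n" "u (h ^ i) \<noteq> 0" "(\<Sum>v\<in>?S. u v *\<^sub>C v) = 0"
      using cvec.dependent_finite[of ?S] by auto
    define q where "q = (\<Sum>i\<le>n. monom (u (h ^ i)) i)"
    have "pev h q = (\<Sum>i\<le>n. u (h ^ i) *\<^sub>C h ^ i)"
      by (simp add: q_def pev_sum pev_monom)
    also have "\<dots> = (\<Sum>v\<in>?S. u v *\<^sub>C v)"
      using True by (simp add: sum.reindex)
    finally have "pev h q = 0" using u(3) by simp
    moreover have "coeff q i = u (h ^ i)"
      using u(1) by (simp add: q_def coeff_sum if_distrib cong: if_cong)
    then have "q \<noteq> 0" using u(2) by auto
    ultimately show ?thesis by blast
  next
    \<comment> \<open>Coinciding powers shrink the set whose dependence is used above; here the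
      relation is written down directly, as the difference of two monomials.\<close>
    case False
    then obtain i j where ij: "i \<noteq> j" "h ^ i = h ^ j"
      unfolding inj_on_def by auto
    let ?q = "monom 1 i + smult (- 1) (monom 1 j) :: complex poly"
    have "pev h ?q = 0"
      using ij(2) by (simp only: pev_add pev_smult pev_monom) simp
    moreover have "coeff ?q i = 1" using ij(1)[symmetric] by simp
    then have "?q \<noteq> 0" by (metis coeff_0 zero_neq_one)
    ultimately show ?thesis by blast
  qed
  then show ?thesis using that by blast
qed

text \<open>Normality lets N (N y) be split off from the square of \<open>adj N * N * y\<close>; the
  C*-identity is then applied twice. This excludes Jordan blocks, so generalized eigenvectors are
  eigenvectors.\<close>

lemma normal_kernel_square:
  fixes N y :: "'a::cstar_algebra"
  assumes normal: "adj N * N = N * adj N" and "N * (N * y) = 0"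
  shows "N * y = 0"
proof -
  have "adj (adj N * N * y) * (adj N * N * y) = adj y * (adj N * (N * adj N) * N * y)"
    by (simp add: adj_mult adj_adj mult.assoc)
  also have "\<dots> = adj y * (adj N * (adj N * N) * N * y)"
    by (simp only: normal[symmetric])
  also have "\<dots> = adj y * adj N * adj N * (N * (N * y))"
    by (simp only: mult.assoc)
  finally have "adj (adj N * N * y) * (adj N * N * y) = 0"
    using assms(2) by simp
  then have "adj N * N * y = 0"
    by (simp only: adj_mult_self_eq_0)
  then have "adj (N * y) * (N * y) = 0"
    by (simp add: adj_mult mult.assoc)
  then show ?thesis by (simp add: adj_mult_self_eq_0)
qed

text \<open>Induction on the degree. For a root m of \<open>q\<close> the induction hypothesis
  decomposes (h - m) y; dividing the components with l \<noteq> m by l - m and subtracting them from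
  y leaves a vector killed by the square of h - m, hence by h - m itself.\<close>

lemma eigen_decomposition:
  assumes B: "fdalg B" and h: "h \<in> B" "adj h = h"
    and "q \<noteq> 0" "y \<in> B" "pev h q * y = 0"
  shows "\<exists>L f. finite L \<and> y = (\<Sum>l\<in>L. f l) \<and> (\<forall>l\<in>L. f l \<in> B \<and> h * f l = l *\<^sub>C f l)"
  using assms(4-)
proof (induction "degree q" arbitrary: q y)
  case 0
  then obtain c where "q = [:c:]" "c \<noteq> 0"
    using degree_eq_zeroE by (metis pCons_0_0)
  with 0 have "c *\<^sub>C y = 0" by (simp add: pev_pCons mult_scaleC_left)
  then have "y = 0" using \<open>c \<noteq> 0\<close> by simp
  then show ?case by (intro exI[of _ "{}"]) simp
next
  case (Suc n)
  then have "\<not> constant (poly q)" by (simp add: constant_degree)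
  then obtain m where "poly q m = 0"
    using fundamental_theorem_of_algebra by blast
  then obtain r where r: "q = [:- m, 1:] * r"
    by (metis poly_eq_0_iff_dvd dvdE)
  with Suc.prems have "r \<noteq> 0" by auto
  have deg: "n = degree r"
    using Suc.hyps(2) r \<open>r \<noteq> 0\<close> by (simp add: degree_mult_eq del: mult_pCons_left)
  let ?N = "h - m *\<^sub>C 1"
  have comm: "?N * pev h r = pev h r * ?N"
    by (simp add: left_diff_distrib right_diff_distrib pev_commute mult_scaleC_left mult_scaleC_right)
  have y': "?N * y \<in> B"
    using fdalgD[OF B] h Suc.prems by simp
  have "pev h r * (?N * y) = 0"
    using Suc.prems(3) unfolding r pev_linear_mult comm by (simp add: mult.assoc)
  from Suc.hyps(1)[OF deg \<open>r \<noteq> 0\<close> y' this]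
  obtain L f where L: "finite L" "?N * y = (\<Sum>l\<in>L. f l)"
    and f: "\<And>l. l \<in> L \<Longrightarrow> f l \<in> B" "\<And>l. l \<in> L \<Longrightarrow> h * f l = l *\<^sub>C f l"
    by blast
  \<comment> \<open>This inverts \<open>?N\<close> on the eigenspaces with l \<noteq> m. At l = m
    the factor is 0 by convention; that value enters no sum below.\<close>
  define g where "g l = (1 / (l - m)) *\<^sub>C f l" for l
  define z where "z = y - (\<Sum>l\<in>L - {m}. g l)"
  have gB: "g l \<in> B" if "l \<in> L" for l
    using f that fdalgD(9)[OF B] by (simp add: g_def)
  have zB: "z \<in> B"
    unfolding z_def using gB Suc.prems fdalgD(8,11)[OF B] by (metis (no_types, lifting) DiffD1)
  have Nf: "?N * f l = (l - m) *\<^sub>C f l" if "l \<in> L" for l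
    using f that by (simp add: left_diff_distrib mult_scaleC_left cvec.scale_left_diff_distrib)
  have "?N * g l = f l" if "l \<in> L - {m}" for l
    using Nf[of l] that by (simp add: g_def mult_scaleC_right scaleC_scaleC scaleC_one)
  then have "?N * (\<Sum>l\<in>L - {m}. g l) = (\<Sum>l\<in>L - {m}. f l)"
    by (simp add: sum_distrib_left)
  then have "?N * z = (\<Sum>l\<in>L. f l) - (\<Sum>l\<in>L - {m}. f l)"
    by (simp add: z_def right_diff_distrib[of ?N] L(2))
  then have Nz: "?N * z = (if m \<in> L then f m else 0)"
    using L(1) by (simp add: sum.remove[of L m])
  have "?N * (?N * z) = 0"
    unfolding Nz using Nf[of m] by auto
  moreover have "adj ?N * ?N = ?N * adj ?N"
    by (simp add: adj_diff adj_scaleC h algebra_simps mult_scaleC_left mult_scaleC_right scaleC_scaleC)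
  ultimately have "?N * z = 0"
    by (metis normal_kernel_square)
  then have hz: "h * z = m *\<^sub>C z"
    by (simp add: left_diff_distrib mult_scaleC_left)
  define k where "k l = (if l = m then z else g l)" for l
  have "(\<Sum>l\<in>insert m (L - {m}). k l) = z + (\<Sum>l\<in>L - {m}. g l)"
    using L(1) by (subst sum.insert) (auto simp: k_def intro!: sum.cong)
  then have "y = (\<Sum>l\<in>insert m (L - {m}). k l)"
    by (simp add: z_def)
  moreover have "k l \<in> B \<and> h * k l = l *\<^sub>C k l" if "l \<in> insert m (L - {m})" for l
    using that hz zB gB f by (auto simp: k_def g_def mult_scaleC_right scaleC_scaleC mult.commute)
  ultimately show ?case
    using L(1) by (intro exI[of _ "insert m (L - {m})"] exI[of _ k]) auto
qed

text \<open>Nonzero projections make every \<open>l\<close> in \<open>L\<close> an eigenvalue, which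
  bounds it by the norm in \<open>spectral_resolution_abs_le\<close>.\<close>

definition spectral_resolution ::
  "'a::cstar_algebra set \<Rightarrow> 'a \<Rightarrow> real set \<Rightarrow> (real \<Rightarrow> 'a) \<Rightarrow> bool" where
  "spectral_resolution B h L p \<longleftrightarrow> finite L \<and>
     (\<forall>l\<in>L. p l \<in> B \<and> adj (p l) = p l \<and> p l * p l = p l \<and> p l \<noteq> 0) \<and>
     (\<forall>l\<in>L. \<forall>k\<in>L. l \<noteq> k \<longrightarrow> p l * p k = 0) \<and> (\<Sum>l\<in>L. p l) = 1 \<and> h = (\<Sum>l\<in>L. l *\<^sub>R p l)"

text \<open>Decompose the unit into eigenvectors f l of left multiplication by \<open>h\<close>.
  Self-adjointness makes the eigenvalues real and \<open>adj (f m) * f l\<close> zero for l \<noteq>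
  m; multiplying the adjoint of the decomposition by f l then gives
  \<open>f l = adj (f l) * f l\<close>, so each component is a projection.\<close>

theorem spectral_resolution_exists:
  assumes B: "fdalg B" and h: "h \<in> B" "adj h = h"
  obtains L p where "spectral_resolution B h L p"
proof -
  obtain q where q: "q \<noteq> 0" "pev h q = 0"
    using annihilating_poly[OF B h(1)] .
  then obtain L0 f where L0: "finite L0" "1 = (\<Sum>l\<in>L0. f l)"
    and f0: "\<And>l. l \<in> L0 \<Longrightarrow> f l \<in> B \<and> h * f l = l *\<^sub>C f l"
    using eigen_decomposition[OF B h q(1) fdalgD(4)[OF B]] by auto
  define L where "L = {l \<in> L0. f l \<noteq> 0}"
  have "(\<Sum>l\<in>L. f l) = (\<Sum>l\<in>L0. f l)"
    unfolding L_def by (rule sum.mono_neutral_left) (use L0 in auto)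
  then have L: "finite L" "1 = (\<Sum>l\<in>L. f l)"
    using L0 by (simp_all add: L_def)
  have f: "f l \<in> B" "h * f l = l *\<^sub>C f l" "f l \<noteq> 0" if "l \<in> L" for l
    using that f0 by (auto simp: L_def)
  have swap: "l *\<^sub>C (adj (f m) * f l) = cnj m *\<^sub>C (adj (f m) * f l)" if "l \<in> L" "m \<in> L" for l m
  proof -
    have "l *\<^sub>C (adj (f m) * f l) = adj (f m) * (h * f l)"
      using f that by (simp add: mult_scaleC_right)
    also have "\<dots> = adj (h * f m) * f l"
      by (simp add: adj_mult h mult.assoc)
    finally show ?thesis using f that by (simp add: adj_scaleC mult_scaleC_left)
  qed
  have real: "cnj l = l" if "l \<in> L" for l
    using swap[OF that that] f(3)[OF that] by (simp add: adj_mult_self_eq_0)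
  have orth: "adj (f m) * f l = 0" if "l \<in> L" "m \<in> L" "l \<noteq> m" for l m
    using swap[OF that(1,2)] real[OF that(2)] that(3) by simp
  have sa: "adj (f l) * f l = f l" if "l \<in> L" for l
  proof -
    have "1 = (\<Sum>m\<in>L. adj (f m))"
      using arg_cong[OF L(2), of adj] by (simp add: adj_sum)
    then have "f l = (\<Sum>m\<in>L. adj (f m)) * f l" by simp
    also have "\<dots> = (\<Sum>m\<in>L. adj (f m) * f l)" by (simp add: sum_distrib_right)
    also have "\<dots> = adj (f l) * f l"
    proof -
      have "(\<Sum>m\<in>L - {l}. adj (f m) * f l) = 0"
        using orth that by (intro sum.neutral) auto
      then show ?thesis by (subst sum.remove[OF L(1) that]) simp
    qed
    finally show ?thesis by simp
  qed
  then have sa': "adj (f l) = f l" if "l \<in> L" for l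
    using that by (metis adj_adj adj_mult)
  define p where "p r = f (complex_of_real r)" for r
  have re: "complex_of_real (Re l) = l" if "l \<in> L" for l
    using real[OF that] by (simp add: complex_eq_iff)
  then have inj: "inj_on Re L"
    by (metis inj_onI)
  have "spectral_resolution B h (Re ` L) p"
    unfolding spectral_resolution_def
  proof (intro conjI ballI impI)
    show "finite (Re ` L)" using L by simp
    show "p l \<in> B" "adj (p l) = p l" "p l * p l = p l" "p l \<noteq> 0" if "l \<in> Re ` L" for l
      using that re f sa sa' by (auto simp: p_def)
    show "p l * p k = 0" if "l \<in> Re ` L" "k \<in> Re ` L" "l \<noteq> k" for l k
      using that re orth sa' by (auto simp: p_def) metis
    show "(\<Sum>l\<in>Re ` L. p l) = 1"
      using L re by (simp add: sum.reindex[OF inj] p_def)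
    have "h = (\<Sum>l\<in>L. h * f l)"
      using L(2) by (metis mult.right_neutral sum_distrib_left)
    then show "h = (\<Sum>l\<in>Re ` L. l *\<^sub>R p l)"
      using re f by (simp add: sum.reindex[OF inj] p_def scaleR_scaleC)
  qed
  then show ?thesis using that by blast
qed

lemma spectral_resolutionD:
  assumes "spectral_resolution B h L p"
  shows "finite L" "\<And>l. l \<in> L \<Longrightarrow> p l \<in> B" "\<And>l. l \<in> L \<Longrightarrow> adj (p l) = p l"
    "\<And>l. l \<in> L \<Longrightarrow> p l * p l = p l" "\<And>l. l \<in> L \<Longrightarrow> p l \<noteq> 0"
    "\<And>l k. l \<in> L \<Longrightarrow> k \<in> L \<Longrightarrow> l \<noteq> k \<Longrightarrow> p l * p k = 0"
    "(\<Sum>l\<in>L. p l) = 1" "h = (\<Sum>l\<in>L. l *\<^sub>R p l)"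
  using assms by (auto simp: spectral_resolution_def)

lemma spectral_resolution_mult:
  assumes R: "spectral_resolution B h L p" and "k \<in> L"
  shows "h * p k = k *\<^sub>R p k"
proof -
  note D = spectral_resolutionD[OF R]
  have "h * p k = (\<Sum>l\<in>L. l *\<^sub>R (p l * p k))"
    by (subst D(8)) (simp add: sum_distrib_right)
  also have "\<dots> = k *\<^sub>R (p k * p k)"
    using D(6) assms(2) by (subst sum.remove[OF D(1) assms(2)]) simp
  finally show ?thesis using D(4) assms(2) by simp
qed

lemma spectral_resolution_power:
  assumes R: "spectral_resolution B h L p"
  shows "h ^ n = (\<Sum>l\<in>L. l ^ n *\<^sub>R p l)"
proof (induction n)
  case 0
  then show ?case using spectral_resolutionD(7)[OF R] by simp
next
  case (Suc n)
  have "h ^ Suc n = (\<Sum>l\<in>L. l ^ n *\<^sub>R (h * p l))"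
    by (simp add: Suc sum_distrib_left)
  then show ?case
    using spectral_resolution_mult[OF R] by (simp add: mult.commute)
qed

text \<open>The projections are not yet known to combine with norm 1. The triangle inequality loses
  the constant \<Sum> \<open>norm (p l)\<close>, the same for all powers of \<open>h\<close>, and
  \<open>le_of_power_bound\<close> removes it.\<close>

lemma spectral_resolution_norm_le:
  assumes R: "spectral_resolution B h L p" and "adj h = h" and le: "\<And>l. l \<in> L \<Longrightarrow> \<bar>l\<bar> \<le> r" and "0 \<le> r"
  shows "norm h \<le> r"
proof (rule le_of_power_bound)
  fix k
  have "norm h ^ 2 ^ k = norm (\<Sum>l\<in>L. l ^ (2 ^ k) *\<^sub>R p l)"
    using norm_selfadj_power[OF assms(2), of k] spectral_resolution_power[OF R, of "2 ^ k"] by simp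
  also have "\<dots> \<le> (\<Sum>l\<in>L. r ^ (2 ^ k) * norm (p l))"
    using le by (intro sum_norm_le) (auto simp: power_abs intro!: mult_right_mono power_mono)
  also have "\<dots> = (\<Sum>l\<in>L. norm (p l)) * r ^ 2 ^ k"
    by (simp add: sum_distrib_left[symmetric])
  finally show "norm h ^ 2 ^ k \<le> (\<Sum>l\<in>L. norm (p l)) * r ^ 2 ^ k" .
qed (use assms in auto)

lemma spectral_resolution_abs_le:
  assumes R: "spectral_resolution B h L p" and "l \<in> L"
  shows "\<bar>l\<bar> \<le> norm h"
proof -
  have "\<bar>l\<bar> * norm (p l) \<le> norm h * norm (p l)"
    using spectral_resolution_mult[OF R assms(2)] norm_mult_ineq[of h "p l"] by simp
  then show ?thesis using spectral_resolutionD(5)[OF R assms(2)] by simp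
qed

section \<open>Positivity, faithfulness and boundedness of the trace\<close>

lemma ftr_proj:
  assumes "fdalg B" "p \<in> B" "p * p = p" "p \<noteq> 0"
  shows "0 < Re (ftr B p)" "Im (ftr B p) = 0"
  using ftr_idem[OF assms] by (metis complex_Re_of_nat of_nat_0_less_iff, metis complex_Im_of_nat)

lemma ftr_resolution:
  assumes B: "fdalg B" and R: "spectral_resolution B h L p"
  shows "ftr B (h ^ n) = of_real (\<Sum>l\<in>L. l ^ n * Re (ftr B (p l)))"
proof -
  note D = spectral_resolutionD[OF R]
  have "ftr B (p l) = of_real (Re (ftr B (p l)))" if "l \<in> L" for l
    using ftr_proj(2)[OF B] D that by (simp add: complex_eq_iff)
  then have "(\<Sum>l\<in>L. of_real (l ^ n) * ftr B (p l)) = of_real (\<Sum>l\<in>L. l ^ n * Re (ftr B (p l)))"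
    by (simp only: of_real_sum of_real_mult) (metis (no_types, lifting) sum.cong)
  moreover have "ftr B (h ^ n) = (\<Sum>l\<in>L. of_real (l ^ n) * ftr B (p l))"
    unfolding spectral_resolution_power[OF R]
    using D(2) fdalgD(10)[OF B] by (subst ftr_sum[OF B]) (auto simp: ftr_scaleR[OF B] simp del: of_real_power)
  ultimately show ?thesis by simp
qed

text \<open>In a spectral resolution the trace of a power of \<open>h\<close> is a sum of powers of
  eigenvalues with the strictly positive weights \<open>ftr B (p l)\<close>; all claims are read off
  from it.\<close>

lemma ftr_selfadj:
  assumes B: "fdalg B" and h: "h \<in> B" "adj h = h"
  shows "Im (ftr B h) = 0" "cmod (ftr B h) \<le> norm h * Re (ftr B 1)"
    "0 \<le> Re (ftr B (h * h))" "Im (ftr B (h * h)) = 0" "ftr B (h * h) = 0 \<Longrightarrow> h = 0"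
proof -
  obtain L p where R: "spectral_resolution B h L p"
    using spectral_resolution_exists[OF assms] .
  note D = spectral_resolutionD[OF R]
  have pos: "Re (ftr B (p l)) > 0" if "l \<in> L" for l
    using ftr_proj D that B by blast
  have 1: "ftr B h = of_real (\<Sum>l\<in>L. l * Re (ftr B (p l)))"
    using ftr_resolution[OF B R, of 1] by simp
  have 2: "ftr B (h * h) = of_real (\<Sum>l\<in>L. l\<^sup>2 * Re (ftr B (p l)))"
    using ftr_resolution[OF B R, of 2] by (simp add: power2_eq_square[of h])
  have 0: "ftr B 1 = of_real (\<Sum>l\<in>L. Re (ftr B (p l)))"
    using ftr_resolution[OF B R, of 0] by simp
  show "Im (ftr B h) = 0" by (simp only: 1 Im_complex_of_real)
  have "cmod (ftr B h) \<le> (\<Sum>l\<in>L. \<bar>l * Re (ftr B (p l))\<bar>)"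
    unfolding 1 norm_of_real by (rule sum_abs)
  also have "\<dots> \<le> (\<Sum>l\<in>L. norm h * Re (ftr B (p l)))"
    using pos spectral_resolution_abs_le[OF R]
    by (intro sum_mono) (simp add: abs_mult less_imp_le mult_right_mono)
  finally show "cmod (ftr B h) \<le> norm h * Re (ftr B 1)"
    unfolding 0 by (simp add: sum_distrib_left)
  show "Im (ftr B (h * h)) = 0" by (simp only: 2 Im_complex_of_real)
  have nn: "0 \<le> l\<^sup>2 * Re (ftr B (p l))" if "l \<in> L" for l
    using pos[OF that] by simp
  then show "0 \<le> Re (ftr B (h * h))"
    unfolding 2 Re_complex_of_real by (rule sum_nonneg)
  assume "ftr B (h * h) = 0"
  then have "l\<^sup>2 * Re (ftr B (p l)) = 0" if "l \<in> L" for l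
    using nn that D(1) sum_nonneg_eq_0_iff[of L "\<lambda>l. l\<^sup>2 * Re (ftr B (p l))"]
    unfolding 2 of_real_eq_0_iff by blast
  then have "l = 0" if "l \<in> L" for l
    using pos that by fastforce
  then have "(\<Sum>l\<in>L. l *\<^sub>R p l) = 0" by (intro sum.neutral) auto
  then show "h = 0" by (subst D(8))
qed

text \<open>Up to sign, \<open>h\<close> and \<open>k\<close> are twice the real and imaginary
  parts. The last identity reduces the trace of \<open>adj x * x\<close> to traces of squares of
  self-adjoint elements.\<close>

lemma cartesian_parts:
  fixes x :: "'a::cstar_algebra"
  defines "h \<equiv> x + adj x" and "k \<equiv> \<i> *\<^sub>C (x - adj x)"
  shows "adj h = h" "adj k = k" "x = (1/2) *\<^sub>C h + (- \<i> / 2) *\<^sub>C k"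
    "h * h + k * k = 2 *\<^sub>C (x * adj x + adj x * x)"
proof -
  show "adj h = h" by (simp add: h_def adj_add adj_adj add.commute)
  show "adj k = k"
    by (simp add: k_def adj_scaleC adj_diff adj_adj cvec.scale_right_diff_distrib
        cvec.scale_minus_left)
  have two: "y + y = 2 *\<^sub>C y" for y :: 'a
    using scaleC_add_left[of 1 1 y] by (simp add: scaleC_one)
  have "(1/2) *\<^sub>C h + (- \<i> / 2) *\<^sub>C k = (1/2) *\<^sub>C (x + x)"
    by (simp add: h_def k_def scaleC_scaleC scaleC_add_right cvec.scale_right_diff_distrib)
  then show "x = (1/2) *\<^sub>C h + (- \<i> / 2) *\<^sub>C k"
    by (simp add: two scaleC_scaleC scaleC_one)
  have "k * k = - ((x - adj x) * (x - adj x))"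
    by (simp add: k_def mult_scaleC_left mult_scaleC_right scaleC_scaleC cvec.scale_minus_left scaleC_one)
  then have "h * h + k * k = (x * adj x + adj x * x) + (x * adj x + adj x * x)"
    by (simp add: h_def algebra_simps)
  then show "h * h + k * k = 2 *\<^sub>C (x * adj x + adj x * x)"
    by (simp only: two)
qed

text \<open>By cyclicity, four times the trace of \<open>adj x * x\<close> is the sum of the traces
  of the squares of the two self-adjoint parts.\<close>

lemma ftr_adj_mult_self:
  assumes B: "fdalg B" and x: "x \<in> B"
  shows "0 \<le> Re (ftr B (adj x * x))" "Im (ftr B (adj x * x)) = 0"
    "ftr B (adj x * x) = 0 \<Longrightarrow> x = 0"
proof -
  define h k where "h = x + adj x" and "k = \<i> *\<^sub>C (x - adj x)"
  note c = cartesian_parts[of x, folded h_def k_def]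
  have mem: "h \<in> B" "k \<in> B" "x * adj x \<in> B" "adj x * x \<in> B" "h * h \<in> B" "k * k \<in> B"
    using x fdalgD[OF B] by (auto simp: h_def k_def)
  have "ftr B (h * h) + ftr B (k * k) = 2 * (ftr B (x * adj x) + ftr B (adj x * x))"
    using arg_cong[OF c(4), of "ftr B"] mem B fdalgD(7)[OF B] by (simp add: ftr_add ftr_scaleC)
  also have "\<dots> = 4 * ftr B (adj x * x)"
    using ftr_comm[OF B x] fdalgD(3)[OF B x] by simp
  finally have eq: "ftr B (h * h) + ftr B (k * k) = 4 * ftr B (adj x * x)" .
  note H = ftr_selfadj[OF B mem(1) c(1)] and K = ftr_selfadj[OF B mem(2) c(2)]
  have re: "Re (ftr B (h * h)) + Re (ftr B (k * k)) = 4 * Re (ftr B (adj x * x))"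
    using arg_cong[OF eq, of Re] by simp
  then show "0 \<le> Re (ftr B (adj x * x))" using H K by linarith
  show "Im (ftr B (adj x * x)) = 0"
    using arg_cong[OF eq, of Im] H K by simp
  assume "ftr B (adj x * x) = 0"
  with re H K have "Re (ftr B (h * h)) = 0" "Re (ftr B (k * k)) = 0" by auto
  then have "h = 0" "k = 0" using H K by (auto simp: complex_eq_iff)
  then show "x = 0" using c(3) by simp
qed

text \<open>The factor 2 is the price of the Cartesian decomposition: two parts of norm at most
  \<open>2 * norm x\<close>, each with weight 1/2.\<close>

lemma ftr_bound:
  assumes B: "fdalg B" and x: "x \<in> B"
  shows "cmod (ftr B x) \<le> 2 * Re (ftr B 1) * norm x"
proof -
  define h k where "h = x + adj x" and "k = \<i> *\<^sub>C (x - adj x)"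
  note c = cartesian_parts[of x, folded h_def k_def]
  have mem: "h \<in> B" "k \<in> B"
    using x fdalgD[OF B] by (auto simp: h_def k_def)
  have nh: "norm h \<le> 2 * norm x" "norm k \<le> 2 * norm x"
    using norm_triangle_ineq[of x "adj x"] norm_triangle_ineq4[of x "adj x"]
    by (simp_all add: h_def k_def norm_scaleC)
  have t1: "Re (ftr B 1) \<ge> 0"
    using ftr_proj(1)[OF B fdalgD(4)[OF B]] by simp
  have "ftr B x = 1/2 * ftr B h + (- \<i> / 2) * ftr B k"
    by (subst c(3)) (simp only: ftr_add[OF B] ftr_scaleC[OF B] fdalgD(9)[OF B] mem)
  then have "cmod (ftr B x) \<le> 1/2 * cmod (ftr B h) + 1/2 * cmod (ftr B k)"
    using norm_triangle_ineq[of "1/2 * ftr B h" "(- \<i> / 2) * ftr B k"] by (simp add: norm_mult norm_divide)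
  also have "\<dots> \<le> 1/2 * (norm h * Re (ftr B 1)) + 1/2 * (norm k * Re (ftr B 1))"
    using ftr_selfadj(2)[OF B mem(1) c(1)] ftr_selfadj(2)[OF B mem(2) c(2)] by linarith
  also have "\<dots> \<le> 2 * Re (ftr B 1) * norm x"
    using mult_right_mono[OF nh(1) t1] mult_right_mono[OF nh(2) t1] by (simp add: algebra_simps)
  finally show ?thesis .
qed

lemma ftr_adj:
  assumes B: "fdalg B" and x: "x \<in> B"
  shows "ftr B (adj x) = cnj (ftr B x)"
proof -
  define h k where "h = x + adj x" and "k = \<i> *\<^sub>C (x - adj x)"
  note c = cartesian_parts[of x, folded h_def k_def]
  have mem: "h \<in> B" "k \<in> B"
    using x fdalgD[OF B] by (auto simp: h_def k_def)
  have re: "cnj (ftr B h) = ftr B h" "cnj (ftr B k) = ftr B k"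
    using ftr_selfadj(1)[OF B] mem c by (simp_all add: complex_eq_iff)
  have "adj x = (1/2) *\<^sub>C h + (\<i> / 2) *\<^sub>C k"
    by (subst c(3)) (simp only: adj_add adj_scaleC c(1,2), simp)
  then have "ftr B (adj x) = 1/2 * ftr B h + (\<i> / 2) * ftr B k"
    by (simp only: ftr_add[OF B] ftr_scaleC[OF B] fdalgD(9)[OF B] mem)
  moreover have "ftr B x = 1/2 * ftr B h + (- \<i> / 2) * ftr B k"
    by (subst c(3)) (simp only: ftr_add[OF B] ftr_scaleC[OF B] fdalgD(9)[OF B] mem)
  ultimately show ?thesis using re by simp
qed

section \<open>Sums of squares and the dual basis\<close>

text \<open>Sums of squares are closed under addition by construction, whereas single squares are so
  only after a square root is taken. The parameter \<open>B\<close> confines the summands to an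
  algebra on which a trace is available.\<close>

inductive_set sos :: "'a::cstar_algebra set \<Rightarrow> 'a set" for B where
  sos_0: "0 \<in> sos B"
| sos_step: "a \<in> sos B \<Longrightarrow> x \<in> B \<Longrightarrow> a + adj x * x \<in> sos B"

lemma sos_square: "x \<in> B \<Longrightarrow> adj x * x \<in> sos B"
  using sos_step[OF sos_0] by fastforce

lemma sos_add: "b \<in> sos B \<Longrightarrow> a \<in> sos B \<Longrightarrow> a + b \<in> sos B"
proof (induction b rule: sos.induct)
  case (sos_step b x)
  then have "(a + b) + adj x * x \<in> sos B" by (intro sos.sos_step) auto
  then show ?case by (simp add: add.assoc)
qed simp

lemma sos_sum: "(\<And>i. i \<in> I \<Longrightarrow> f i \<in> sos B) \<Longrightarrow> sum f I \<in> sos B"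
  by (induction I rule: infinite_finite_induct) (auto intro: sos_0 sos_add)

lemma sos_selfadj: "a \<in> sos B \<Longrightarrow> adj a = a"
  by (induction a rule: sos.induct) (simp_all add: adj_add adj_mult adj_adj)

lemma sos_conj:
  assumes "\<And>x. x \<in> B \<Longrightarrow> x * y \<in> B"
  shows "a \<in> sos B \<Longrightarrow> adj y * a * y \<in> sos B"
proof (induction a rule: sos.induct)
  case (sos_step a x)
  have "adj y * (a + adj x * x) * y = adj y * a * y + adj (x * y) * (x * y)"
    by (simp add: algebra_simps adj_mult)
  then show ?case
    using sos.sos_step[OF sos_step.IH assms[OF sos_step.hyps(2)]] by simp
qed (simp add: sos_0)

lemma sos_mono: "B \<subseteq> C \<Longrightarrow> a \<in> sos B \<Longrightarrow> a \<in> sos C"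
  by (rotate_tac, induction a rule: sos.induct) (auto intro: sos.intros)

lemma sos_subset: "fdalg B \<Longrightarrow> a \<in> sos B \<Longrightarrow> a \<in> B"
  by (rotate_tac, induction a rule: sos.induct) (auto intro: fdalgD)

lemma ftr_sos:
  assumes B: "fdalg B"
  shows "a \<in> sos B \<Longrightarrow> 0 \<le> Re (ftr B a)"
proof (induction a rule: sos.induct)
  case (sos_step a x)
  then have "ftr B (a + adj x * x) = ftr B a + ftr B (adj x * x)"
    using sos_subset[OF B] fdalgD[OF B] by (intro ftr_add B) auto
  then show ?case using sos_step ftr_adj_mult_self(1)[OF B] by simp
qed (simp add: ftr_0[OF B])

lemma sos_scaleR_proj:
  assumes "fdalg B" "p \<in> B" "adj p = p" "p * p = p" "0 \<le> r"
  shows "r *\<^sub>R p \<in> sos B"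
  using sos_square[of "sqrt r *\<^sub>R p" B] assms(2-) fdalgD(10)[OF assms(1,2)]
  by (simp add: adj_scaleR)

text \<open>After diagonalization the coefficients are r - l, nonnegative because l \<le> norm h,
  and have real square roots.\<close>

lemma fdalg_norm_minus_sos:
  assumes B: "fdalg B" and h: "h \<in> B" "adj h = h" and le: "norm h \<le> r"
  shows "r *\<^sub>R 1 - h \<in> sos B"
proof -
  obtain L p where R: "spectral_resolution B h L p"
    using spectral_resolution_exists[OF B h] .
  note D = spectral_resolutionD[OF R]
  have "r *\<^sub>R 1 - h = (\<Sum>l\<in>L. r *\<^sub>R p l) - (\<Sum>l\<in>L. l *\<^sub>R p l)"
    by (simp only: scaleR_sum_right[symmetric] D(7) D(8)[symmetric])
  also have "\<dots> = (\<Sum>l\<in>L. (r - l) *\<^sub>R p l)"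
    by (simp add: scaleR_diff_left sum_subtractf)
  also have "\<dots> \<in> sos B"
    using spectral_resolution_abs_le[OF R] le D
    by (intro sos_sum sos_scaleR_proj B) force+
  finally show ?thesis .
qed

text \<open>Compress by a spectral projection p l of \<open>a\<close>. Both l p and (r - l) p, with
  r the norm of a + b, are sums of squares, the latter because r - a is \<open>b\<close> plus r - (a
  + b). Positivity of the trace gives 0 \<le> l \<le> r.\<close>

lemma fdalg_norm_mono:
  assumes B: "fdalg B" and a: "a \<in> sos B" and b: "b \<in> sos B"
  shows "norm a \<le> norm (a + b)"
proof -
  have aB: "a \<in> B" and bB: "b \<in> B" and sa: "adj a = a" and sb: "adj b = b"
    using a b sos_subset[OF B] sos_selfadj by auto
  obtain L p where R: "spectral_resolution B a L p"
    using spectral_resolution_exists[OF B aB sa] .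
  note D = spectral_resolutionD[OF R]
  define c where "c = a + b"
  define r where "r = norm c"
  have "\<bar>l\<bar> \<le> r" if l: "l \<in> L" for l
  proof -
    let ?p = "p l"
    note P = D(2-5)[OF l]
    have pos: "0 < Re (ftr B ?p)" using ftr_proj(1)[OF B P(1,3,4)] .
    have conj: "?p * x * ?p \<in> sos B" if "x \<in> sos B" for x
      using sos_conj[of B ?p x] that P fdalgD(2)[OF B] by simp
    have pap: "?p * a * ?p = l *\<^sub>R ?p"
      using spectral_resolution_mult[OF R l] P by (simp add: mult.assoc)
    then have "l *\<^sub>R ?p \<in> sos B" using conj[OF a] by simp
    from ftr_sos[OF B this] have "0 \<le> l * Re (ftr B ?p)"
      by (simp add: ftr_scaleR[OF B P(1)])
    then have "0 \<le> l" using pos by (simp add: zero_le_mult_iff)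
    have "r *\<^sub>R 1 - c \<in> sos B"
      using fdalg_norm_minus_sos[OF B, of c r] aB bB sa sb fdalgD(7)[OF B]
      by (simp add: c_def r_def adj_add)
    from sos_add[OF conj[OF b] conj[OF this]] have "?p * (r *\<^sub>R 1 - a) * ?p \<in> sos B"
      by (simp add: c_def algebra_simps)
    also have "?p * (r *\<^sub>R 1 - a) * ?p = (r - l) *\<^sub>R ?p"
      using pap P by (simp add: algebra_simps)
    finally have "(r - l) *\<^sub>R ?p \<in> sos B" .
    from ftr_sos[OF B this] have "0 \<le> (r - l) * Re (ftr B ?p)"
      by (simp add: ftr_scaleR[OF B P(1)])
    then have "l \<le> r" using pos by (simp add: zero_le_mult_iff)
    with \<open>0 \<le> l\<close> show ?thesis by simp
  qed
  then show ?thesis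
    using spectral_resolution_norm_le[OF R sa, of r] by (simp add: r_def c_def)
qed

text \<open>Expanding \<open>adj x\<close> in the basis reduces the claim to faithfulness of the
  trace on \<open>x * adj x\<close>.\<close>

lemma ftr_nondegenerate:
  assumes B: "fdalg B" and x: "x \<in> B" and 0: "\<And>s. s \<in> fb B \<Longrightarrow> ftr B (x * s) = 0"
  shows "x = 0"
proof -
  have ax: "adj x \<in> B" using fdalgD(3)[OF B x] .
  have "adj x = (\<Sum>s\<in>fb B. cvec.representation (fb B) (adj x) s *\<^sub>C s)"
    using cvec.sum_representation_eq[OF fb(2)[OF B], of "adj x" "fb B"] fb[OF B] ax by simp
  then have "x * adj x = x * (\<Sum>s\<in>fb B. cvec.representation (fb B) (adj x) s *\<^sub>C s)"
    by (rule arg_cong[of _ _ "(*) x"])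
  also have "\<dots> = (\<Sum>s\<in>fb B. cvec.representation (fb B) (adj x) s *\<^sub>C (x * s))"
    by (simp add: sum_distrib_left mult_scaleC_right)
  finally have "ftr B (x * adj x) = (\<Sum>s\<in>fb B. cvec.representation (fb B) (adj x) s * ftr B (x * s))"
    using fb_mem[OF B] fdalgD[OF B] x by (simp add: ftr_sum[OF B] ftr_scaleC[OF B])
  then have "ftr B (adj (adj x) * adj x) = 0"
    using 0 by (simp add: adj_adj)
  then have "adj x = 0"
    using ftr_adj_mult_self(3)[OF B ax] by simp
  then show "x = 0" by (metis adj_adj adj_zero)
qed

text \<open>\<open>T\<close> represents the trace pairing in the basis. It is injective by
  nondegeneracy, hence surjective by dimension, and the preimage of a basis element is its dual
  element.\<close>

lemma dual_basis_exists:
  assumes B: "fdalg B"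
  shows "\<exists>d. \<forall>s\<in>fb B. d s \<in> B \<and> (\<forall>t\<in>fb B. ftr B (d s * t) = (if s = t then 1 else 0))"
proof -
  define S where "S = fb B"
  note S = fb[OF B, folded S_def]
  note SB = fb_mem[OF B, folded S_def]
  define T where "T x = (\<Sum>s\<in>S. ftr B (x * s) *\<^sub>C s)" for x
  have lin: "lin_on B T"
    using SB fdalgD(2)[OF B]
    by (auto simp: lin_on_def T_def distrib_right ftr_add[OF B] scaleC_add_left sum.distrib
        mult_scaleC_left ftr_scaleC[OF B] cvec.scale_sum_right)
  have TB: "T x \<in> B" for x
    unfolding T_def by (intro fdalgD(11,9)[OF B] SB)
  have T0: "x = 0" if "x \<in> B" "T x = 0" for x
  proof -
    have "ftr B (x * s) = 0" if "s \<in> S" for s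
      using cvec.independentD[OF S(2,1) subset_refl, of "\<lambda>s. ftr B (x * s)"] \<open>T x = 0\<close> that
      by (simp add: T_def)
    then show ?thesis using ftr_nondegenerate[OF B \<open>x \<in> B\<close>] by (simp add: S_def)
  qed
  have inj: "inj_on T B"
  proof (rule inj_onI)
    fix x y assume xy: "x \<in> B" "y \<in> B" "T x = T y"
    then have "T (x - y) = 0"
      using lin_on_diff[OF fdalgD(1)[OF B] lin] by simp
    then show "x = y" using T0[of "x - y"] xy fdalgD(8)[OF B] by simp
  qed
  then have injS: "inj_on T S" using SB by (meson inj_on_subset subsetI)
  have ind: "cvec.independent (T ` S)"
  proof (rule ccontr)
    assume "\<not> ?thesis"
    then obtain u where u: "(\<Sum>v\<in>T ` S. u v *\<^sub>C v) = 0" "\<exists>v\<in>T ` S. u v \<noteq> 0"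
      using cvec.dependent_finite[of "T ` S"] S(1) by auto
    have "T (\<Sum>s\<in>S. u (T s) *\<^sub>C s) = (\<Sum>s\<in>S. u (T s) *\<^sub>C T s)"
      using lin_on_sum[OF fdalgD(1)[OF B] lin, of S "\<lambda>s. s"] SB by simp
    also have "\<dots> = 0" using u(1) by (simp add: sum.reindex[OF injS])
    finally have Tz: "T (\<Sum>s\<in>S. u (T s) *\<^sub>C s) = 0" .
    have "(\<Sum>s\<in>S. u (T s) *\<^sub>C s) \<in> B"
      by (intro fdalgD(11,9)[OF B] SB)
    from T0[OF this Tz] have "(\<Sum>s\<in>S. u (T s) *\<^sub>C s) = 0" .
    then have "u (T s) = 0" if "s \<in> S" for s
      using cvec.independentD[OF S(2,1) subset_refl, of "\<lambda>s. u (T s)"] that by simp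
    then show False using u(2) by auto
  qed
  obtain T' where T': "T ` S \<subseteq> T'" "T' \<subseteq> B" "cvec.independent T'" "B \<subseteq> cvec.span T'"
    using cvec.maximal_independent_subset_extend[of "T ` S" B] ind TB by blast
  have "finite T' \<and> card T' \<le> card S"
    using cvec.independent_span_bound[OF S(1) T'(3)] T'(2) S(3) by blast
  then have "T ` S = T'"
    using T'(1) card_image[OF injS] by (metis card_seteq)
  then have BT: "B \<subseteq> cvec.span (T ` S)" using T'(4) by simp
  have surj: "\<exists>x\<in>B. T x = y" if "y \<in> B" for y
  proof -
    have "y \<in> cvec.span (T ` S)" using BT that by blast
    then obtain u where "y = (\<Sum>v\<in>T ` S. u v *\<^sub>C v)"
      unfolding cvec.span_finite[OF finite_imageI[OF S(1)]] by blast
    then have "y = (\<Sum>s\<in>S. u (T s) *\<^sub>C T s)" by (simp add: sum.reindex[OF injS])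
    also have "\<dots> = T (\<Sum>s\<in>S. u (T s) *\<^sub>C s)"
      using lin_on_sum[OF fdalgD(1)[OF B] lin, of S "\<lambda>s. s"] SB by simp
    finally show ?thesis using SB fdalgD(9,11)[OF B] by (metis (no_types, lifting))
  qed
  have "\<exists>x. x \<in> B \<and> (\<forall>t\<in>S. ftr B (x * t) = (if s = t then 1 else 0))" if s: "s \<in> S" for s
  proof -
    obtain x where x: "x \<in> B" "T x = s" using surj SB s by blast
    have "(\<Sum>t\<in>S. (if s = t then 1 else 0) *\<^sub>C t) = s"
      using s S(1) by (simp add: if_distrib[of "\<lambda>c. c *\<^sub>C _"] scaleC_one cong: if_cong)
    then have "(\<Sum>t\<in>S. (ftr B (x * t) - (if s = t then 1 else 0)) *\<^sub>C t) = 0"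
      using x(2) by (simp add: T_def cvec.scale_left_diff_distrib sum_subtractf)
    from cvec.independentD[OF S(2,1) subset_refl this]
    show ?thesis using x(1) by auto
  qed
  then show ?thesis unfolding S_def by metis
qed

definition fdual :: "'a::cstar_algebra set \<Rightarrow> 'a \<Rightarrow> 'a" where
  "fdual B = (SOME d. \<forall>s\<in>fb B. d s \<in> B \<and> (\<forall>t\<in>fb B. ftr B (d s * t) = (if s = t then 1 else 0)))"

lemma fdual:
  assumes "fdalg B" "s \<in> fb B"
  shows "fdual B s \<in> B" "\<And>t. t \<in> fb B \<Longrightarrow> ftr B (fdual B s * t) = (if s = t then 1 else 0)"
  using someI_ex[OF dual_basis_exists[OF assms(1)]] assms(2) unfolding fdual_def by auto

lemma fdual_representation:
  assumes B: "fdalg B" and x: "x \<in> B" and s: "s \<in> fb B"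
  shows "ftr B (fdual B s * x) = cvec.representation (fb B) x s"
proof -
  have "x = (\<Sum>t\<in>fb B. cvec.representation (fb B) x t *\<^sub>C t)"
    using cvec.sum_representation_eq[OF fb(2)[OF B], of x "fb B"] fb[OF B] x by simp
  then have "fdual B s * x = fdual B s * (\<Sum>t\<in>fb B. cvec.representation (fb B) x t *\<^sub>C t)"
    by (rule arg_cong[of _ _ "(*) (fdual B s)"])
  also have "\<dots> = (\<Sum>t\<in>fb B. cvec.representation (fb B) x t *\<^sub>C (fdual B s * t))"
    by (simp add: sum_distrib_left mult_scaleC_right)
  finally have "ftr B (fdual B s * x) = (\<Sum>t\<in>fb B. cvec.representation (fb B) x t * ftr B (fdual B s * t))"
    using fb_mem[OF B] fdalgD[OF B] fdual(1)[OF B s] by (simp add: ftr_sum[OF B] ftr_scaleC[OF B])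
  also have "\<dots> = (\<Sum>t\<in>fb B. if s = t then cvec.representation (fb B) x t else 0)"
    using fdual(2)[OF B s] by (intro sum.cong) auto
  finally show ?thesis using s fb(1)[OF B] by simp
qed

lemma fdual_expand_left:
  assumes B: "fdalg B" and x: "x \<in> B"
  shows "(\<Sum>s\<in>fb B. ftr B (fdual B s * x) *\<^sub>C s) = x"
  using cvec.sum_representation_eq[OF fb(2)[OF B], of x "fb B"] fb[OF B] x
  by (simp add: fdual_representation[OF B x])

lemma fdual_expand_right:
  assumes B: "fdalg B" and x: "x \<in> B"
  shows "(\<Sum>s\<in>fb B. ftr B (x * s) *\<^sub>C fdual B s) = x"
proof -
  let ?y = "\<Sum>s\<in>fb B. ftr B (x * s) *\<^sub>C fdual B s"
  have yB: "?y \<in> B" by (intro fdalgD(11,9)[OF B] fdual(1)[OF B])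
  have "ftr B ((x - ?y) * t) = 0" if t: "t \<in> fb B" for t
  proof -
    have tB: "t \<in> B" using fb_mem[OF B t] .
    have "ftr B (?y * t) = (\<Sum>s\<in>fb B. ftr B (x * s) * ftr B (fdual B s * t))"
      using fdual(1)[OF B] fdalgD[OF B] tB
      by (simp add: sum_distrib_right mult_scaleC_left ftr_sum[OF B] ftr_scaleC[OF B])
    also have "\<dots> = (\<Sum>s\<in>fb B. if s = t then ftr B (x * s) else 0)"
      using fdual(2)[OF B] t by (intro sum.cong) auto
    also have "\<dots> = ftr B (x * t)" using t fb(1)[OF B] by simp
    finally show ?thesis
      using ftr_diff[OF B] x yB tB fdalgD(2)[OF B] by (simp add: left_diff_distrib)
  qed
  then have "x - ?y = 0"
    using ftr_nondegenerate[OF B] x yB fdalgD(8)[OF B] by blast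
  then show ?thesis by simp
qed

text \<open>Tested against y, the sum becomes the sum of the traces of
  \<open>fdual B s * (y * s)\<close>, which are the diagonal coefficients of left multiplication by
  y. They add up to the trace of y precisely because the trace is the regular one.\<close>

lemma fdual_sum:
  assumes B: "fdalg B"
  shows "(\<Sum>s\<in>fb B. s * fdual B s) = 1"
proof -
  let ?z = "\<Sum>s\<in>fb B. s * fdual B s"
  have zB: "?z \<in> B" by (intro fdalgD(11,2)[OF B] fdual(1)[OF B] fb_mem[OF B])
  have "ftr B ((?z - 1) * y) = 0" if "y \<in> fb B" for y
  proof -
    have y: "y \<in> B" using fb_mem[OF B that] .
    have "ftr B (?z * y) = (\<Sum>s\<in>fb B. ftr B (s * (fdual B s * y)))"
      using fdual(1)[OF B] fb_mem[OF B] fdalgD[OF B] y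
      by (simp add: sum_distrib_right mult.assoc ftr_sum[OF B])
    also have "\<dots> = (\<Sum>s\<in>fb B. ftr B (fdual B s * (y * s)))"
      using fdual(1)[OF B] fb_mem[OF B] fdalgD[OF B] y
      by (intro sum.cong refl) (subst ftr_comm[OF B], auto simp: mult.assoc)
    also have "\<dots> = (\<Sum>s\<in>fb B. cvec.representation (fb B) (y * s) s)"
      using fb_mem[OF B] fdalgD(2)[OF B] y
      by (intro sum.cong refl) (simp only: fdual_representation[OF B])
    also have "\<dots> = ftr B y"
      by (simp only: ftr_def)
    finally show ?thesis
      using ftr_diff[OF B] y zB fdalgD(2)[OF B] by (simp add: left_diff_distrib)
  qed
  then have "?z - 1 = 0"
    using ftr_nondegenerate[OF B] zB fdalgD(4,8)[OF B] by blast
  then show ?thesis by simp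
qed

section \<open>Approximate homomorphisms\<close>

lemma coordinate_bound:
  assumes B: "fdalg B"
  obtains C where "0 \<le> C" "\<And>s x. s \<in> fb B \<Longrightarrow> x \<in> B \<Longrightarrow> cmod (ftr B (fdual B s * x)) \<le> C * norm x"
proof
  define t where "t = 2 * Re (ftr B 1)"
  have t: "0 \<le> t" using ftr_proj(1)[OF B fdalgD(4)[OF B]] by (simp add: t_def)
  show "0 \<le> t * (\<Sum>s\<in>fb B. norm (fdual B s))" using t by (simp add: sum_nonneg)
  fix s x assume s: "s \<in> fb B" and x: "x \<in> B"
  have "cmod (ftr B (fdual B s * x)) \<le> t * norm (fdual B s * x)"
    unfolding t_def by (intro ftr_bound B fdalgD(2) fdual(1) s x)
  also have "\<dots> \<le> t * ((\<Sum>s\<in>fb B. norm (fdual B s)) * norm x)"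
    using s fb(1)[OF B] t
    by (intro mult_left_mono order_trans[OF norm_mult_ineq] mult_right_mono member_le_sum) auto
  finally show "cmod (ftr B (fdual B s * x)) \<le> t * (\<Sum>s\<in>fb B. norm (fdual B s)) * norm x"
    by (simp add: mult.assoc)
qed

lemma fdalg_closed:
  assumes B: "fdalg B"
  shows "closed B"
  unfolding closed_sequential_limits
proof (intro allI impI, elim conjE)
  fix X :: "nat \<Rightarrow> 'a" and l
  assume X: "\<forall>n. X n \<in> B" and l: "X \<longlonglongrightarrow> l"
  obtain C where C: "0 \<le> C" "\<And>s x. s \<in> fb B \<Longrightarrow> x \<in> B \<Longrightarrow> cmod (ftr B (fdual B s * x)) \<le> C * norm x"
    using coordinate_bound[OF B] by blast
  have "Cauchy (\<lambda>n. ftr B (fdual B s * X n))" if s: "s \<in> fb B" for s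
  proof (rule CauchyI)
    fix e :: real assume "0 < e"
    have "0 < e / (C + 1)" using C(1) \<open>0 < e\<close> by simp
    then obtain N where N: "norm (X m - X n) < e / (C + 1)" if "m \<ge> N" "n \<ge> N" for m n
      using CauchyD[OF LIMSEQ_imp_Cauchy[OF l]] by blast
    have "cmod (ftr B (fdual B s * X m) - ftr B (fdual B s * X n)) < e" if "m \<ge> N" "n \<ge> N" for m n
    proof -
      have "ftr B (fdual B s * X m) - ftr B (fdual B s * X n) = ftr B (fdual B s * (X m - X n))"
        using X fdual(1)[OF B s] fdalgD(2)[OF B] by (simp add: ftr_diff[OF B] right_diff_distrib)
      then have "cmod (ftr B (fdual B s * X m) - ftr B (fdual B s * X n)) \<le> C * norm (X m - X n)"
        using C(2)[OF s, of "X m - X n"] X fdalgD(8)[OF B] by simp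
      also have "\<dots> \<le> C * (e / (C + 1))"
        using N[OF that] C(1) by (intro mult_left_mono) auto
      also have "\<dots> < e" using C(1) \<open>0 < e\<close> by (simp add: field_simps)
      finally show ?thesis .
    qed
    then show "\<exists>M. \<forall>m\<ge>M. \<forall>n\<ge>M. norm (ftr B (fdual B s * X m) - ftr B (fdual B s * X n)) < e"
      by blast
  qed
  then obtain c where c: "(\<lambda>n. ftr B (fdual B s * X n)) \<longlonglongrightarrow> c s" if "s \<in> fb B" for s
    unfolding Cauchy_convergent_iff convergent_def by metis
  have "(\<lambda>n. \<Sum>s\<in>fb B. ftr B (fdual B s * X n) *\<^sub>C s) \<longlonglongrightarrow> (\<Sum>s\<in>fb B. c s *\<^sub>C s)"
    by (intro tendsto_sum tendsto_scaleC c tendsto_const)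
  then have "X \<longlonglongrightarrow> (\<Sum>s\<in>fb B. c s *\<^sub>C s)"
    using X by (simp add: fdual_expand_left[OF B])
  then have "l = (\<Sum>s\<in>fb B. c s *\<^sub>C s)"
    using l LIMSEQ_unique by blast
  then show "l \<in> B"
    using fb_mem[OF B] by (simp only:) (intro fdalgD(11,9)[OF B])
qed

lemma fdalg_unital_cstar_subalgebra: "fdalg B \<Longrightarrow> unital_cstar_subalgebra B"
  using fdalg_closed by (auto simp: unital_cstar_subalgebra_def cstar_subalgebra_def fdalg_def)

lemma unital_cstar_subalgebraD:
  assumes "unital_cstar_subalgebra D"
  shows "cvec.subspace D" "closed D" "\<And>x y. x \<in> D \<Longrightarrow> y \<in> D \<Longrightarrow> x * y \<in> D"
    "\<And>x. x \<in> D \<Longrightarrow> adj x \<in> D" "1 \<in> D" "0 \<in> D"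
    "\<And>x y. x \<in> D \<Longrightarrow> y \<in> D \<Longrightarrow> x + y \<in> D" "\<And>x y. x \<in> D \<Longrightarrow> y \<in> D \<Longrightarrow> x - y \<in> D"
    "\<And>c x. x \<in> D \<Longrightarrow> c *\<^sub>C x \<in> D" "\<And>r x. x \<in> D \<Longrightarrow> r *\<^sub>R x \<in> D"
    "\<And>f I. (\<And>i. i \<in> I \<Longrightarrow> f i \<in> D) \<Longrightarrow> sum f I \<in> D"
  using assms
  by (auto simp: unital_cstar_subalgebra_def cstar_subalgebra_def scaleR_scaleC cvec.subspace_0
      cvec.subspace_add cvec.subspace_diff cvec.subspace_scale cvec.subspace_sum)

text \<open>The separability idempotent commutes with \<open>x\<close>, expressed through maps
  applied to its two tensor factors. \<open>x * s\<close> and \<open>fdual B t * x\<close> expand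
  with the same coefficient matrix \<open>c\<close>.\<close>

lemma casimir:
  assumes B: "fdalg B" and f: "lin_on B f" and g: "lin_on B g" and x: "x \<in> B"
  shows "(\<Sum>s\<in>fb B. f (x * s) * g (fdual B s)) = (\<Sum>s\<in>fb B. f s * g (fdual B s * x))"
proof -
  define c where "c s t = ftr B (fdual B t * x * s)" for s t
  have f': "f (x * s) = (\<Sum>t\<in>fb B. c s t *\<^sub>C f t)" if "s \<in> fb B" for s
  proof -
    have "f (\<Sum>t\<in>fb B. c s t *\<^sub>C t) = (\<Sum>t\<in>fb B. c s t *\<^sub>C f t)"
      using fb_mem[OF B] by (intro lin_on_sum[OF fdalgD(1)[OF B] f, of "fb B" "\<lambda>t. t" "c s"])
    then show ?thesis
      using fdual_expand_left[OF B fdalgD(2)[OF B x fb_mem[OF B that]]]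
      by (simp add: c_def mult.assoc)
  qed
  have g': "g (fdual B t * x) = (\<Sum>s\<in>fb B. c s t *\<^sub>C g (fdual B s))" if "t \<in> fb B" for t
  proof -
    have "g (\<Sum>s\<in>fb B. c s t *\<^sub>C fdual B s) = (\<Sum>s\<in>fb B. c s t *\<^sub>C g (fdual B s))"
      using fdual(1)[OF B]
      by (intro lin_on_sum[OF fdalgD(1)[OF B] g, of "fb B" "fdual B" "\<lambda>s. c s t"])
    then show ?thesis
      using fdual_expand_right[OF B fdalgD(2)[OF B fdual(1)[OF B that] x]]
      by (simp add: c_def)
  qed
  have "(\<Sum>s\<in>fb B. f (x * s) * g (fdual B s)) =
      (\<Sum>s\<in>fb B. \<Sum>t\<in>fb B. c s t *\<^sub>C (f t * g (fdual B s)))"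
    by (simp add: f' sum_distrib_right mult_scaleC_left)
  also have "\<dots> = (\<Sum>t\<in>fb B. \<Sum>s\<in>fb B. c s t *\<^sub>C (f t * g (fdual B s)))"
    by (rule sum.swap)
  also have "\<dots> = (\<Sum>t\<in>fb B. f t * g (fdual B t * x))"
    by (simp add: g' sum_distrib_left mult_scaleC_right)
  finally show ?thesis .
qed

definition mdef :: "('a::cstar_algebra \<Rightarrow> 'a) \<Rightarrow> 'a \<Rightarrow> 'a \<Rightarrow> 'a" where
  "mdef f x y = f (x * y) - f x * f y"

text \<open>The multiplicative defect of an almost multiplicative map is a 2-cocycle; contracting it with
  the separability idempotent \<open>\<Sum>\<^sub>s s \<otimes> s'\<close> exhibits it as a coboundary up to second order.\<close>

definition newton_corr :: "'a::cstar_algebra set \<Rightarrow> ('a \<Rightarrow> 'a) \<Rightarrow> 'a \<Rightarrow> 'a" where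
  "newton_corr B f x = (\<Sum>s\<in>fb B. f s * mdef f (fdual B s) x)"

lemma lin_on_mdef_left: "fdalg B \<Longrightarrow> lin_on B f \<Longrightarrow> y \<in> B \<Longrightarrow> lin_on B (\<lambda>x. mdef f x y)"
  by (auto simp: lin_on_def mdef_def distrib_right mult_scaleC_left cvec.scale_right_diff_distrib fdalgD)

lemma lin_on_mdef_right: "fdalg B \<Longrightarrow> lin_on B f \<Longrightarrow> x \<in> B \<Longrightarrow> lin_on B (mdef f x)"
  by (auto simp: lin_on_def mdef_def distrib_left mult_scaleC_right cvec.scale_right_diff_distrib fdalgD)

lemma lin_on_newton_corr:
  assumes B: "fdalg B" and f: "lin_on B f"
  shows "lin_on B (newton_corr B f)"
  using lin_on_mdef_right[OF B f fdual(1)[OF B]]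
  by (auto simp: lin_on_def newton_corr_def distrib_left mult_scaleC_right sum.distrib
      cvec.scale_sum_right)

lemma mdef_cocycle:
  "mdef f (u * v) w = f u * mdef f v w + mdef f u (v * w) - mdef f u v * f w"
  by (simp add: mdef_def algebra_simps)

text \<open>All first-order terms cancel: \<open>casimir\<close> and the cocycle relation rewrite
  \<open>f x * newton_corr B f y\<close>, and \<open>fdual_sum\<close> turns the sum of
  \<open>f s * f (fdual B s)\<close> into 1 minus a defect. Products of two small quantities
  remain.\<close>

lemma newton_identity:
  assumes B: "fdalg B" and f: "lin_on B f" and f1: "f 1 = 1" and x: "x \<in> B" and y: "y \<in> B"
  defines "g \<equiv> \<lambda>x. f x + newton_corr B f x"
  shows "mdef g x y = (\<Sum>s\<in>fb B. mdef f s (fdual B s)) * mdef f x y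
      + (\<Sum>s\<in>fb B. mdef f x s * mdef f (fdual B s) y) - newton_corr B f x * newton_corr B f y"
proof -
  let ?d = "fdual B" and ?\<eta> = "newton_corr B f"
  have 1: "f x * ?\<eta> y = (\<Sum>s\<in>fb B. f s * mdef f (?d s * x) y) - (\<Sum>s\<in>fb B. mdef f x s * mdef f (?d s) y)"
  proof -
    have "f x * ?\<eta> y = (\<Sum>s\<in>fb B. f (x * s) * mdef f (?d s) y) - (\<Sum>s\<in>fb B. mdef f x s * mdef f (?d s) y)"
      by (simp add: newton_corr_def sum_distrib_left mdef_def[of f x] left_diff_distrib
          sum_subtractf mult.assoc)
    then show ?thesis
      using casimir[OF B f lin_on_mdef_left[OF B f y] x] by simp
  qed
  have 2: "(\<Sum>s\<in>fb B. f s * mdef f (?d s * x) y) =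
      (\<Sum>s\<in>fb B. f s * f (?d s)) * mdef f x y + ?\<eta> (x * y) - ?\<eta> x * f y"
    by (simp add: newton_corr_def mdef_cocycle distrib_left right_diff_distrib sum.distrib
        sum_subtractf sum_distrib_right mult.assoc)
  have 3: "(\<Sum>s\<in>fb B. f s * f (?d s)) = 1 - (\<Sum>s\<in>fb B. mdef f s (?d s))"
  proof -
    have "f (\<Sum>s\<in>fb B. 1 *\<^sub>C (s * ?d s)) = (\<Sum>s\<in>fb B. 1 *\<^sub>C f (s * ?d s))"
      using fdual(1)[OF B] fb_mem[OF B] fdalgD(2)[OF B]
      by (intro lin_on_sum[OF fdalgD(1)[OF B] f, of "fb B" "\<lambda>s. s * ?d s" "\<lambda>_. 1"]) auto
    then have "(\<Sum>s\<in>fb B. f (s * ?d s)) = 1"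
      by (simp add: scaleC_one fdual_sum[OF B] f1)
    then show ?thesis by (simp add: mdef_def sum_subtractf)
  qed
  have "mdef g x y = mdef f x y + ?\<eta> (x * y) - f x * ?\<eta> y - ?\<eta> x * f y - ?\<eta> x * ?\<eta> y"
    by (simp add: mdef_def g_def algebra_simps)
  also have "\<dots> = mdef f x y - (\<Sum>s\<in>fb B. f s * f (?d s)) * mdef f x y
      + (\<Sum>s\<in>fb B. mdef f x s * mdef f (?d s) y) - ?\<eta> x * ?\<eta> y"
    unfolding 1 2 by simp
  also have "\<dots> = (\<Sum>s\<in>fb B. mdef f s (?d s)) * mdef f x y
      + (\<Sum>s\<in>fb B. mdef f x s * mdef f (?d s) y) - ?\<eta> x * ?\<eta> y"
    unfolding 3 by (simp add: left_diff_distrib)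
  finally show ?thesis .
qed

text \<open>Only multiplicativity is approximate; unit and involution are respected exactly, and
  every Newton step keeps it so.\<close>

definition ahom :: "'a::cstar_algebra set \<Rightarrow> 'a set \<Rightarrow> real \<Rightarrow> real \<Rightarrow> ('a \<Rightarrow> 'a) \<Rightarrow> bool" where
  "ahom B D M \<epsilon> f \<longleftrightarrow> lin_on B f \<and> (\<forall>x\<in>B. f x \<in> D) \<and> f 1 = 1 \<and> (\<forall>x\<in>B. f (adj x) = adj (f x)) \<and>
     (\<forall>x\<in>B. norm (f x) \<le> M * norm x) \<and> (\<forall>x\<in>B. \<forall>y\<in>B. norm (mdef f x y) \<le> \<epsilon> * norm x * norm y)"

lemma ahomD:
  assumes "ahom B D M \<epsilon> f"
  shows "lin_on B f" "\<And>x. x \<in> B \<Longrightarrow> f x \<in> D" "f 1 = 1" "\<And>x. x \<in> B \<Longrightarrow> f (adj x) = adj (f x)"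
    "\<And>x. x \<in> B \<Longrightarrow> norm (f x) \<le> M * norm x"
    "\<And>x y. x \<in> B \<Longrightarrow> y \<in> B \<Longrightarrow> norm (mdef f x y) \<le> \<epsilon> * norm x * norm y"
  using assms by (auto simp: ahom_def)

text \<open>Averaging with the conjugate map restores compatibility with the involution. The
  additional term is a product of two deviations, hence of second order.\<close>

lemma mdef_symmetrized:
  fixes g :: "'a::cstar_algebra \<Rightarrow> 'a"
  defines "h \<equiv> \<lambda>x. (1/2) *\<^sub>R (g x + adj (g (adj x)))"
  shows "mdef h x y = (1/2) *\<^sub>R (mdef g x y + adj (mdef g (adj y) (adj x)))
    + (1/4) *\<^sub>R ((g x - adj (g (adj x))) * (g y - adj (g (adj y))))"
proof -
  let ?a = "g (x * y)" and ?b = "adj (g (adj y * adj x))"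
    and ?u = "g x" and ?v = "adj (g (adj x))" and ?w = "g y" and ?z = "adj (g (adj y))"
  have half: "(1/2) *\<^sub>R c = (1/4) *\<^sub>R c + (1/4) *\<^sub>R c" for c :: 'a
    by (simp add: scaleR_left_distrib[symmetric])
  have "mdef h x y = (1/2) *\<^sub>R (?a + ?b) - (1/4) *\<^sub>R ((?u + ?v) * (?w + ?z))"
    by (simp add: mdef_def h_def adj_mult)
  also have "\<dots> = (1/2) *\<^sub>R (?a - ?u * ?w + (?b - ?v * ?z)) + (1/4) *\<^sub>R ((?u - ?v) * (?w - ?z))"
    by (simp add: half algebra_simps)
  finally show ?thesis
    by (simp add: mdef_def adj_diff adj_mult)
qed

text \<open>The correction need not respect the involution, so the Newton step is followed by
  symmetrization. In the new defect, 2 K stems from the two sums in \<open>newton_identity\<close>;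
  the square of M K occurs once for the product of corrections and once for the
  symmetrization.\<close>

lemma ahom_step:
  assumes B: "fdalg B" and D: "unital_cstar_subalgebra D" and f: "ahom B D M \<epsilon> f"
    and M: "0 \<le> M" and e: "0 \<le> \<epsilon>"
  defines "K \<equiv> \<Sum>s\<in>fb B. norm s * norm (fdual B s)"
  obtains h where "ahom B D (M + M * K * \<epsilon>) ((2 * K + 2 * (M * K)\<^sup>2) * \<epsilon>\<^sup>2) h"
    "\<And>x. x \<in> B \<Longrightarrow> norm (h x - f x) \<le> M * K * \<epsilon> * norm x"
proof -
  let ?d = "fdual B" and ?\<eta> = "newton_corr B f"
  note F = ahomD[OF f] and BD = fdalgD[OF B] and DD = unital_cstar_subalgebraD[OF D]
  note dB = fdual(1)[OF B] and sB = fb_mem[OF B]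
  define g where "g = (\<lambda>x. f x + ?\<eta> x)"
  define h where "h = (\<lambda>x. (1/2) *\<^sub>R (g x + adj (g (adj x))))"
  have K0: "0 \<le> K" by (simp add: K_def sum_nonneg)
  have \<eta>lin: "lin_on B ?\<eta>" using lin_on_newton_corr[OF B F(1)] .
  have mD: "mdef f x y \<in> D" if "x \<in> B" "y \<in> B" for x y
    using that F(2) BD(2) DD(3,8) by (simp add: mdef_def)
  have \<eta>D: "?\<eta> x \<in> D" if "x \<in> B" for x
    unfolding newton_corr_def by (intro DD(11,3) mD[OF dB that] F(2)[OF sB])
  have \<eta>bound: "norm (?\<eta> x) \<le> M * K * \<epsilon> * norm x" if x: "x \<in> B" for x
  proof -
    have "norm (?\<eta> x) \<le> (\<Sum>s\<in>fb B. (M * norm s) * (\<epsilon> * norm (?d s) * norm x))"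
      unfolding newton_corr_def using M
      by (intro sum_norm_le order_trans[OF norm_mult_ineq] mult_mono F(5,6) sB dB x) auto
    also have "\<dots> = M * K * \<epsilon> * norm x"
      by (simp add: K_def sum_distrib_left sum_distrib_right mult.assoc mult.left_commute)
    finally show ?thesis .
  qed
  have gm: "norm (mdef g x y) \<le> (2 * K + (M * K)\<^sup>2) * \<epsilon>\<^sup>2 * norm x * norm y"
    if x: "x \<in> B" and y: "y \<in> B" for x y
  proof -
    have 1: "norm (\<Sum>s\<in>fb B. mdef f s (?d s)) \<le> K * \<epsilon>"
    proof -
      have "norm (\<Sum>s\<in>fb B. mdef f s (?d s)) \<le> (\<Sum>s\<in>fb B. \<epsilon> * norm s * norm (?d s))"
        by (intro sum_norm_le F(6) sB dB)
      then show ?thesis by (simp add: K_def sum_distrib_left mult.assoc mult.commute)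
    qed
    have 2: "norm (\<Sum>s\<in>fb B. mdef f x s * mdef f (?d s) y) \<le> K * \<epsilon>\<^sup>2 * norm x * norm y"
    proof -
      have "norm (\<Sum>s\<in>fb B. mdef f x s * mdef f (?d s) y)
          \<le> (\<Sum>s\<in>fb B. (\<epsilon> * norm x * norm s) * (\<epsilon> * norm (?d s) * norm y))"
        using e by (intro sum_norm_le order_trans[OF norm_mult_ineq] mult_mono F(6) sB dB x y) auto
      also have "\<dots> = K * \<epsilon>\<^sup>2 * norm x * norm y"
        by (simp add: K_def sum_distrib_left sum_distrib_right power2_eq_square mult_ac)
      finally show ?thesis .
    qed
    have "norm (mdef g x y) \<le> norm (\<Sum>s\<in>fb B. mdef f s (?d s)) * norm (mdef f x y)
        + norm (\<Sum>s\<in>fb B. mdef f x s * mdef f (?d s) y) + norm (?\<eta> x) * norm (?\<eta> y)"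
      unfolding g_def newton_identity[OF B F(1,3) x y]
      by (intro order_trans[OF norm_triangle_ineq4] add_mono order_trans[OF norm_triangle_ineq]
          norm_mult_ineq order_refl)
    also have "\<dots> \<le> (K * \<epsilon>) * (\<epsilon> * norm x * norm y) + K * \<epsilon>\<^sup>2 * norm x * norm y
        + (M * K * \<epsilon> * norm x) * (M * K * \<epsilon> * norm y)"
      using e K0 M by (intro add_mono mult_mono 1 2 F(6) \<eta>bound x y) auto
    also have "\<dots> = (2 * K + (M * K)\<^sup>2) * \<epsilon>\<^sup>2 * norm x * norm y"
      by (simp add: algebra_simps power2_eq_square)
    finally show ?thesis .
  qed
  have glin: "lin_on B g"
    using F(1) \<eta>lin by (auto simp: lin_on_def g_def scaleC_add_right)
  have gD: "g x \<in> D" if "x \<in> B" for x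
    using F(2) \<eta>D DD(7) that by (simp add: g_def)
  have hf: "h x - f x = (1/2) *\<^sub>R (?\<eta> x + adj (?\<eta> (adj x)))" if "x \<in> B" for x
  proof -
    have "h x = (1/2) *\<^sub>R (f x + f x + (?\<eta> x + adj (?\<eta> (adj x))))"
      using F(4)[OF that] by (simp add: h_def g_def adj_add adj_adj algebra_simps)
    then show ?thesis by (simp add: scaleR_add_right scaleR_left_distrib[symmetric])
  qed
  have hclose: "norm (h x - f x) \<le> M * K * \<epsilon> * norm x" if x: "x \<in> B" for x
  proof -
    have "norm (h x - f x) \<le> 1/2 * (norm (?\<eta> x) + norm (?\<eta> (adj x)))"
      unfolding hf[OF x] using norm_triangle_ineq[of "?\<eta> x" "adj (?\<eta> (adj x))"] by simp
    also have "\<dots> \<le> 1/2 * (M * K * \<epsilon> * norm x + M * K * \<epsilon> * norm (adj x))"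
      using \<eta>bound[OF x] \<eta>bound[OF BD(3)[OF x]] by (intro mult_left_mono add_mono) auto
    finally show ?thesis by (simp add: mult_ac)
  qed
  have "ahom B D (M + M * K * \<epsilon>) ((2 * K + 2 * (M * K)\<^sup>2) * \<epsilon>\<^sup>2) h"
    unfolding ahom_def
  proof (intro conjI ballI)
    show "lin_on B h"
      using glin BD(3)
      by (auto simp: lin_on_def h_def adj_add adj_scaleC scaleC_add_right scaleR_scaleC mult.commute
          algebra_simps)
    show "h x \<in> D" if "x \<in> B" for x
      unfolding h_def using that by (intro DD(10,7,4) gD BD(3))
    \<comment> \<open>A unital map has no defect against 1, so the correction leaves the unit
      fixed.\<close>
    have "mdef f u 1 = 0" for u by (simp add: mdef_def F(3))
    then have "?\<eta> 1 = 0" by (simp add: newton_corr_def)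
    then show "h 1 = 1"
      using hf[OF BD(4)] F(3) by simp
    show "h (adj x) = adj (h x)" if "x \<in> B" for x
      by (simp add: h_def adj_scaleR adj_add adj_adj add.commute)
    show "norm (h x) \<le> (M + M * K * \<epsilon>) * norm x" if "x \<in> B" for x
      using norm_triangle_ineq[of "f x" "h x - f x"] hclose[OF that] F(5)[OF that]
      by (simp add: algebra_simps)
    fix x y assume x: "x \<in> B" and y: "y \<in> B"
    have diff: "norm (g u - adj (g (adj u))) \<le> 2 * (M * K * \<epsilon> * norm u)" if u: "u \<in> B" for u
    proof -
      have "g u - adj (g (adj u)) = ?\<eta> u - adj (?\<eta> (adj u))"
        using F(4)[OF u] by (simp add: g_def adj_add adj_adj)
      then have "norm (g u - adj (g (adj u))) \<le> norm (?\<eta> u) + norm (?\<eta> (adj u))"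
        using norm_triangle_ineq4[of "?\<eta> u" "adj (?\<eta> (adj u))"] by simp
      then show ?thesis using \<eta>bound[OF u] \<eta>bound[OF BD(3)[OF u]] by simp
    qed
    have "norm (mdef h x y) \<le> 1/2 * (norm (mdef g x y) + norm (mdef g (adj y) (adj x)))
        + 1/4 * (norm (g x - adj (g (adj x))) * norm (g y - adj (g (adj y))))"
      unfolding h_def mdef_symmetrized
      using norm_mult_ineq[of "g x - adj (g (adj x))" "g y - adj (g (adj y))"]
        norm_triangle_ineq[of "mdef g x y" "adj (mdef g (adj y) (adj x))"]
      by (intro order_trans[OF norm_triangle_ineq] add_mono) simp_all
    also have "\<dots> \<le> 1/2 * ((2 * K + (M * K)\<^sup>2) * \<epsilon>\<^sup>2 * norm x * norm y
        + (2 * K + (M * K)\<^sup>2) * \<epsilon>\<^sup>2 * norm (adj y) * norm (adj x))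
        + 1/4 * ((2 * (M * K * \<epsilon> * norm x)) * (2 * (M * K * \<epsilon> * norm y)))"
      using e K0 M by (intro add_mono mult_left_mono mult_mono gm diff x y BD(3)) auto
    also have "\<dots> = (2 * K + 2 * (M * K)\<^sup>2) * \<epsilon>\<^sup>2 * norm x * norm y"
      by (simp add: algebra_simps power2_eq_square)
    finally show "norm (mdef h x y) \<le> (2 * K + 2 * (M * K)\<^sup>2) * \<epsilon>\<^sup>2 * norm x * norm y" .
  qed
  then show ?thesis using that hclose by blast
qed

definition shom :: "'a::cstar_algebra set \<Rightarrow> 'a set \<Rightarrow> ('a \<Rightarrow> 'a) \<Rightarrow> bool" where
  "shom B D f \<longleftrightarrow> lin_on B f \<and> (\<forall>x\<in>B. f x \<in> D) \<and> f 1 = 1 \<and> (\<forall>x\<in>B. f (adj x) = adj (f x)) \<and>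
     (\<forall>x\<in>B. \<forall>y\<in>B. f (x * y) = f x * f y)"

lemma shomD:
  assumes "shom B D f"
  shows "lin_on B f" "\<And>x. x \<in> B \<Longrightarrow> f x \<in> D" "f 1 = 1" "\<And>x. x \<in> B \<Longrightarrow> f (adj x) = adj (f x)"
    "\<And>x y. x \<in> B \<Longrightarrow> y \<in> B \<Longrightarrow> f (x * y) = f x * f y"
  using assms by (auto simp: shom_def)

lemma ahom_mono: "ahom B D M e f \<Longrightarrow> M \<le> M' \<Longrightarrow> e \<le> e' \<Longrightarrow> ahom B D M' e' f"
  unfolding ahom_def by (meson mult_right_mono norm_ge_zero order_trans)

lemma ahom_limit:
  assumes B: "fdalg B" and D: "unital_cstar_subalgebra D"
    and f: "\<And>n. ahom B D (M n) (e n) (f n)" and e: "e \<longlonglongrightarrow> 0"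
    and lim: "\<And>x. x \<in> B \<Longrightarrow> (\<lambda>n. f n x) \<longlonglongrightarrow> g x"
  shows "shom B D g"
proof -
  note BD = fdalgD[OF B] and F = ahomD[OF f]
  note uniq = LIMSEQ_unique[OF lim]
  show ?thesis
    unfolding shom_def lin_on_def
  proof (intro conjI ballI allI)
    fix x y assume x: "x \<in> B" and y: "y \<in> B"
    show "g (x + y) = g x + g y"
      using tendsto_add[OF lim[OF x] lim[OF y]] x y lin_onD(1)[OF F(1)]
      by (intro uniq BD(7)) simp_all
    have "(\<lambda>n. mdef (f n) x y) \<longlonglongrightarrow> g (x * y) - g x * g y"
      unfolding mdef_def by (intro tendsto_intros lim BD(2) x y)
    moreover have "(\<lambda>n. mdef (f n) x y) \<longlonglongrightarrow> 0"
    proof (rule Lim_null_comparison)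
      show "\<forall>\<^sub>F n in sequentially. norm (mdef (f n) x y) \<le> e n * norm x * norm y"
        using F(6)[OF x y] by simp
      show "(\<lambda>n. e n * norm x * norm y) \<longlonglongrightarrow> 0"
        using tendsto_mult_left_zero[OF tendsto_mult_left_zero[OF e]] .
    qed
    ultimately have "g (x * y) - g x * g y = 0"
      by (rule LIMSEQ_unique)
    then show "g (x * y) = g x * g y" by simp
  next
    fix c x assume x: "x \<in> B"
    show "g (c *\<^sub>C x) = c *\<^sub>C g x"
      using tendsto_scaleC[OF tendsto_const lim[OF x]] x lin_onD(2)[OF F(1)]
      by (intro uniq BD(9)) simp_all
  next
    fix x assume x: "x \<in> B"
    show "g x \<in> D"
      using closed_sequentially[OF unital_cstar_subalgebraD(2)[OF D] _ lim[OF x]] F(2)[OF x] by blast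
    show "g (adj x) = adj (g x)"
      using tendsto_adj[OF lim[OF x]] F(4)[OF x] by (intro uniq BD(3) x) simp
  next
    show "g 1 = 1" using F(3) by (intro uniq BD(4)) simp
  qed
qed

lemma newton_limit:
  assumes B: "fdalg B" and M: "1 \<le> M"
  obtains \<delta> L where "0 < \<delta>" "0 \<le> L"
    "\<And>D f e. unital_cstar_subalgebra D \<Longrightarrow> 0 \<le> e \<Longrightarrow> e \<le> \<delta> \<Longrightarrow> ahom B D M e f \<Longrightarrow>
      \<exists>g. shom B D g \<and> (\<forall>x\<in>B. norm (g x - f x) \<le> L * e * norm x)"
proof -
  define K where "K = (\<Sum>s\<in>fb B. norm s * norm (fdual B s))"
  define C where "C = 2 * K + 2 * (2 * M * K)\<^sup>2"
  \<comment> \<open>For e \<le> \<delta> this gives C e \<le> 1/2, which halves the defect, and 4 K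
    e \<le> 1, which keeps the growth of the norm bound within \<open>?M\<close>.\<close>
  define \<delta> where "\<delta> = 1 / (2 * C + 4 * K + 1)"
  define L where "L = 4 * M * K"
  have K0: "0 \<le> K" by (simp add: K_def sum_nonneg)
  have C0: "0 \<le> C" using K0 by (simp add: C_def)
  have "0 < \<delta>" "0 \<le> L" using K0 C0 M by (simp_all add: \<delta>_def L_def)
  moreover have "\<exists>g. shom B D g \<and> (\<forall>x\<in>B. norm (g x - f x) \<le> L * e * norm x)"
    if D: "unital_cstar_subalgebra D" and e: "0 \<le> e" "e \<le> \<delta>" and f: "ahom B D M e f" for D f e
  proof -
    have "(2 * C + 4 * K + 1) * e \<le> 1"
      using e K0 C0 by (simp add: \<delta>_def field_simps)
    then have sum1: "2 * (C * e) + 4 * (K * e) + e \<le> 1" by (simp add: algebra_simps)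
    have "0 \<le> C * e" "0 \<le> K * e" using C0 K0 e by auto
    with sum1 e have Ce: "C * e \<le> 1/2" and Ke: "4 * K * e \<le> 1" by auto
    \<comment> \<open>The step squares the defect, but halving it is enough. The norm bounds stay
      below 2 M, the value used in \<open>C\<close>, and grow by M/2, M/4 and so on; the moves sum
      to 4 M K e, whence \<open>L\<close>.\<close>
    let ?M = "\<lambda>n. M * (2 - (1/2) ^ n)" and ?e = "\<lambda>n. e * (1/2) ^ n"
    let ?Q = "\<lambda>n f g. \<forall>x\<in>B. norm (g x - f x) \<le> (2 * M * K * e * norm x) * (1/2) ^ n"
    have step: "\<exists>g. ahom B D (?M (Suc n)) (?e (Suc n)) g \<and> ?Q n f g"
      if f: "ahom B D (?M n) (?e n) f" for n f
    proof -
      have p: "0 \<le> (1/2::real) ^ n" "(1/2::real) ^ n \<le> 1"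
        by (auto intro: power_le_one)
      have Mn: "0 \<le> ?M n" "?M n \<le> 2 * M" using p M by auto
      have en: "0 \<le> ?e n" using e by simp
      obtain h where h: "ahom B D (?M n + ?M n * K * ?e n) ((2 * K + 2 * (?M n * K)\<^sup>2) * (?e n)\<^sup>2) h"
        "\<And>x. x \<in> B \<Longrightarrow> norm (h x - f x) \<le> ?M n * K * ?e n * norm x"
        using ahom_step[OF B D f Mn(1) en, folded K_def] by blast
      have a: "?M n * K * ?e n \<le> 2 * M * K * ?e n"
        using Mn K0 en by (intro mult_right_mono) auto
      have b: "2 * M * K * ?e n \<le> 1/2 * M * (1/2) ^ n"
      proof -
        have "1/2 * M * (1/2) ^ n * (4 * K * e) \<le> 1/2 * M * (1/2) ^ n * 1"
          using Ke M by (intro mult_left_mono) auto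
        then show ?thesis by (simp add: mult_ac)
      qed
      have c: "(2 * K + 2 * (?M n * K)\<^sup>2) * (?e n)\<^sup>2 \<le> ?e (Suc n)"
      proof -
        have "?M n * K \<le> 2 * M * K" using Mn K0 by (intro mult_right_mono)
        then have "(?M n * K)\<^sup>2 \<le> (2 * M * K)\<^sup>2" using Mn K0 by (intro power_mono) auto
        then have "(2 * K + 2 * (?M n * K)\<^sup>2) * (?e n)\<^sup>2 \<le> C * (?e n)\<^sup>2"
          unfolding C_def by (intro mult_right_mono) auto
        also have "\<dots> = (C * e) * ((1/2) ^ n * ?e n)" by (simp add: power2_eq_square mult_ac)
        also have "\<dots> \<le> 1/2 * (1 * ?e n)"
          using Ce p en e C0 by (intro mult_mono) auto
        finally show ?thesis by simp
      qed
      have "ahom B D (?M (Suc n)) (?e (Suc n)) h"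
        using ahom_mono[OF h(1) _ c] a b by (simp add: algebra_simps)
      moreover have "?Q n f h"
      proof
        fix x assume "x \<in> B"
        have "norm (h x - f x) \<le> 2 * M * K * ?e n * norm x"
          using h(2)[OF \<open>x \<in> B\<close>] mult_right_mono[OF a, of "norm x"] by simp
        then show "norm (h x - f x) \<le> (2 * M * K * e * norm x) * (1/2) ^ n"
          by (simp add: mult_ac)
      qed
      ultimately show ?thesis by blast
    qed
    have "\<exists>F. \<forall>n. ahom B D (?M n) (?e n) (F n) \<and> ?Q n (F n) (F (Suc n)) \<and> (n = 0 \<longrightarrow> F n = f)"
    proof -
      have "\<exists>F. \<forall>n. (ahom B D (?M n) (?e n) (F n) \<and> (n = 0 \<longrightarrow> F n = f)) \<and> ?Q n (F n) (F (Suc n))"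
      proof (rule dependent_nat_choice)
        show "\<exists>x. ahom B D (?M 0) (?e 0) x \<and> (0 = (0::nat) \<longrightarrow> x = f)"
          using f by auto
        show "\<exists>y. (ahom B D (?M (Suc n)) (?e (Suc n)) y \<and> (Suc n = 0 \<longrightarrow> y = f)) \<and> ?Q n x y"
          if "ahom B D (?M n) (?e n) x \<and> (n = 0 \<longrightarrow> x = f)" for n x
          using step[of n x] that by blast
      qed
      then show ?thesis by blast
    qed
    then obtain F where F: "\<And>n. ahom B D (?M n) (?e n) (F n)" "\<And>n. ?Q n (F n) (F (Suc n))" "F 0 = f"
      by blast
    define g where "g x = f x + (\<Sum>n. F (Suc n) x - F n x)" for x
    have summ: "summable (\<lambda>n. (2 * M * K * e * norm x) * (1/2) ^ n)" for x :: 'a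
      by (intro summable_mult summable_geometric) simp
    have sum_F: "summable (\<lambda>n. norm (F (Suc n) x - F n x))" if "x \<in> B" for x
      using F(2) that by (intro summable_comparison_test'[OF summ[of x], of 0]) simp
    have lim: "(\<lambda>n. F n x) \<longlonglongrightarrow> g x" if x: "x \<in> B" for x
    proof -
      have "(\<lambda>n. f x + (\<Sum>i<n. F (Suc i) x - F i x)) \<longlonglongrightarrow> g x"
        unfolding g_def
        by (intro tendsto_add tendsto_const summable_LIMSEQ[OF summable_norm_cancel[OF sum_F[OF x]]])
      moreover have "(\<lambda>n. f x + (\<Sum>i<n. F (Suc i) x - F i x)) = (\<lambda>n. F n x)"
        using F(3) by (simp add: sum_lessThan_telescope[of "\<lambda>i. F i x"])
      ultimately show ?thesis by simp
    qed
    have "shom B D g"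
    proof (rule ahom_limit[OF B D F(1) _ lim])
      show "?e \<longlonglongrightarrow> 0"
        by (intro tendsto_mult_right_zero LIMSEQ_power_zero) simp
    qed
    moreover have "norm (g x - f x) \<le> L * e * norm x" if x: "x \<in> B" for x
    proof -
      have "norm (g x - f x) = norm (\<Sum>n. F (Suc n) x - F n x)"
        by (simp add: g_def)
      also have "\<dots> \<le> (\<Sum>n. norm (F (Suc n) x - F n x))"
        by (rule summable_norm[OF sum_F[OF x]])
      also have "\<dots> \<le> (\<Sum>n. (2 * M * K * e * norm x) * (1/2) ^ n)"
        using F(2) x by (intro suminf_le sum_F summ) auto
      also have "\<dots> = L * e * norm x"
        by (subst suminf_mult) (simp_all add: suminf_geometric L_def)
      finally show ?thesis .
    qed
    ultimately show ?thesis by blast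
  qed
  ultimately show ?thesis using that by blast
qed

section \<open>Stability of unital *-homomorphisms\<close>

definition near_shom :: "'a::cstar_algebra set \<Rightarrow> 'a set \<Rightarrow> real \<Rightarrow> real \<Rightarrow> ('a \<Rightarrow> 'a) \<Rightarrow> bool" where
  "near_shom B D M \<delta> f \<longleftrightarrow> lin_on B f \<and> (\<forall>x\<in>B. f x \<in> D) \<and> norm (f 1 - 1) \<le> \<delta> \<and>
     (\<forall>x\<in>B. norm (f x) \<le> M * norm x) \<and> (\<forall>x\<in>B. norm (f (adj x) - adj (f x)) \<le> \<delta> * norm x) \<and>
     (\<forall>x\<in>B. \<forall>y\<in>B. norm (mdef f x y) \<le> \<delta> * norm x * norm y)"

text \<open>Symmetrizing repairs the involution; adding \<tau>(x) (1 - g 1) with the normalized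
  trace \<tau> repairs the unit and keeps the involution, since \<tau> is self-adjoint. The change
  is (1/2 + 2) \<delta>, rounded up to 3 \<delta>, and 13 + 6 M is 1 + 3 + 3 (M + 3) + 3 M.\<close>

lemma near_shom_normalize:
  assumes B: "fdalg B" and D: "unital_cstar_subalgebra D" and f: "near_shom B D M \<delta> f"
    and M: "0 \<le> M" and \<delta>: "0 \<le> \<delta>" "\<delta> \<le> 1"
  obtains h where "ahom B D (M + 3) ((13 + 6 * M) * \<delta>) h"
    "\<And>x. x \<in> B \<Longrightarrow> norm (h x - f x) \<le> 3 * \<delta> * norm x"
proof -
  note BD = fdalgD[OF B] and DD = unital_cstar_subalgebraD[OF D]
  have flin: "lin_on B f" and fD: "\<And>x. x \<in> B \<Longrightarrow> f x \<in> D" and f1: "norm (f 1 - 1) \<le> \<delta>"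
    and fM: "\<And>x. x \<in> B \<Longrightarrow> norm (f x) \<le> M * norm x"
    and fadj: "\<And>x. x \<in> B \<Longrightarrow> norm (f (adj x) - adj (f x)) \<le> \<delta> * norm x"
    and fm: "\<And>x y. x \<in> B \<Longrightarrow> y \<in> B \<Longrightarrow> norm (mdef f x y) \<le> \<delta> * norm x * norm y"
    using f by (auto simp: near_shom_def)
  define t where "t = Re (ftr B 1)"
  have t: "0 < t" "ftr B 1 = of_real t"
    using ftr_proj[OF B BD(4)] by (simp_all add: t_def complex_eq_iff)
  define \<tau> where "\<tau> x = ftr B x / of_real t" for x
  have \<tau>: "cmod (\<tau> x) \<le> 2 * norm x" if "x \<in> B" for x
    using ftr_bound[OF B that, folded t_def] t(1)
    by (simp add: \<tau>_def norm_divide pos_divide_le_eq mult_ac)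
  define g where "g x = (1/2) *\<^sub>R (f x + adj (f (adj x)))" for x
  define u where "u = 1 - g 1"
  define h where "h x = g x + \<tau> x *\<^sub>C u" for x
  have gf: "norm (g x - f x) \<le> 1/2 * \<delta> * norm x" if x: "x \<in> B" for x
  proof -
    have "g x - (1/2) *\<^sub>R (f x + f x) = (1/2) *\<^sub>R (adj (f (adj x)) - f x)"
      by (simp only: g_def scaleR_diff_right[symmetric]) simp
    then have "g x - f x = (1/2) *\<^sub>R (adj (f (adj x)) - f x)"
      by (simp add: scaleR_half_double)
    moreover have "norm (adj (f (adj x)) - f x) = norm (f (adj x) - adj (f x))"
      by (metis adj_adj adj_diff norm_adj)
    ultimately show ?thesis using fadj[OF x] by simp
  qed
  have nu: "norm u \<le> \<delta>"
  proof -
    have "u = (1/2) *\<^sub>R ((1 - f 1) + adj (1 - f 1))"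
    proof -
      have "(1/2) *\<^sub>R ((1 - f 1) + adj (1 - f 1)) = (1/2) *\<^sub>R (1 + 1) - (1/2) *\<^sub>R (f 1 + adj (f 1))"
        by (simp add: adj_diff scaleR_diff_right[symmetric])
      then show ?thesis
        using scaleR_half_double[of "1 :: 'a"] by (simp add: u_def g_def)
    qed
    then have "norm u \<le> 1/2 * (norm (1 - f 1) + norm (1 - f 1))"
      using norm_triangle_ineq[of "1 - f 1" "adj (1 - f 1)"] by simp
    then show ?thesis using f1 by (simp add: norm_minus_commute)
  qed
  have hf: "norm (h x - f x) \<le> 3 * \<delta> * norm x" if x: "x \<in> B" for x
  proof -
    have "norm (h x - f x) \<le> norm (g x - f x) + norm (\<tau> x *\<^sub>C u)"
      using norm_triangle_ineq[of "g x - f x" "\<tau> x *\<^sub>C u"] by (simp add: h_def algebra_simps)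
    also have "\<dots> \<le> 1/2 * \<delta> * norm x + (2 * norm x) * \<delta>"
      using gf[OF x] \<tau>[OF x] nu unfolding norm_scaleC by (intro add_mono mult_mono) auto
    also have "\<dots> \<le> 3 * \<delta> * norm x" using \<delta> by (simp add: algebra_simps)
    finally show ?thesis .
  qed
  have hM: "norm (h x) \<le> (M + 3) * norm x" if x: "x \<in> B" for x
  proof -
    have "norm (h x) \<le> norm (f x) + norm (h x - f x)"
      using norm_triangle_ineq[of "f x" "h x - f x"] by simp
    also have "\<dots> \<le> M * norm x + 3 * 1 * norm x"
      using \<delta> by (intro add_mono fM x order_trans[OF hf] mult_right_mono mult_left_mono) auto
    finally show ?thesis by (simp add: algebra_simps)
  qed
  have "ahom B D (M + 3) ((13 + 6 * M) * \<delta>) h"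
    unfolding ahom_def
  proof (intro conjI ballI)
    have "lin_on B g"
      using flin BD(3)
      by (auto simp: lin_on_def g_def adj_add adj_scaleC scaleC_add_right scaleR_scaleC mult.commute
          algebra_simps)
    moreover have "\<tau> (x + y) = \<tau> x + \<tau> y" "\<tau> (c *\<^sub>C x) = c * \<tau> x" if "x \<in> B" "y \<in> B" for x y c
      using that by (simp_all add: \<tau>_def ftr_add[OF B] ftr_scaleC[OF B] add_divide_distrib)
    ultimately show "lin_on B h"
      by (auto simp: lin_on_def h_def scaleC_add_left scaleC_add_right scaleC_scaleC)
    have gD: "g x \<in> D" if "x \<in> B" for x
      unfolding g_def using that by (intro DD(10,7,4) fD BD(3))
    then have "u \<in> D" unfolding u_def by (intro DD(8,5) gD BD(4))
    then show "h x \<in> D" if "x \<in> B" for x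
      unfolding h_def using that by (intro DD(7,9) gD)
    show "h 1 = 1" using t by (simp add: h_def \<tau>_def scaleC_one u_def)
    show "h (adj x) = adj (h x)" if "x \<in> B" for x
    proof -
      have "\<tau> (adj x) = cnj (\<tau> x)" using ftr_adj[OF B that] by (simp add: \<tau>_def)
      moreover have "g (adj x) = adj (g x)" for x
        by (simp add: g_def adj_scaleR adj_add adj_adj add.commute)
      moreover from this[of 1] have "adj u = u" by (simp add: u_def adj_diff)
      ultimately show ?thesis by (simp add: h_def adj_add adj_scaleC)
    qed
    show "norm (h x) \<le> (M + 3) * norm x" if "x \<in> B" for x using hM[OF that] .
    fix x y assume x: "x \<in> B" and y: "y \<in> B"
    have "mdef h x y = mdef f x y + (h (x * y) - f (x * y)) - ((h x - f x) * h y + f x * (h y - f y))"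
      by (simp add: mdef_def algebra_simps)
    then have "norm (mdef h x y) \<le> norm (mdef f x y) + norm (h (x * y) - f (x * y))
        + (norm (h x - f x) * norm (h y) + norm (f x) * norm (h y - f y))"
      by (simp only:) (intro order_trans[OF norm_triangle_ineq4] add_mono norm_triangle_ineq
          order_trans[OF norm_triangle_ineq] norm_mult_ineq)
    also have "\<dots> \<le> \<delta> * norm x * norm y + 3 * \<delta> * (norm x * norm y)
        + ((3 * \<delta> * norm x) * ((M + 3) * norm y) + (M * norm x) * (3 * \<delta> * norm y))"
      using \<delta> M
      by (intro add_mono mult_mono fm hf hM fM x y BD(2) order_trans[OF hf[OF BD(2)[OF x y]]]
          mult_left_mono norm_mult_ineq) auto
    also have "\<dots> = (13 + 6 * M) * \<delta> * norm x * norm y"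
      by (simp add: algebra_simps)
    finally show "norm (mdef h x y) \<le> (13 + 6 * M) * \<delta> * norm x * norm y" .
  qed
  then show ?thesis using that hf by blast
qed

text \<open>The tolerance is chosen before target and map, which vary with the stage of the
  approximation while the source stays fixed.\<close>

theorem shom_stability:
  assumes B: "fdalg B" and M: "0 \<le> M" and \<eta>: "0 < \<eta>"
  obtains \<delta> where "0 < \<delta>"
    "\<And>D f. unital_cstar_subalgebra D \<Longrightarrow> near_shom B D M \<delta> f \<Longrightarrow>
      \<exists>g. shom B D g \<and> (\<forall>x\<in>B. norm (g x - f x) \<le> \<eta> * norm x)"
proof -
  obtain \<delta>0 L where \<delta>0: "0 < \<delta>0" and L: "0 \<le> L"
    and N: "\<And>D f e. unital_cstar_subalgebra D \<Longrightarrow> 0 \<le> e \<Longrightarrow> e \<le> \<delta>0 \<Longrightarrow> ahom B D (M + 3) e f \<Longrightarrow>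
      \<exists>g. shom B D g \<and> (\<forall>x\<in>B. norm (g x - f x) \<le> L * e * norm x)"
    using newton_limit[OF B, of "M + 3"] M by auto
  define c where "c = 13 + 6 * M"
  have c: "0 < c" using M by (simp add: c_def)
  \<comment> \<open>The three bounds serve the normalization, the start of Newton's iteration and
    the total error 3 \<delta> + L c \<delta>.\<close>
  define \<delta> where "\<delta> = min 1 (min (\<delta>0 / c) (\<eta> / (3 + L * c)))"
  have den: "0 < 3 + L * c" using L c by (simp add: add_pos_nonneg)
  have \<delta>: "0 < \<delta>" using \<delta>0 c den \<eta> by (simp add: \<delta>_def)
  moreover have "\<exists>g. shom B D g \<and> (\<forall>x\<in>B. norm (g x - f x) \<le> \<eta> * norm x)"
    if D: "unital_cstar_subalgebra D" and f: "near_shom B D M \<delta> f" for D f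
  proof -
    have "\<delta> \<le> \<delta>0 / c" "\<delta> \<le> \<eta> / (3 + L * c)" "\<delta> \<le> 1" by (simp_all add: \<delta>_def)
    then have c\<delta>: "c * \<delta> \<le> \<delta>0" and tot: "(3 + L * c) * \<delta> \<le> \<eta>"
      using c den by (simp_all add: pos_le_divide_eq mult.commute)
    obtain h where h: "ahom B D (M + 3) (c * \<delta>) h" "\<And>x. x \<in> B \<Longrightarrow> norm (h x - f x) \<le> 3 * \<delta> * norm x"
      using near_shom_normalize[OF B D f M less_imp_le[OF \<delta>] \<open>\<delta> \<le> 1\<close>, folded c_def] by blast
    obtain g where g: "shom B D g" "\<And>x. x \<in> B \<Longrightarrow> norm (g x - h x) \<le> L * (c * \<delta>) * norm x"
      using N[OF D _ c\<delta> h(1)] c \<delta> by auto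
    have "norm (g x - f x) \<le> \<eta> * norm x" if x: "x \<in> B" for x
    proof -
      have "norm (g x - f x) \<le> norm (g x - h x) + norm (h x - f x)"
        using norm_triangle_ineq[of "g x - h x" "h x - f x"] by simp
      also have "\<dots> \<le> (3 + L * c) * \<delta> * norm x"
        using g(2)[OF x] h(2)[OF x] by (simp add: algebra_simps)
      also have "\<dots> \<le> \<eta> * norm x" using tot by (intro mult_right_mono) auto
      finally show ?thesis .
    qed
    with g(1) show ?thesis by blast
  qed
  ultimately show ?thesis using that by blast
qed

section \<open>Local finite-dimensionality\<close>

definition locally_fd :: "'a::cstar_algebra set \<Rightarrow> bool" where
  "locally_fd D \<longleftrightarrow> (\<forall>X e. finite X \<and> X \<subseteq> D \<and> 0 < e \<longrightarrow>
     (\<exists>B. fdalg B \<and> B \<subseteq> D \<and> (\<forall>x\<in>X. \<exists>b\<in>B. norm (x - b) < e)))"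

text \<open>\<open>AF_algebra\<close> admits approximants without the unit; adjoining the scalars
  passes to the unital notion \<open>fdalg\<close>.\<close>

lemma fdalg_unitization:
  assumes F: "cstar_subalgebra F" "finite_dim F"
  shows "fdalg (cvec.span (insert 1 F))"
proof -
  have sub: "cvec.subspace F" and mult: "\<And>x y. x \<in> F \<Longrightarrow> y \<in> F \<Longrightarrow> x * y \<in> F"
    and adj: "\<And>x. x \<in> F \<Longrightarrow> adj x \<in> F"
    using F(1) by (auto simp: cstar_subalgebra_def)
  have span: "cvec.span (insert 1 F) = {x. \<exists>k. x - k *\<^sub>C 1 \<in> F}"
    unfolding cvec.span_insert cvec.span_eq_iff[THEN iffD2, OF sub] ..
  obtain S where S: "finite S" "F = cvec.span S"
    using F(2) unfolding finite_dim_def by blast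
  have span': "cvec.span (insert 1 F) = cvec.span (insert 1 S)"
    unfolding span unfolding S(2) cvec.span_insert ..
  show ?thesis
    unfolding fdalg_def
  proof (intro conjI ballI)
    show "cvec.subspace (cvec.span (insert 1 F))" by simp
    show "finite_dim (cvec.span (insert 1 F))"
      using S(1) span' unfolding finite_dim_def by blast
    show "1 \<in> cvec.span (insert 1 F)" by (simp add: cvec.span_base)
    show "adj x \<in> cvec.span (insert 1 F)" if "x \<in> cvec.span (insert 1 F)" for x
      using that adj unfolding span by (force simp: adj_diff adj_scaleC)
    fix x y assume "x \<in> cvec.span (insert 1 F)" "y \<in> cvec.span (insert 1 F)"
    then obtain k l where k: "x - k *\<^sub>C 1 \<in> F" and l: "y - l *\<^sub>C 1 \<in> F"
      unfolding span by blast
    have "x * y - (k * l) *\<^sub>C 1 = (x - k *\<^sub>C 1) * (y - l *\<^sub>C 1) + k *\<^sub>C (y - l *\<^sub>C 1) + l *\<^sub>C (x - k *\<^sub>C 1)"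
      by (simp add: algebra_simps mult_scaleC_left mult_scaleC_right
          cvec.scale_right_diff_distrib scaleC_scaleC)
    also have "\<dots> \<in> F"
      by (intro cvec.subspace_add cvec.subspace_scale sub mult k l)
    finally show "x * y \<in> cvec.span (insert 1 F)" unfolding span by blast
  qed
qed

lemma AF_algebra_locally_fd:
  assumes "AF_algebra (UNIV :: 'a::cstar_algebra set)"
  shows "locally_fd (UNIV :: 'a set)"
proof -
  obtain F :: "nat \<Rightarrow> 'a set" where F: "incseq F" "\<And>n. cstar_subalgebra (F n) \<and> finite_dim (F n)"
      "UNIV = closure (\<Union>n. F n)"
    using assms unfolding AF_algebra_def by blast
  show ?thesis
    unfolding locally_fd_def
  proof (intro allI impI, elim conjE)
    fix X :: "'a set" and e :: real
    assume X: "finite X" and e: "0 < e"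
    have "\<exists>n. \<exists>b\<in>F n. norm (x - b) < e" for x
    proof -
      have "x \<in> closure (\<Union>n. F n)" using F(3) by simp
      then show ?thesis
        using e unfolding closure_approachable by (auto simp: dist_norm norm_minus_commute)
    qed
    then obtain N where N: "\<And>x. \<exists>b\<in>F (N x). norm (x - b) < e" by metis
    define n where "n = Max (insert 0 (N ` X))"
    have "\<exists>b\<in>cvec.span (insert 1 (F n)). norm (x - b) < e" if "x \<in> X" for x
    proof -
      have "N x \<le> n" using X that by (simp add: n_def)
      then have "F (N x) \<subseteq> F n" using F(1) by (simp add: incseqD)
      then show ?thesis using N[of x] cvec.span_base by blast
    qed
    then show "\<exists>B. fdalg B \<and> B \<subseteq> UNIV \<and> (\<forall>x\<in>X. \<exists>b\<in>B. norm (x - b) < e)"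
      using fdalg_unitization F(2) by blast
  qed
qed


section \<open>Positivity\<close>

text \<open>A closed cone by construction, so positivity can be checked on sums of squares and
  passed to limits. No square roots are needed.\<close>

definition Pos :: "'a::cstar_algebra set" where
  "Pos = closure (sos UNIV)"

definition ple :: "'a::cstar_algebra \<Rightarrow> 'a \<Rightarrow> bool" (infix \<open>\<preceq>\<close> 50) where
  "a \<preceq> b \<longleftrightarrow> b - a \<in> Pos"

lemma Pos_limit: "(\<And>n. X n \<in> Pos) \<Longrightarrow> X \<longlonglongrightarrow> a \<Longrightarrow> a \<in> Pos"
  unfolding Pos_def using closed_sequentially[OF closed_closure] by blast

lemma Pos_sequence: "a \<in> Pos \<Longrightarrow> \<exists>X. (\<forall>n. X n \<in> sos UNIV) \<and> X \<longlonglongrightarrow> a"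
  unfolding Pos_def closure_sequential by blast

lemma sos_Pos: "a \<in> sos B \<Longrightarrow> a \<in> Pos"
  unfolding Pos_def using sos_mono[of B UNIV] closure_subset by blast

lemma Pos_image:
  assumes "a \<in> Pos" and f: "\<And>a. a \<in> sos UNIV \<Longrightarrow> f a \<in> Pos"
    and cont: "\<And>X a. X \<longlonglongrightarrow> a \<Longrightarrow> (\<lambda>n. f (X n)) \<longlonglongrightarrow> f a"
  shows "f a \<in> Pos"
proof -
  obtain X where X: "\<And>n. X n \<in> sos UNIV" "X \<longlonglongrightarrow> a"
    using Pos_sequence[OF assms(1)] by blast
  show ?thesis
    by (rule Pos_limit[OF f[OF X(1)] cont[OF X(2)]])
qed

lemma Pos_square: "adj x * x \<in> Pos"
  using sos_Pos[OF sos_square[of x UNIV]] by simp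

lemma Pos_0: "0 \<in> Pos"
  using sos_Pos[OF sos_0] .

lemma Pos_add:
  assumes "a \<in> Pos" "b \<in> Pos"
  shows "a + b \<in> Pos"
proof -
  obtain X Y where XY: "\<And>n. X n \<in> sos UNIV" "X \<longlonglongrightarrow> a" "\<And>n. Y n \<in> sos UNIV" "Y \<longlonglongrightarrow> b"
    using assms[THEN Pos_sequence] by blast
  show ?thesis
    by (rule Pos_limit[OF sos_Pos[OF sos_add[OF XY(3,1)]] tendsto_add[OF XY(2,4)]])
qed

lemma Pos_sum: "(\<And>i. i \<in> I \<Longrightarrow> f i \<in> Pos) \<Longrightarrow> sum f I \<in> Pos"
  by (induction I rule: infinite_finite_induct) (auto intro: Pos_0 Pos_add)

lemma Pos_conj: "a \<in> Pos \<Longrightarrow> adj y * a * y \<in> Pos"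
proof (rule Pos_image[where f = "\<lambda>a. adj y * a * y"])
  show "adj y * a * y \<in> Pos" if "a \<in> sos UNIV" for a
    using sos_Pos sos_conj[OF _ that, of y] by blast
qed (auto intro!: tendsto_intros)

lemma Pos_scaleR: "a \<in> Pos \<Longrightarrow> 0 \<le> r \<Longrightarrow> r *\<^sub>R a \<in> Pos"
  using Pos_conj[of a "sqrt r *\<^sub>R 1"] by (simp add: adj_scaleR)

lemma Pos_selfadj: "a \<in> Pos \<Longrightarrow> adj a = a"
proof -
  assume "a \<in> Pos"
  then obtain X where X: "\<And>n. X n \<in> sos UNIV" "X \<longlonglongrightarrow> a"
    using Pos_sequence by blast
  have "X \<longlonglongrightarrow> adj a"
    using tendsto_adj[OF X(2)] by (simp add: sos_selfadj[OF X(1)])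
  then show ?thesis using X(2) LIMSEQ_unique by blast
qed

lemma approximating_sequence:
  assumes loc: "locally_fd (UNIV :: 'a::cstar_algebra set)" and X: "finite (X :: 'a set)"
  obtains B f where "\<And>n. fdalg (B n)" "\<And>n x. x \<in> X \<Longrightarrow> f n x \<in> B n"
    "\<And>x. x \<in> X \<Longrightarrow> (\<lambda>n. f n x) \<longlonglongrightarrow> x"
proof -
  have "\<exists>B f. fdalg B \<and> (\<forall>x\<in>X. f x \<in> B \<and> norm (x - f x) < inverse (real (Suc n)))" for n
  proof -
    obtain B where "fdalg B" "\<forall>x\<in>X. \<exists>b\<in>B. norm (x - b) < inverse (real (Suc n))"
      using loc X unfolding locally_fd_def by (metis inverse_positive_iff_positive of_nat_0_less_iff
          subset_UNIV zero_less_Suc)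
    then show ?thesis by metis
  qed
  then obtain B f where Bf: "\<And>n. fdalg (B n)"
      "\<And>n x. x \<in> X \<Longrightarrow> f n x \<in> B n \<and> norm (x - f n x) < inverse (real (Suc n))"
    by metis
  have "(\<lambda>n. f n x) \<longlonglongrightarrow> x" if "x \<in> X" for x
  proof -
    have "(\<lambda>n. x - f n x) \<longlonglongrightarrow> 0"
    proof (rule Lim_null_comparison)
      show "\<forall>\<^sub>F n in sequentially. norm (x - f n x) \<le> inverse (real (Suc n))"
        using Bf(2)[OF that] by (simp add: less_imp_le)
    qed (rule LIMSEQ_inverse_real_of_nat)
    from tendsto_diff[OF tendsto_const[of x] this] show ?thesis by simp
  qed
  with Bf show ?thesis using that by blast
qed

text \<open>\<open>X\<close> collects the elements whose squares are summed. Leaving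
  \<open>B\<close> and \<open>f\<close> arbitrary lets one sequence of algebras serve two elements
  at once.\<close>

lemma sos_approximation:
  assumes "a \<in> sos (UNIV :: 'a::cstar_algebra set)"
  shows "\<exists>X. finite X \<and> (\<forall>B f. (\<forall>x\<in>X. (\<forall>n. f n x \<in> B n) \<and> (\<lambda>n. f n x) \<longlonglongrightarrow> x) \<longrightarrow>
    (\<exists>b. (\<forall>n. b n \<in> sos (B n)) \<and> b \<longlonglongrightarrow> a))"
  using assms
proof (induction a rule: sos.induct)
  case sos_0
  show ?case
    by (rule exI[of _ "{}"]) (auto intro!: exI[of _ "\<lambda>_. 0"] sos.sos_0)
next
  case (sos_step a x)
  then obtain X where X: "finite X"
    "\<And>B f. (\<forall>x\<in>X. (\<forall>n. f n x \<in> B n) \<and> (\<lambda>n. f n x) \<longlonglongrightarrow> x) \<Longrightarrow>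
      (\<exists>b. (\<forall>n. b n \<in> sos (B n)) \<and> b \<longlonglongrightarrow> a)"
    by blast
  show ?case
  proof (intro exI[of _ "insert x X"] conjI allI impI)
    show "finite (insert x X)" using X(1) by simp
    fix B :: "nat \<Rightarrow> 'a set" and f
    assume f: "\<forall>y\<in>insert x X. (\<forall>n. f n y \<in> B n) \<and> (\<lambda>n. f n y) \<longlonglongrightarrow> y"
    then obtain b where b: "\<And>n. b n \<in> sos (B n)" "b \<longlonglongrightarrow> a"
      using X(2)[of f B] by blast
    have "(\<lambda>n. b n + adj (f n x) * f n x) \<longlonglongrightarrow> a + adj x * x"
      using f by (intro tendsto_intros b tendsto_adj) auto
    then show "\<exists>b. (\<forall>n. b n \<in> sos (B n)) \<and> b \<longlonglongrightarrow> a + adj x * x"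
      using b f by (intro exI[of _ "\<lambda>n. b n + adj (f n x) * f n x"]) (auto intro: sos.sos_step)
  qed
qed

text \<open>Both sums of squares are approximated in a common sequence of finite-dimensional
  algebras, where \<open>fdalg_norm_mono\<close> applies; a second limit reaches the
  closure.\<close>

lemma Pos_norm_mono:
  assumes loc: "locally_fd (UNIV :: 'a::cstar_algebra set)" and a: "a \<in> Pos" and b: "(b :: 'a) \<in> Pos"
  shows "norm a \<le> norm (a + b)"
proof -
  have sos: "norm a \<le> norm (a + b)" if a: "a \<in> sos UNIV" and b: "b \<in> sos UNIV" for a b :: 'a
  proof -
    obtain X where X: "finite X" "\<And>B f. (\<forall>x\<in>X. (\<forall>n. f n x \<in> B n) \<and> (\<lambda>n. f n x) \<longlonglongrightarrow> x) \<longrightarrow>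
        (\<exists>b. (\<forall>n. b n \<in> sos (B n)) \<and> b \<longlonglongrightarrow> a)"
      using sos_approximation[OF a] by blast
    obtain Y where Y: "finite Y" "\<And>B f. (\<forall>x\<in>Y. (\<forall>n. f n x \<in> B n) \<and> (\<lambda>n. f n x) \<longlonglongrightarrow> x) \<longrightarrow>
        (\<exists>a. (\<forall>n. a n \<in> sos (B n)) \<and> a \<longlonglongrightarrow> b)"
      using sos_approximation[OF b] by blast
    obtain B f where B: "\<And>n. fdalg (B n)" "\<And>n x. x \<in> X \<union> Y \<Longrightarrow> f n x \<in> B n"
        "\<And>x. x \<in> X \<union> Y \<Longrightarrow> (\<lambda>n. f n x) \<longlonglongrightarrow> x"
      using approximating_sequence[OF loc finite_UnI[OF X(1) Y(1)]] by blast
    obtain s where s: "\<And>n. s n \<in> sos (B n)" "s \<longlonglongrightarrow> a"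
      using X(2)[of f B] B by blast
    obtain t where t: "\<And>n. t n \<in> sos (B n)" "t \<longlonglongrightarrow> b"
      using Y(2)[of f B] B by blast
    show ?thesis
    proof (rule LIMSEQ_le)
      show "(\<lambda>n. norm (s n)) \<longlonglongrightarrow> norm a" "(\<lambda>n. norm (s n + t n)) \<longlonglongrightarrow> norm (a + b)"
        by (intro tendsto_intros s t)+
      show "\<exists>N. \<forall>n\<ge>N. norm (s n) \<le> norm (s n + t n)"
        using fdalg_norm_mono[OF B(1) s(1) t(1)] by blast
    qed
  qed
  obtain X Y where XY: "\<And>n. X n \<in> sos UNIV" "X \<longlonglongrightarrow> a" "\<And>n. Y n \<in> sos UNIV" "Y \<longlonglongrightarrow> b"
    using a b[THEN Pos_sequence] Pos_sequence[OF a] by blast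
  show ?thesis
  proof (rule LIMSEQ_le)
    show "(\<lambda>n. norm (X n)) \<longlonglongrightarrow> norm a" "(\<lambda>n. norm (X n + Y n)) \<longlonglongrightarrow> norm (a + b)"
      by (intro tendsto_intros XY)+
    show "\<exists>N. \<forall>n\<ge>N. norm (X n) \<le> norm (X n + Y n)"
      using sos[OF XY(1,3)] by blast
  qed
qed

lemma Pos_norm_minus:
  assumes loc: "locally_fd (UNIV :: 'a::cstar_algebra set)" and h: "adj h = (h :: 'a)" and r: "norm h \<le> r"
  shows "r *\<^sub>R 1 - h \<in> Pos"
proof -
  obtain B f where B: "\<And>n. fdalg (B n)" "\<And>n. f n h \<in> B n" "(\<lambda>n. f n h) \<longlonglongrightarrow> h"
    using approximating_sequence[OF loc, of "{h}"] by auto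
  define g where "g n = (1/2) *\<^sub>R (f n h + adj (f n h))" for n
  have "g \<longlonglongrightarrow> (1/2) *\<^sub>R (h + adj h)"
    unfolding g_def by (intro tendsto_intros tendsto_adj B)
  then have g: "g \<longlonglongrightarrow> h" using h by (simp add: scaleR_half_double)
  have "g n \<in> B n" "adj (g n) = g n" for n
    using fdalgD(3,7,10)[OF B(1)] B(2) by (simp_all add: g_def adj_scaleR adj_add adj_adj add.commute)
  then have "norm (g n) *\<^sub>R 1 - g n \<in> Pos" for n
    using sos_Pos[OF fdalg_norm_minus_sos[OF B(1)]] by blast
  moreover have "(\<lambda>n. norm (g n) *\<^sub>R 1 - g n) \<longlonglongrightarrow> norm h *\<^sub>R 1 - h"
    by (intro tendsto_intros g)
  ultimately have "norm h *\<^sub>R 1 - h \<in> Pos"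
    by (rule Pos_limit)
  moreover have "(r - norm h) *\<^sub>R 1 \<in> (Pos :: 'a set)"
    using Pos_scaleR[OF Pos_square[of 1], of "r - norm h"] r by simp
  ultimately have "(norm h *\<^sub>R 1 - h) + (r - norm h) *\<^sub>R 1 \<in> Pos" by (rule Pos_add)
  then show ?thesis by (simp add: scaleR_left_diff_distrib)
qed

lemma ple_refl: "a \<preceq> a"
  by (simp add: ple_def Pos_0)

lemma ple_trans [trans]: "a \<preceq> b \<Longrightarrow> b \<preceq> c \<Longrightarrow> a \<preceq> c"
  unfolding ple_def using Pos_add[of "b - a" "c - b"] by simp

lemma ple_sum: "(\<And>i. i \<in> I \<Longrightarrow> f i \<preceq> g i) \<Longrightarrow> sum f I \<preceq> sum g I"
  unfolding ple_def sum_subtractf[symmetric] by (rule Pos_sum)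

lemma ple_scaleR: "a \<preceq> b \<Longrightarrow> 0 \<le> r \<Longrightarrow> r *\<^sub>R a \<preceq> r *\<^sub>R b"
  unfolding ple_def scaleR_diff_right[symmetric] by (rule Pos_scaleR)

lemma ple_member_sum:
  assumes "finite I" "i \<in> I" "\<And>j. j \<in> I \<Longrightarrow> f j \<in> Pos"
  shows "f i \<preceq> sum f I"
  unfolding ple_def using assms Pos_sum[of "I - {i}" f] by (simp add: sum_diff1)

lemma ple_norm:
  assumes "locally_fd (UNIV :: 'a::cstar_algebra set)" "a \<in> Pos" "a \<preceq> (b :: 'a)"
  shows "norm a \<le> norm b"
  using Pos_norm_mono[OF assms(1,2), of "b - a"] assms(3) by (simp add: ple_def)

lemma ple_square_bound:
  assumes "locally_fd (UNIV :: 'a::cstar_algebra set)"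
  shows "adj (v * x) * (v * x) \<preceq> (norm v)\<^sup>2 *\<^sub>R (adj x * (x :: 'a))"
proof -
  have "(norm v)\<^sup>2 *\<^sub>R 1 - adj v * v \<in> Pos"
    by (rule Pos_norm_minus[OF assms]) (simp_all add: adj_mult adj_adj norm_adj_mult_self)
  from Pos_conj[OF this, of x] show ?thesis
    by (simp add: ple_def adj_mult algebra_simps)
qed

section \<open>Frames for a conditional expectation of finite index\<close>

locale finite_index_expectation =
  fixes P :: "'a::cstar_algebra set" and E :: "'a \<Rightarrow> 'a" and n :: nat and u v :: "nat \<Rightarrow> 'a"
  assumes loc: "locally_fd (UNIV :: 'a set)" and P: "unital_cstar_subalgebra P"
    and E: "conditional_expectation P E" and qb: "quasi_basis E n u v"
begin

lemmas PD = unital_cstar_subalgebraD[OF P]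

lemma linear_E: "Vector_Spaces.linear scaleC scaleC E"
  using E by (simp add: conditional_expectation_def)

lemma E_plus: "E (x + y) = E x + E y"
proof -
  interpret Vector_Spaces.linear scaleC scaleC E by (rule linear_E)
  show ?thesis by (rule add)
qed

lemma E_scaleC: "E (c *\<^sub>C x) = c *\<^sub>C E x"
proof -
  interpret Vector_Spaces.linear scaleC scaleC E by (rule linear_E)
  show ?thesis by (rule scale)
qed

lemma E_scaleR: "E (r *\<^sub>R x) = r *\<^sub>R E x"
  by (simp add: scaleR_scaleC E_scaleC)

lemma E_0: "E 0 = 0"
  using E_scaleC[of 0 0] by simp

lemma E_diff: "E (x - y) = E x - E y"
  using E_plus[of "x - y" y] by simp

lemma E_sum: "E (sum f I) = (\<Sum>i\<in>I. E (f i))"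
  by (induction I rule: infinite_finite_induct) (simp_all add: E_0 E_plus)

lemma E_mem: "E x \<in> P" and E_id: "p \<in> P \<Longrightarrow> E p = p" and E_norm: "norm (E x) \<le> norm x"
  using E by (auto simp: conditional_expectation_def)

lemma E_left: "p \<in> P \<Longrightarrow> E (p * x) = p * E x" and E_right: "p \<in> P \<Longrightarrow> E (x * p) = E x * p"
proof -
  have bi: "\<forall>p\<in>P. \<forall>q\<in>P. \<forall>a. E (p * a * q) = p * E a * q"
    using E by (simp add: conditional_expectation_def)
  show "E (p * x) = p * E x" if "p \<in> P"
    using bi[rule_format, OF that PD(5), of x] by simp
  show "E (x * p) = E x * p" if "p \<in> P"
    using bi[rule_format, OF PD(5) that, of x] by simp
qed

lemma bounded_linear_E: "bounded_linear E"
  by (rule bounded_linear_intro[where K = 1]) (simp_all add: E_plus E_scaleR E_norm)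

lemmas tendsto_E = bounded_linear.tendsto[OF bounded_linear_E]

lemma E_sos: "a \<in> sos UNIV \<Longrightarrow> E a \<in> sos UNIV"
proof (induction a rule: sos.induct)
  case (sos_step a x)
  have "positive (E (adj x * x))"
    using E unfolding conditional_expectation_def positive_def by blast
  then obtain y where "E (adj x * x) = adj y * y"
    unfolding positive_def by blast
  then show ?case
    using sos.sos_step[OF sos_step.IH, of y] by (simp add: E_plus)
qed (simp add: E_0 sos.sos_0)

lemma E_Pos: "a \<in> Pos \<Longrightarrow> E a \<in> Pos"
  by (rule Pos_image[where f = E]) (auto intro: sos_Pos[OF E_sos] tendsto_E)

text \<open>For self-adjoint h, 4 h is the difference of the squares of h + 1 and h - 1, so
  \<open>E h\<close> is a real multiple of a difference of positive elements. The general case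
  follows from the Cartesian decomposition.\<close>

lemma E_adj: "E (adj x) = adj (E x)"
proof -
  have sa: "adj (E h) = E h" if h: "adj h = h" for h
  proof -
    have "(4 :: real) *\<^sub>R h = 2 *\<^sub>R 2 *\<^sub>R h" by simp
    also have "\<dots> = (h + h) + (h + h)" by (simp only: scaleR_2)
    also have "\<dots> = adj (h + 1) * (h + 1) - adj (h - 1) * (h - 1)"
      by (simp add: adj_add adj_diff h algebra_simps)
    finally have "4 *\<^sub>R E h = E (adj (h + 1) * (h + 1)) - E (adj (h - 1) * (h - 1))"
      by (metis E_diff E_scaleR)
    then have "adj (4 *\<^sub>R E h) = 4 *\<^sub>R E h"
      using Pos_selfadj[OF E_Pos[OF Pos_square]] by (metis adj_diff)
    then show ?thesis by (simp add: adj_scaleR)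
  qed
  define h k where "h = x + adj x" and "k = \<i> *\<^sub>C (x - adj x)"
  note c = cartesian_parts[of x, folded h_def k_def]
  have "E (adj x) = (1/2) *\<^sub>C E h + (\<i> / 2) *\<^sub>C E k"
    by (subst c(3)) (simp only: adj_add adj_scaleC c(1,2) E_plus E_scaleC, simp)
  moreover have "adj (E x) = (1/2) *\<^sub>C E h + (\<i> / 2) *\<^sub>C E k"
    by (subst c(3)) (simp only: adj_add adj_scaleC sa[OF c(1)] sa[OF c(2)] E_plus E_scaleC, simp)
  ultimately show ?thesis by simp
qed

lemma quasi_left: "(\<Sum>i<n. u i * E (v i * x)) = x" and quasi_right: "(\<Sum>i<n. E (x * u i) * v i) = x"
  using qb unfolding quasi_basis_def by metis+

text \<open>The difference is \<open>E\<close> of the square of x - E x, by the bimodule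
  property.\<close>

lemma Kadison: "adj (E x) * E x \<preceq> E (adj x * x)"
proof -
  let ?d = "x - E x"
  have "adj ?d * ?d = adj x * x - adj x * E x - adj (E x) * x + adj (E x) * E x"
    by (simp add: adj_diff algebra_simps)
  then have "E (adj ?d * ?d) = E (adj x * x) - adj (E x) * E x"
    using E_mem PD(3,4) by (simp add: E_plus E_diff E_left E_right E_id E_adj)
  then show ?thesis
    unfolding ple_def by (metis E_Pos Pos_square)
qed

lemma E_mult_bound: "(norm (E (w * x)))\<^sup>2 \<le> (norm w)\<^sup>2 * norm (E (adj x * x))"
proof -
  have "adj (E (w * x)) * E (w * x) \<preceq> E (adj (w * x) * (w * x))"
    by (rule Kadison)
  also have "E (adj (w * x) * (w * x)) \<preceq> (norm w)\<^sup>2 *\<^sub>R E (adj x * x)"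
    using E_Pos[OF ple_square_bound[OF loc, of w x, unfolded ple_def]]
    by (simp add: ple_def E_diff E_scaleR)
  finally have "norm (adj (E (w * x)) * E (w * x)) \<le> norm ((norm w)\<^sup>2 *\<^sub>R E (adj x * x))"
    by (rule ple_norm[OF loc Pos_square])
  then show ?thesis by (simp add: norm_adj_mult_self)
qed

text \<open>A numerical constant for estimates, not the index itself, which appears below as
  \<open>w\<close>.\<close>

definition idx :: real where "idx = (\<Sum>i<n. norm (u i) * norm (v i))"

text \<open>A Pimsner-Popa type estimate, by which the module norm controls the norm of
  \<open>A\<close>: expand x in the quasi-basis and bound each coefficient by
  \<open>E_mult_bound\<close>.\<close>

lemma norm_le_E: "norm x \<le> idx * sqrt (norm (E (adj x * x)))"
proof -
  have "norm x \<le> (\<Sum>i<n. norm (u i * E (v i * x)))"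
    by (subst quasi_left[of x, symmetric]) (rule norm_sum)
  also have "\<dots> \<le> (\<Sum>i<n. norm (u i) * (norm (v i) * sqrt (norm (E (adj x * x)))))"
  proof (intro sum_mono order_trans[OF norm_mult_ineq] mult_left_mono)
    fix i
    have "norm (E (v i * x)) \<le> sqrt ((norm (v i))\<^sup>2 * norm (E (adj x * x)))"
      by (rule real_le_rsqrt[OF E_mult_bound])
    then show "norm (E (v i * x)) \<le> norm (v i) * sqrt (norm (E (adj x * x)))"
      by (simp add: real_sqrt_mult)
  qed simp
  also have "\<dots> = idx * sqrt (norm (E (adj x * x)))"
    by (simp add: idx_def sum_distrib_right mult.assoc)
  finally show ?thesis .
qed

section \<open>The frame operator and a polynomial iteration\<close>

definition rs :: real where "rs = 1 / (1 + (\<Sum>i<n. (norm (v i))\<^sup>2))"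

text \<open>The scaled frame operator of the vectors \<open>adj (v i)\<close> for the inner product
  \<open>E (adj x * y)\<close>. The factor \<open>rs\<close> makes it at most 1, see
  \<open>S_bounds\<close>; the summand 1 in \<open>rs\<close> keeps the denominator
  positive.\<close>

definition S :: "'a \<Rightarrow> 'a" where "S x = rs *\<^sub>R (\<Sum>i<n. adj (v i) * E (v i * x))"

lemma rs_pos: "0 < rs"
  by (simp add: rs_def sum_nonneg add_pos_nonneg)

text \<open>The self-adjoint right \<open>P\<close>-linear maps for
  \<open>E (adj x * y)\<close>.\<close>

definition module_op :: "('a \<Rightarrow> 'a) \<Rightarrow> bool" where
  "module_op X \<longleftrightarrow> (\<forall>x y. X (x + y) = X x + X y) \<and> (\<forall>r x. X (r *\<^sub>R x) = r *\<^sub>R X x) \<and>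
     (\<forall>x. \<forall>p\<in>P. X (x * p) = X x * p) \<and> (\<forall>x y. E (adj (X x) * y) = E (adj x * X y))"

lemma module_opD:
  assumes "module_op X"
  shows "X (x + y) = X x + X y" "X (r *\<^sub>R x) = r *\<^sub>R X x" "p \<in> P \<Longrightarrow> X (x * p) = X x * p"
    "E (adj (X x) * y) = E (adj x * X y)"
  using assms by (auto simp: module_op_def)

lemma module_op_diff: "module_op X \<Longrightarrow> X (x - y) = X x - X y"
  using module_opD(1)[of X "x - y" y] by simp

lemma module_op_sum: "module_op X \<Longrightarrow> X (sum f I) = (\<Sum>i\<in>I. X (f i))"
proof (induction I rule: infinite_finite_induct)
  case (insert i I)
  then show ?case by (simp add: module_opD(1))
qed (use module_op_diff[of X 0 0] in auto)

lemma module_op_id: "module_op (\<lambda>x. x)"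
  by (simp add: module_op_def)

lemma module_op_S: "module_op S"
  unfolding module_op_def
proof (intro conjI allI ballI)
  fix x y r p
  show "S (x + y) = S x + S y"
    by (simp add: S_def distrib_left E_plus sum.distrib scaleR_add_right)
  show "S (r *\<^sub>R x) = r *\<^sub>R S x"
    by (simp add: S_def E_scaleR scaleR_sum_right mult.commute)
  show "S (x * p) = S x * p" if "p \<in> P"
    using that by (simp add: S_def mult.assoc[symmetric] E_right sum_distrib_right)
  have "E (adj (S x) * y) = rs *\<^sub>R (\<Sum>i<n. adj (E (v i * x)) * E (v i * y))"
    using PD(4)[OF E_mem]
    by (simp add: S_def adj_scaleR adj_sum adj_mult adj_adj sum_distrib_right E_scaleR E_sum
        mult.assoc E_left)
  moreover have "E (adj x * S y) = rs *\<^sub>R (\<Sum>i<n. adj (E (v i * x)) * E (v i * y))"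
    using E_mem
    by (simp add: S_def sum_distrib_left E_scaleR E_sum mult.assoc[symmetric] E_right E_adj[symmetric]
        adj_mult)
  ultimately show "E (adj (S x) * y) = E (adj x * S y)" by simp
qed

text \<open>The symmetric form X - X Y X preserves self-adjointness whether or not the maps commute.
  With \<open>Y = S\<close> it is the recursion of \<open>resid\<close>.\<close>

lemma module_op_combine:
  assumes X: "module_op X" and Y: "module_op Y"
  shows "module_op (\<lambda>x. X x - X (Y (X x)))"
  unfolding module_op_def
proof (intro conjI allI ballI)
  note x = module_opD[OF X] and y = module_opD[OF Y]
  fix a b :: 'a and r p
  show "X (a + b) - X (Y (X (a + b))) = X a - X (Y (X a)) + (X b - X (Y (X b)))"
    by (simp add: x(1) y(1))
  show "X (r *\<^sub>R a) - X (Y (X (r *\<^sub>R a))) = r *\<^sub>R (X a - X (Y (X a)))"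
    by (simp add: x(2) y(2) scaleR_diff_right)
  show "X (a * p) - X (Y (X (a * p))) = (X a - X (Y (X a))) * p" if "p \<in> P"
    by (simp add: x(3) y(3) that left_diff_distrib)
  show "E (adj (X a - X (Y (X a))) * b) = E (adj a * (X b - X (Y (X b))))"
    by (simp add: adj_diff left_diff_distrib right_diff_distrib E_diff x(4) y(4))
qed

text \<open>The recursion is chosen so that \<open>h\<^sub>k = S y\<^sub>k\<close> satisfies \<open>h\<^sub>k\<^sub>+\<^sub>1 = h\<^sub>k - h\<^sub>k\<^sup>2\<close>, hence
  \<open>\<Sum>\<^sub>k h\<^sub>k\<^sup>2 \<le> S\<close> and \<open>h\<^sub>k \<rightarrow> 0\<close>, while \<open>1 = \<Sum>\<^sub>k y\<^sub>k S y\<^sub>k + y\<^sub>n\<close> (\<open>y\<close> is \<open>resid\<close>, \<open>h\<close> is \<open>hop\<close>).\<close>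

primrec resid :: "nat \<Rightarrow> 'a \<Rightarrow> 'a" where
  "resid 0 x = x"
| "resid (Suc k) x = resid k x - resid k (S (resid k x))"

definition hop :: "nat \<Rightarrow> 'a \<Rightarrow> 'a" where "hop k x = S (resid k x)"

lemma module_op_resid: "module_op (resid k)"
proof (induction k)
  case 0
  then show ?case using module_op_id by (simp add: module_op_def)
next
  case (Suc k)
  have "resid (Suc k) = (\<lambda>x. resid k x - resid k (S (resid k x)))" by auto
  then show ?case using module_op_combine[OF Suc module_op_S] by simp
qed

lemma hop_0: "hop 0 x = S x" and hop_Suc: "hop (Suc k) x = hop k x - hop k (hop k x)"
  by (simp_all add: hop_def module_op_diff[OF module_op_S])

lemma module_op_hop: "module_op (hop k)"
proof (induction k)
  case 0
  have "hop 0 = S" by (simp add: hop_0 fun_eq_iff)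
  then show ?case using module_op_S by simp
next
  case (Suc k)
  have "hop (Suc k) = (\<lambda>x. hop k x - hop k (hop k x))" by (simp add: hop_Suc fun_eq_iff)
  then show ?case
    using Suc unfolding module_op_def
    by (simp add: left_diff_distrib scaleR_diff_right adj_diff right_diff_distrib E_diff algebra_simps)
qed

lemma S_form: "E (adj x * S x) = rs *\<^sub>R (\<Sum>i<n. adj (E (v i * x)) * E (v i * x))"
  using E_mem
  by (simp add: S_def sum_distrib_left E_scaleR E_sum mult.assoc[symmetric] E_right E_adj[symmetric]
      adj_mult)

text \<open>The form of \<open>S\<close> is a sum of squares, and the i-th of them is at most the
  square of \<open>norm (v i)\<close> times \<open>E (adj x * x)\<close>; \<open>rs\<close> absorbs
  these constants.\<close>

lemma S_bounds: "E (adj x * S x) \<in> Pos" "E (adj x * S x) \<preceq> E (adj x * x)"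
proof -
  show "E (adj x * S x) \<in> Pos"
    unfolding S_form using rs_pos by (intro Pos_scaleR Pos_sum Pos_square) simp
  have "adj (E (v i * x)) * E (v i * x) \<preceq> (norm (v i))\<^sup>2 *\<^sub>R E (adj x * x)" for i
    using ple_trans[OF Kadison[of "v i * x"]] E_Pos[OF ple_square_bound[OF loc, of "v i" x, unfolded ple_def]]
    by (simp add: ple_def E_diff E_scaleR)
  then have "E (adj x * S x) \<preceq> rs *\<^sub>R (\<Sum>i<n. (norm (v i))\<^sup>2 *\<^sub>R E (adj x * x))"
    unfolding S_form using rs_pos by (intro ple_scaleR ple_sum) auto
  also have "\<dots> = (rs * (\<Sum>i<n. (norm (v i))\<^sup>2)) *\<^sub>R E (adj x * x)"
    by (simp only: scaleR_sum_left[symmetric] scaleR_scaleR)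
  also have "\<dots> \<preceq> E (adj x * x)"
  proof -
    let ?t = "rs * (\<Sum>i<n. (norm (v i))\<^sup>2)"
    have "?t \<le> 1" by (simp add: rs_def divide_le_eq sum_nonneg add_pos_nonneg)
    then have "(1 - ?t) *\<^sub>R E (adj x * x) \<in> Pos"
      by (intro Pos_scaleR E_Pos Pos_square) simp
    then show ?thesis by (simp add: ple_def scaleR_left_diff_distrib)
  qed
  finally show "E (adj x * S x) \<preceq> E (adj x * x)" .
qed

text \<open>Both \<open>h - h\<^sup>2 = h (1 - h) h + (1 - h) h (1 - h)\<close> and \<open>1 - h + h\<^sup>2\<close> are positive for
  \<open>0 \<le> h \<le> 1\<close>.\<close>

lemma hop_bounds: "E (adj x * hop k x) \<in> Pos \<and> E (adj x * (x - hop k x)) \<in> Pos"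
proof (induction k arbitrary: x)
  case 0
  then show ?case
    using S_bounds[of x] by (simp add: hop_0 ple_def right_diff_distrib E_diff)
next
  case (Suc k)
  note h = module_opD[OF module_op_hop[of k]] and hd = module_op_diff[OF module_op_hop[of k]]
  let ?h = "hop k"
  have "E (adj x * hop (Suc k) x) =
      E (adj (?h x) * (?h x - ?h (?h x))) + E (adj (x - ?h x) * ?h (x - ?h x))"
    by (simp add: hop_Suc hd adj_diff right_diff_distrib left_diff_distrib E_diff h(4))
  moreover have "E (adj x * (x - hop (Suc k) x)) = E (adj x * (x - ?h x)) + E (adj (?h x) * ?h x)"
    by (simp add: hop_Suc right_diff_distrib E_diff h(4))
  ultimately show ?case
    using Suc[of "?h x"] Suc[of "x - ?h x"] Suc[of x] E_Pos[OF Pos_square[of "?h x"]]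
    by (auto intro: Pos_add)
qed

text \<open>With h' = h - h^2, the difference of the squares of h and h' is h h h + h h' h, a sum of
  positive forms evaluated at h x.\<close>

lemma hop_square_decreasing:
  "E (adj (hop (Suc k) x) * hop (Suc k) x) \<preceq> E (adj (hop k x) * hop k x)"
proof -
  note h = module_opD[OF module_op_hop[of k]] and hd = module_op_diff[OF module_op_hop[of k]]
  let ?h = "hop k"
  let ?y = "?h x"
  have "E (adj ?y * ?y) - E (adj (hop (Suc k) x) * hop (Suc k) x) =
      E (adj ?y * ?h ?y) + E (adj ?y * hop (Suc k) ?y)"
    by (simp add: hop_Suc hd adj_diff right_diff_distrib left_diff_distrib E_diff h(4))
  then show ?thesis
    unfolding ple_def using hop_bounds[of ?y k] hop_bounds[of ?y "Suc k"] by (auto intro: Pos_add)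
qed

text \<open>The recursion telescopes, so the squares of all \<open>hop k\<close> add up to at most
  \<open>S\<close>, hence at most 1. Since they decrease, m times the last one is below the sum of
  the first m.\<close>

lemma hop_square_bound: "real m * norm (E (adj (hop m x) * hop m x)) \<le> (norm x)\<^sup>2"
proof -
  let ?a = "\<lambda>k. E (adj (hop k x) * hop k x)"
  have dec: "?a m \<preceq> ?a k" if "k \<le> m" for k
    using that
  proof (induction m rule: dec_induct)
    case (step m)
    then show ?case using ple_trans[OF hop_square_decreasing] by blast
  qed (rule ple_refl)
  have tel: "(\<Sum>k<m. ?a k) + E (adj x * hop m x) = E (adj x * S x)" for m
  proof (induction m)
    case (Suc m)
    have "E (adj x * hop m x) = ?a m + E (adj x * hop (Suc m) x)"
      by (simp add: hop_Suc right_diff_distrib E_diff module_opD(4)[OF module_op_hop])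
    with Suc show ?case by (simp add: add.assoc)
  qed (simp add: hop_0)
  have "(\<Sum>k<m. ?a m) \<preceq> (\<Sum>k<m. ?a k)"
    by (intro ple_sum dec) simp
  also have "\<dots> \<preceq> E (adj x * S x)"
    using tel[of m, symmetric] hop_bounds[of x m] by (simp add: ple_def)
  also have "\<dots> \<preceq> E (adj x * x)" by (rule S_bounds)
  finally have "real m *\<^sub>R ?a m \<preceq> E (adj x * x)"
    by (simp add: scaleR_conv_of_real)
  moreover have "real m *\<^sub>R ?a m \<in> Pos"
    by (intro Pos_scaleR E_Pos Pos_square) simp
  ultimately have "norm (real m *\<^sub>R ?a m) \<le> norm (E (adj x * x))"
    using ple_norm[OF loc] by blast
  also have "\<dots> \<le> (norm x)\<^sup>2"
    using E_norm[of "adj x * x"] by (simp add: norm_adj_mult_self)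
  finally show ?thesis by simp
qed

text \<open>The quasi-basis bounds x by the coefficients \<open>E (v i * x)\<close>, whose squares
  are dominated by the form of \<open>S\<close>, thus by \<open>norm x * norm (S x) / rs\<close>.
  Squaring the estimate and cancelling one \<open>norm x\<close> gives the claim.\<close>

lemma S_bounded_below: obtains c where "0 \<le> c" "\<And>x. norm x \<le> c * norm (S x)"
proof -
  define t where "t = (\<Sum>i<n. norm (u i)) / sqrt rs"
  have t0: "0 \<le> t" using rs_pos by (simp add: t_def sum_nonneg)
  have le: "norm x \<le> t * sqrt (norm x * norm (S x))" for x
  proof -
    have ev: "norm (E (v i * x)) \<le> sqrt (norm x * norm (S x)) / sqrt rs" if i: "i < n" for i
    proof -
      let ?f = "\<lambda>i. adj (E (v i * x)) * E (v i * x)"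
      have "?f i \<preceq> (\<Sum>i<n. ?f i)"
        by (rule ple_member_sum[of "{..<n}" i ?f]) (use i Pos_square in auto)
      then have "norm (?f i) \<le> norm (\<Sum>i<n. ?f i)"
        by (rule ple_norm[OF loc Pos_square])
      then have "rs * norm (?f i) \<le> norm (E (adj x * S x))"
        unfolding S_form using rs_pos by simp
      also have "\<dots> \<le> norm x * norm (S x)"
        using E_norm[of "adj x * S x"] norm_mult_ineq[of "adj x" "S x"] by simp
      finally have "(norm (E (v i * x)))\<^sup>2 \<le> norm x * norm (S x) / rs"
        using rs_pos by (simp add: norm_adj_mult_self pos_le_divide_eq mult.commute)
      from real_le_rsqrt[OF this] show ?thesis
        by (simp add: real_sqrt_divide)
    qed
    have "norm x \<le> (\<Sum>i<n. norm (u i * E (v i * x)))"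
      by (subst quasi_left[of x, symmetric]) (rule norm_sum)
    also have "\<dots> \<le> (\<Sum>i<n. norm (u i) * (sqrt (norm x * norm (S x)) / sqrt rs))"
      using ev by (intro sum_mono order_trans[OF norm_mult_ineq] mult_left_mono) auto
    also have "\<dots> = t * sqrt (norm x * norm (S x))"
      by (simp add: t_def sum_distrib_right sum_divide_distrib)
    finally show ?thesis .
  qed
  have "norm x \<le> t\<^sup>2 * norm (S x)" for x
  proof (cases "x = 0")
    case False
    have "(norm x)\<^sup>2 \<le> (t * sqrt (norm x * norm (S x)))\<^sup>2"
      using le by (intro power_mono) auto
    then have "norm x * norm x \<le> norm x * (t\<^sup>2 * norm (S x))"
      by (simp add: power_mult_distrib power2_eq_square mult_ac)
    then show ?thesis using False by simp
  qed simp
  then show ?thesis using that[of "t\<^sup>2"] by simp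
qed

text \<open>\<open>hop m\<close> is \<open>S\<close> after \<open>resid m\<close> and tends to 0
  like m^(-1/2) by \<open>hop_square_bound\<close> and \<open>norm_le_E\<close>; since
  \<open>S\<close> is bounded below, so does \<open>resid m\<close>.\<close>

lemma resid_small:
  assumes "0 < \<epsilon>"
  obtains m where "0 < m" "\<And>x. norm (resid m x) \<le> \<epsilon> * norm x"
proof -
  obtain c where c: "0 \<le> c" "\<And>x. norm x \<le> c * norm (S x)"
    using S_bounded_below by blast
  have idx0: "0 \<le> idx" by (simp add: idx_def sum_nonneg)
  obtain m :: nat where m: "(c * idx / \<epsilon>)\<^sup>2 < real m"
    using reals_Archimedean2 by blast
  then have m0: "0 < real m" using zero_le_power2 by (rule le_less_trans[rotated])
  have "c * idx / \<epsilon> \<le> sqrt (real m)"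
    using m by (intro real_le_rsqrt) simp
  then have cm: "c * idx / sqrt (real m) \<le> \<epsilon>"
    using m0 assms by (simp add: field_simps)
  have "norm (resid m x) \<le> \<epsilon> * norm x" for x
  proof -
    let ?q = "norm (E (adj (hop m x) * hop m x))"
    have "?q \<le> (norm x)\<^sup>2 / real m"
      using hop_square_bound[of m x] m0 by (simp add: pos_le_divide_eq mult.commute)
    then have "sqrt ?q \<le> norm x / sqrt (real m)"
      using real_sqrt_le_mono by (fastforce simp: real_sqrt_divide)
    then have "norm (hop m x) \<le> idx * (norm x / sqrt (real m))"
      using norm_le_E[of "hop m x"] mult_left_mono[OF _ idx0] order_trans by blast
    then have "norm (resid m x) \<le> c * (idx * (norm x / sqrt (real m)))"
      using c(2)[of "resid m x"] mult_left_mono[OF _ c(1)] order_trans unfolding hop_def by blast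
    also have "\<dots> = (c * idx / sqrt (real m)) * norm x" by simp
    also have "\<dots> \<le> \<epsilon> * norm x" using cm by (intro mult_right_mono) auto
    finally show ?thesis .
  qed
  then show ?thesis using that m0 by simp
qed

text \<open>A self-dual frame \<open>x \<approx> \<Sum>\<^sub>l z\<^sub>l E(z\<^sub>l\<^sup>* x)\<close> replaces the square root of the frame
  operator \<open>S\<close> that would make the quasi-basis self-dual.\<close>

lemma approximate_frame:
  assumes "0 < \<epsilon>"
  obtains L :: "(nat \<times> nat) set" and z where "finite L"
    "\<And>x. norm (x - (\<Sum>l\<in>L. z l * E (adj (z l) * x))) \<le> \<epsilon> * norm x"
    "\<And>j. j < n \<Longrightarrow> \<exists>l\<in>L. z l = sqrt rs *\<^sub>R adj (v j)"
proof -
  obtain m where m: "0 < m" "\<And>x. norm (resid m x) \<le> \<epsilon> * norm x"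
    using resid_small[OF assms] by blast
  define L where "L = {..<m} \<times> {..<n}"
  define z where "z l = sqrt rs *\<^sub>R resid (fst l) (adj (v (snd l)))" for l
  have summand: "resid k (S (resid k x)) = (\<Sum>j<n. z (k, j) * E (adj (z (k, j)) * x))" for k x
  proof -
    note y = module_opD[OF module_op_resid[of k]]
    have "resid k (S (resid k x)) = rs *\<^sub>R (\<Sum>j<n. resid k (adj (v j)) * E (v j * resid k x))"
      by (simp add: S_def y(2,3) module_op_sum[OF module_op_resid] E_mem)
    \<comment> \<open>Self-adjointness moves \<open>resid k\<close> to the other argument; this
      makes the frame self-dual.\<close>
    also have "\<dots> = rs *\<^sub>R (\<Sum>j<n. resid k (adj (v j)) * E (adj (resid k (adj (v j))) * x))"
      by (simp add: y(4) adj_adj)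
    also have "\<dots> = (\<Sum>j<n. z (k, j) * E (adj (z (k, j)) * x))"
      using rs_pos by (simp add: z_def adj_scaleR E_scaleR scaleR_sum_right)
    finally show ?thesis .
  qed
  have tel: "x - (\<Sum>k<m. \<Sum>j<n. z (k, j) * E (adj (z (k, j)) * x)) = resid m x" for m x
    by (induction m) (simp_all add: summand algebra_simps)
  have "resid m x = x - (\<Sum>l\<in>L. z l * E (adj (z l) * x))" for x
    unfolding tel[symmetric] L_def by (simp only: sum.cartesian_product) (simp add: case_prod_beta)
  then have "norm (x - (\<Sum>l\<in>L. z l * E (adj (z l) * x))) \<le> \<epsilon> * norm x" for x
    using m(2) by metis
  \<comment> \<open>\<open>resid 0\<close> is the identity, so the vectors with first index 0 are
    the scaled \<open>adj (v j)\<close>; they are what lets the frame sum control \<open>T\<close>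
    on the quasi-basis.\<close>
  moreover have "\<exists>l\<in>L. z l = sqrt rs *\<^sub>R adj (v j)" if "j < n" for j
    using that m(1) by (intro bexI[of _ "(0, j)"]) (auto simp: z_def L_def)
  ultimately show ?thesis using that[of L z] by (simp add: L_def)
qed

end

section \<open>The Rohlin projection\<close>

lemma seq_alg_cases:
  obtains f where "Bseq f" "x = abs_seq_alg f"
proof (rule that[of "rep_seq_alg x"])
  show "Bseq (rep_seq_alg x)"
    using Quotient3_rep_reflp[OF Quotient3_seq_alg, of x] by (simp add: seq_rel_def)
  show "x = abs_seq_alg (rep_seq_alg x)"
    by (simp add: Quotient3_abs_rep[OF Quotient3_seq_alg])
qed

lemma abs_seq_alg_eq_iff:
  assumes "Bseq f" "Bseq g"
  shows "abs_seq_alg f = abs_seq_alg g \<longleftrightarrow> (\<lambda>n. f n - g n) \<longlonglongrightarrow> 0"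
  using Quotient3_rel[OF Quotient3_seq_alg, of f g] assms by (auto simp: seq_rel_def)

lemma seq_rel_refl: "Bseq f \<Longrightarrow> seq_rel f f"
  by (simp add: seq_rel_def)

lemma Bseq_adj: "Bseq f \<Longrightarrow> Bseq (\<lambda>n. adj (f n :: 'a::cstar_algebra))"
  by (simp add: Bseq_def)

lemma Bseq_diff:
  fixes f g :: "nat \<Rightarrow> 'a::real_normed_vector"
  shows "Bseq f \<Longrightarrow> Bseq g \<Longrightarrow> Bseq (\<lambda>n. f n - g n)"
  using Bseq_plus[of f "\<lambda>n. - g n"] by (simp add: Bseq_minus_iff)

lemma Bseq_sum:
  fixes f :: "'i \<Rightarrow> nat \<Rightarrow> 'a::real_normed_vector"
  shows "(\<And>i. i \<in> I \<Longrightarrow> Bseq (f i)) \<Longrightarrow> Bseq (\<lambda>n. \<Sum>i\<in>I. f i n)"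
  by (induction I rule: infinite_finite_induct) (auto intro: Bseq_plus)

lemma abs_seq_plus: "Bseq f \<Longrightarrow> Bseq g \<Longrightarrow> abs_seq_alg f + abs_seq_alg g = abs_seq_alg (\<lambda>n. f n + g n)"
  by (intro plus_seq_alg.abs_eq seq_rel_refl)

lemma abs_seq_times: "Bseq f \<Longrightarrow> Bseq g \<Longrightarrow> abs_seq_alg f * abs_seq_alg g = abs_seq_alg (\<lambda>n. f n * g n)"
  by (intro times_seq_alg.abs_eq seq_rel_refl)

lemma abs_seq_adj: "Bseq f \<Longrightarrow> adj (abs_seq_alg f) = abs_seq_alg (\<lambda>n. adj (f n))"
  by (intro adj_seq_alg.abs_eq seq_rel_refl)

lemma abs_seq_minus:
  assumes "Bseq f" "Bseq g"
  shows "abs_seq_alg f - abs_seq_alg g = abs_seq_alg (\<lambda>n. f n - g n)"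
proof -
  have "- abs_seq_alg g = abs_seq_alg (\<lambda>n. - g n)"
    using assms by (intro uminus_seq_alg.abs_eq seq_rel_refl)
  then show ?thesis
    using assms by (simp add: minus_seq_alg_def abs_seq_plus Bseq_minus_iff)
qed

lemma abs_seq_sum:
  "(\<And>i. i \<in> I \<Longrightarrow> Bseq (f i)) \<Longrightarrow> (\<Sum>i\<in>I. abs_seq_alg (f i)) = abs_seq_alg (\<lambda>n. \<Sum>i\<in>I. f i n)"
  by (induction I rule: infinite_finite_induct)
     (auto simp: zero_seq_alg.abs_eq abs_seq_plus Bseq_sum)

lemma seq_const_abs: "seq_const a = abs_seq_alg (\<lambda>_. a)"
  by (rule seq_const.abs_eq)

lemma seq_const_diff: "seq_const (a - b) = seq_const a - seq_const b"
  and seq_const_mult: "seq_const (a * b) = seq_const a * seq_const b"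
  and seq_const_adj: "adj (seq_const a) = seq_const (adj a)"
  by (simp_all add: seq_const_abs abs_seq_plus abs_seq_minus abs_seq_times abs_seq_adj)

lemma seq_const_1: "seq_const 1 = 1"
  by (simp add: seq_const_abs one_seq_alg.abs_eq)

lemma seq_const_sum: "seq_const (sum f I) = (\<Sum>i\<in>I. seq_const (f i))"
  by (simp add: seq_const_abs abs_seq_sum)

lemma seq_const_inject: "seq_const a = seq_const b \<longleftrightarrow> a = b"
  by (simp add: seq_const_abs abs_seq_alg_eq_iff LIMSEQ_const_iff)

lemma seq_adj_mult: "adj (x * y) = adj y * adj (x :: 'a::cstar_algebra seq_alg)"
proof -
  obtain f g where "Bseq f" "Bseq g" "x = abs_seq_alg f" "y = abs_seq_alg g"
    using seq_alg_cases by metis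
  then show ?thesis by (simp add: abs_seq_times abs_seq_adj Bseq_times Bseq_adj adj_mult)
qed

lemma seq_adj_diff: "adj (x - y) = adj x - adj (y :: 'a::cstar_algebra seq_alg)"
proof -
  obtain f g where "Bseq f" "Bseq g" "x = abs_seq_alg f" "y = abs_seq_alg g"
    using seq_alg_cases by metis
  then show ?thesis by (simp add: abs_seq_minus abs_seq_adj Bseq_diff Bseq_adj adj_diff)
qed

lemma seq_const_central:
  assumes "\<And>a. w * a = a * (w :: 'a::cstar_algebra)"
  shows "seq_const w * x = x * seq_const w"
proof -
  obtain f where "Bseq f" "x = abs_seq_alg f"
    using seq_alg_cases by metis
  then show ?thesis by (simp add: seq_const_abs abs_seq_times assms)
qed

section \<open>The expectation on the sequence algebra and the index\<close>

context finite_index_expectation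
begin

lemma Bseq_E: "Bseq f \<Longrightarrow> Bseq (\<lambda>n. E (f n))"
  unfolding Bseq_def by (meson E_norm order_trans)

abbreviation EE :: "'a seq_alg \<Rightarrow> 'a seq_alg" where "EE \<equiv> seq_map E"

lemmas EE_abs = seq_map_abs[OF E]

lemma EE_plus: "EE (x + y) = EE x + EE y"
proof -
  obtain f g where "Bseq f" "Bseq g" "x = abs_seq_alg f" "y = abs_seq_alg g"
    using seq_alg_cases by metis
  then show ?thesis by (simp add: abs_seq_plus EE_abs Bseq_plus Bseq_E E_plus)
qed

lemma EE_diff: "EE (x - y) = EE x - EE y"
  using EE_plus[of "x - y" y] by simp

lemma EE_sum: "EE (sum f I) = (\<Sum>i\<in>I. EE (f i))"
  by (induction I rule: infinite_finite_induct) (use EE_diff[of 0 0] in \<open>auto simp: EE_plus\<close>)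

lemma EE_left: "EE (EE x * y) = EE x * EE y"
proof -
  obtain f g where "Bseq f" "Bseq g" "x = abs_seq_alg f" "y = abs_seq_alg g"
    using seq_alg_cases by metis
  then show ?thesis by (simp add: abs_seq_times EE_abs Bseq_times Bseq_E E_left E_mem)
qed

lemma EE_right: "EE (x * EE y) = EE x * EE y"
proof -
  obtain f g where "Bseq f" "Bseq g" "x = abs_seq_alg f" "y = abs_seq_alg g"
    using seq_alg_cases by metis
  then show ?thesis by (simp add: abs_seq_times EE_abs Bseq_times Bseq_E E_right E_mem)
qed

lemma EE_adj: "EE (adj x) = adj (EE x)"
proof -
  obtain f where "Bseq f" "x = abs_seq_alg f"
    using seq_alg_cases by metis
  then show ?thesis by (simp add: abs_seq_adj EE_abs Bseq_E Bseq_adj E_adj)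
qed

lemma EE_const: "EE (seq_const a) = seq_const (E a)"
  by (simp add: seq_const_abs EE_abs)

lemma EE_const_left: "p \<in> P \<Longrightarrow> EE (seq_const p * x) = seq_const p * EE x"
  using EE_left[of "seq_const p" x] by (simp add: EE_const E_id)

definition w :: 'a where "w = (\<Sum>i<n. u i * v i)"

text \<open>Expand \<open>v i * a\<close> by the right quasi-basis identity, swap the sums and
  collapse by the left one.\<close>

lemma w_central: "w * a = a * w"
proof -
  have "w * a = (\<Sum>i<n. u i * (v i * a))"
    by (simp only: w_def sum_distrib_right mult.assoc)
  also have "\<dots> = (\<Sum>i<n. u i * (\<Sum>j<n. E (v i * a * u j) * v j))"
    by (simp only: quasi_right)
  also have "\<dots> = (\<Sum>j<n. (\<Sum>i<n. u i * E (v i * (a * u j))) * v j)"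
    unfolding sum_distrib_left sum_distrib_right mult.assoc by (rule sum.swap)
  also have "\<dots> = a * w"
    by (simp only: quasi_left) (simp only: w_def sum_distrib_left mult.assoc)
  finally show ?thesis .
qed

end

locale rohlin_expectation = finite_index_expectation P E n u v
  for P :: "'a::cstar_algebra set" and E n u v +
  fixes em :: "nat \<Rightarrow> 'a" and c :: 'a
  assumes Bseq_em: "Bseq em"
    and central: "abs_seq_alg em \<in> central_seq" and projection: "projection (abs_seq_alg em)"
    and cw: "c * w = 1" and wc: "w * c = 1" and expectation: "EE (abs_seq_alg em) = seq_const c"
begin

definition e :: "'a seq_alg" where e_abs: "e = abs_seq_alg em"

lemma e_central: "e * seq_const a = seq_const a * e"
  and e_idem: "e * e = e" and e_adj: "adj e = e" and EE_e: "EE e = seq_const c"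
  using central projection expectation by (simp_all add: e_abs central_seq_def projection_def)

lemma c_mem: "c \<in> P"
proof -
  have "abs_seq_alg (\<lambda>m. E (em m)) = abs_seq_alg (\<lambda>_. c)"
    using EE_e Bseq_em by (simp add: e_abs EE_abs seq_const_abs)
  then have "(\<lambda>m. E (em m) - c) \<longlonglongrightarrow> 0"
    using Bseq_em by (simp add: abs_seq_alg_eq_iff Bseq_E)
  then have lim: "(\<lambda>m. E (em m)) \<longlonglongrightarrow> c"
    by (simp add: LIM_zero_iff)
  show ?thesis
    by (rule closed_sequentially[OF PD(2) E_mem lim])
qed

text \<open>As \<open>c\<close> lies in \<open>P\<close>, applying \<open>E\<close> to w c = 1 shows
  that \<open>E w\<close> is also a left inverse of \<open>c\<close>; hence it equals
  \<open>w\<close>.\<close>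

lemma w_mem: "w \<in> P"
proof -
  have "E w * c = 1"
    using E_right[OF c_mem, of w] wc E_id[OF PD(5)] by simp
  then have "E w = w"
    using cw by (metis mult.assoc mult_1_left mult_1_right)
  then show ?thesis using E_mem[of w] by simp
qed

lemma w_adj: "adj w = w"
proof -
  have "seq_const (adj c) = seq_const c"
    using EE_adj[of e] by (simp add: e_adj EE_e seq_const_adj)
  then have "adj c = c" by (simp add: seq_const_inject)
  then have "adj w * c = 1"
    using arg_cong[OF cw, of adj] by (simp add: adj_mult)
  then show ?thesis
    using cw by (metis mult.assoc mult_1_left mult_1_right)
qed

abbreviation W :: "'a seq_alg" where "W \<equiv> seq_const w"

lemma W_central: "W * x = x * W"
  by (rule seq_const_central) (rule w_central)

lemma W_left_comm: "x * (W * y) = W * (x * y)"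
  by (metis W_central mult.assoc)

lemma W_left: "EE (W * x) = W * EE x"
  by (rule EE_const_left[OF w_mem])

lemma W_e: "W * EE e = 1" "EE e * W = 1"
  by (simp_all add: EE_e seq_const_mult[symmetric] wc cw seq_const_1)

text \<open>The subtracted term is the projection onto the submodule generated by \<open>e\<close>,
  because \<open>EE e\<close> is inverse to \<open>W\<close>. The aim is that \<open>T\<close>
  vanishes on constants.\<close>

definition T :: "'a seq_alg \<Rightarrow> 'a seq_alg" where "T x = e * x - W * (e * EE (e * x))"

text \<open>\<open>T\<close> is a self-adjoint idempotent for the inner product \<open>E\<^sup>\<infinity>(x\<^sup>* y)\<close>; the proof that it
  vanishes computes \<open>\<Sum>\<^sub>l E\<^sup>\<infinity>(T(z\<^sub>l\<^sup>*)\<^sup>* T(z\<^sub>l\<^sup>*))\<close> over a self-dual frame.\<close>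

lemma T_form:
  "EE (adj (T (seq_const (adj z))) * T (seq_const (adj z))) =
    EE (seq_const z * seq_const (adj z) * e) - W * EE (e * (seq_const z * EE (seq_const (adj z) * e)))"
proof -
  let ?z = "seq_const z" and ?y = "seq_const (adj z)"
  have ze: "e * ?z = ?z * e" "e * ?y = ?y * e" using e_central by auto
  let ?A = "EE (?z * e)" and ?B = "EE (?y * e)"
  have adjB: "adj ?B = ?A"
    by (simp add: EE_adj[symmetric] seq_adj_mult e_adj seq_const_adj adj_adj ze)
  have adjT: "adj (T ?y) = ?z * e - ?A * e * W"
    by (simp add: T_def ze seq_adj_diff seq_adj_mult e_adj seq_const_adj adj_adj adjB w_adj mult.assoc)
  have TT: "T ?y = ?y * e - W * (e * ?B)"
    by (simp add: T_def ze)
  have ee: "e * (e * x) = e * x" for x by (simp add: mult.assoc[symmetric] e_idem)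
  note Wl = W_left_comm[of ?z] W_left_comm[of e] W_left_comm[of ?A]
  have "adj (T ?y) * T ?y = ?z * (e * (?y * e)) - W * ((?z * e) * ?B) - W * (?A * (e * (?y * e)))
      + W * (W * (?A * (e * ?B)))"
  proof -
    have "adj (T ?y) * T ?y = ?z * (e * (?y * e)) - ?z * (e * (W * (e * ?B)))
        - ?A * (e * (W * (?y * e))) + ?A * (e * (W * (W * (e * ?B))))"
      by (simp only: adjT, simp only: TT, simp add: algebra_simps)
    moreover have "?z * (e * (W * (e * ?B))) = W * ((?z * e) * ?B)"
      by (simp add: Wl ee mult.assoc)
    moreover have "?A * (e * (W * (?y * e))) = W * (?A * (e * (?y * e)))"
      by (simp add: Wl)
    moreover have "?A * (e * (W * (W * (e * ?B)))) = W * (W * (?A * (e * ?B)))"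
      by (simp add: Wl ee)
    ultimately show ?thesis by simp
  qed
  also have "e * (?y * e) = ?y * e"
    by (simp add: ze(2)[symmetric] ee)
  finally have eq: "adj (T ?y) * T ?y = ?z * (?y * e) - W * ((?z * e) * ?B) - W * (?A * (?y * e))
      + W * (W * (?A * (e * ?B)))" .
  \<comment> \<open>Since \<open>EE e\<close> is inverse to \<open>W\<close>, one factor
    \<open>W\<close> cancels and the last term offsets one of the two middle terms, which agree
    after \<open>EE\<close>.\<close>
  have "W * EE (?A * (e * ?B)) = W * (?A * (EE e * ?B))"
    by (simp add: EE_left EE_right)
  also have "\<dots> = ?A * (W * EE e * ?B)"
    by (simp only: mult.assoc W_left_comm[of ?A])
  finally have "W * (W * EE (?A * (e * ?B))) = W * (?A * ?B)"
    by (simp add: W_e)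
  then have "EE (adj (T ?y) * T ?y) = EE (?z * (?y * e)) - W * (?A * ?B)"
    by (simp add: eq EE_plus EE_diff W_left EE_left EE_right)
  moreover have "EE (e * (?z * ?B)) = ?A * ?B"
    by (simp add: mult.assoc[symmetric] EE_right ze)
  ultimately show ?thesis by (simp add: mult.assoc)
qed

text \<open>The right-hand side consists of frame errors: for an exact self-dual frame the terms
  \<open>seq_const (z l) * EE (seq_const (adj (z l)) * e)\<close> add up to \<open>e\<close> and the
  \<open>z l * adj (z l)\<close> to \<open>w\<close>, and it would be 0.\<close>

lemma T_frame_sum:
  assumes "finite L"
  shows "(\<Sum>l\<in>L. EE (adj (T (seq_const (adj (z l)))) * T (seq_const (adj (z l))))) =
    W * EE (e * (e - (\<Sum>l\<in>L. seq_const (z l) * EE (seq_const (adj (z l)) * e))))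
    - EE (seq_const (w - (\<Sum>l\<in>L. z l * adj (z l))) * e)"
proof -
  let ?s = "\<Sum>l\<in>L. seq_const (z l) * EE (seq_const (adj (z l)) * e)"
  have "(\<Sum>l\<in>L. EE (adj (T (seq_const (adj (z l)))) * T (seq_const (adj (z l))))) =
      EE (seq_const (\<Sum>l\<in>L. z l * adj (z l)) * e) - W * EE (e * ?s)"
    by (simp add: T_form sum_subtractf seq_const_sum seq_const_mult EE_sum sum_distrib_left
        sum_distrib_right)
  moreover have "W * EE (e * (e - ?s)) = W * EE e - W * EE (e * ?s)"
    by (simp add: right_diff_distrib e_idem EE_diff)
  moreover have "EE (seq_const (w - (\<Sum>l\<in>L. z l * adj (z l))) * e) =
      W * EE e - EE (seq_const (\<Sum>l\<in>L. z l * adj (z l)) * e)"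
    by (simp add: seq_const_diff left_diff_distrib EE_diff W_left)
  ultimately show ?thesis by simp
qed

definition Tm :: "nat \<Rightarrow> 'a \<Rightarrow> 'a" where "Tm m a = em m * a - w * (em m * E (em m * a))"

lemma Bseq_Tm: "Bseq (\<lambda>m. Tm m a)"
  unfolding Tm_def by (intro Bseq_diff Bseq_times Bseq_E Bseq_em) simp_all

lemma T_abs: "T (seq_const a) = abs_seq_alg (\<lambda>m. Tm m a)"
  unfolding T_def Tm_def e_abs seq_const_abs
  by (simp add: abs_seq_times abs_seq_minus EE_abs Bseq_em Bseq_times Bseq_E)

text \<open>Expanding \<open>adj (z l)\<close> in the quasi-basis turns the difference into the
  frame errors of the \<open>u i\<close>, multiplied by \<open>v i\<close>.\<close>

lemma w_minus_frame:
  assumes "finite L" "\<And>x. norm (x - (\<Sum>l\<in>L. z l * E (adj (z l) * x))) \<le> \<epsilon> * norm x"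
  shows "norm (w - (\<Sum>l\<in>L. z l * adj (z l))) \<le> \<epsilon> * idx"
proof -
  have "(\<Sum>l\<in>L. z l * adj (z l)) = (\<Sum>l\<in>L. z l * (\<Sum>i<n. E (adj (z l) * u i) * v i))"
    by (simp add: quasi_right)
  also have "\<dots> = (\<Sum>i<n. (\<Sum>l\<in>L. z l * E (adj (z l) * u i)) * v i)"
    unfolding sum_distrib_left sum_distrib_right mult.assoc by (rule sum.swap)
  finally have "w - (\<Sum>l\<in>L. z l * adj (z l)) =
      (\<Sum>i<n. (u i - (\<Sum>l\<in>L. z l * E (adj (z l) * u i))) * v i)"
    by (simp add: w_def left_diff_distrib sum_subtractf)
  also have "norm \<dots> \<le> (\<Sum>i<n. \<epsilon> * norm (u i) * norm (v i))"
    using assms(2) by (intro sum_norm_le order_trans[OF norm_mult_ineq] mult_right_mono) auto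
  finally show ?thesis by (simp add: idx_def sum_distrib_left mult.assoc)
qed

lemma em_bound: obtains K where "0 < K" "\<And>m. norm (em m) \<le> K"
  using Bseq_em unfolding Bseq_def by blast

text \<open>The summand of \<open>v j\<close> is positive, so its norm is at most that of the whole
  frame sum, which equals \<open>g\<close> up to a null sequence. The bound of \<open>g\<close>
  involves only \<open>w\<close>, \<open>idx\<close> and a bound of \<open>em\<close>, so the number
  of frame vectors may grow as \<epsilon> shrinks.\<close>

lemma Tm_form_tendsto:
  assumes j: "j < n"
  shows "(\<lambda>m. E (adj (Tm m (v j)) * Tm m (v j))) \<longlonglongrightarrow> 0"
proof (rule LIMSEQ_I)
  fix r :: real assume r: "0 < r"
  obtain K where K: "0 < K" "\<And>m. norm (em m) \<le> K" using em_bound by blast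
  have idx0: "0 \<le> idx" by (simp add: idx_def sum_nonneg)
  define C where "C = norm w * (K * K) + idx * K"
  have C0: "0 \<le> C" using K idx0 by (simp add: C_def)
  \<comment> \<open>Makes (C + 1) \<epsilon> = rs r: C \<epsilon> bounds \<open>g\<close>, another
    \<epsilon> the null sequence, and \<open>rs\<close> comes from the scaled frame vector.\<close>
  define \<epsilon> where "\<epsilon> = rs * r / (C + 1)"
  have \<epsilon>: "0 < \<epsilon>" using r rs_pos C0 by (simp add: \<epsilon>_def add_nonneg_pos)
  have "\<exists>(L :: (nat \<times> nat) set) z. finite L \<and>
      (\<forall>x. norm (x - (\<Sum>l\<in>L. z l * E (adj (z l) * x))) \<le> \<epsilon> * norm x) \<and>
      (\<forall>j<n. \<exists>l\<in>L. z l = sqrt rs *\<^sub>R adj (v j))"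
    by (rule approximate_frame[OF \<epsilon>]) (intro exI conjI allI impI; assumption?; blast)
  then obtain L :: "(nat \<times> nat) set" and z where L: "finite L"
    and fr: "\<And>x. norm (x - (\<Sum>l\<in>L. z l * E (adj (z l) * x))) \<le> \<epsilon> * norm x"
    and zj: "\<forall>j<n. \<exists>l\<in>L. z l = sqrt rs *\<^sub>R adj (v j)"
    by blast
  define p where "p l m = E (adj (Tm m (adj (z l))) * Tm m (adj (z l)))" for l m
  define q where "q m = em m - (\<Sum>l\<in>L. z l * E (adj (z l) * em m))" for m
  define t where "t = w - (\<Sum>l\<in>L. z l * adj (z l))"
  define g where "g m = w * E (em m * q m) - E (t * em m)" for m
  have Bp: "Bseq (p l)" for l
    unfolding p_def by (intro Bseq_E Bseq_times Bseq_adj Bseq_Tm)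
  have Bq: "Bseq q"
    unfolding q_def by (intro Bseq_diff Bseq_sum Bseq_times Bseq_E Bseq_em) simp_all
  have Bg: "Bseq g"
    unfolding g_def by (intro Bseq_diff Bseq_times Bseq_E Bseq_em Bq) simp_all
  have "(\<Sum>l\<in>L. EE (adj (T (seq_const (adj (z l)))) * T (seq_const (adj (z l))))) =
      abs_seq_alg (\<lambda>m. \<Sum>l\<in>L. p l m)"
    by (simp add: T_abs abs_seq_adj abs_seq_times EE_abs Bseq_Tm Bseq_adj Bseq_times p_def[symmetric]
        abs_seq_sum Bp)
  moreover have "e - (\<Sum>l\<in>L. seq_const (z l) * EE (seq_const (adj (z l)) * e)) = abs_seq_alg q"
    by (simp add: e_abs seq_const_abs abs_seq_times EE_abs Bseq_em Bseq_times Bseq_E abs_seq_sum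
        abs_seq_minus Bseq_sum q_def[symmetric])
  moreover have "W * EE (e * abs_seq_alg q) - EE (seq_const t * e) = abs_seq_alg g"
    by (simp add: e_abs seq_const_abs abs_seq_times EE_abs Bseq_em Bseq_times Bseq_E Bq
        abs_seq_minus g_def[symmetric])
  ultimately have "abs_seq_alg (\<lambda>m. \<Sum>l\<in>L. p l m) = abs_seq_alg g"
    using T_frame_sum[OF L, of z] by (simp add: t_def)
  moreover have "Bseq (\<lambda>m. \<Sum>l\<in>L. p l m)" by (intro Bseq_sum Bp)
  ultimately have lim: "(\<lambda>m. (\<Sum>l\<in>L. p l m) - g m) \<longlonglongrightarrow> 0"
    by (simp only: abs_seq_alg_eq_iff[OF _ Bg])
  have g_le: "norm (g m) \<le> C * \<epsilon>" for m
  proof -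
    have "norm (E (em m * q m)) \<le> K * (\<epsilon> * K)"
      using K fr[of "em m"] \<epsilon> unfolding q_def[symmetric]
      by (intro order_trans[OF E_norm] order_trans[OF norm_mult_ineq] mult_mono)
         (auto intro: order_trans[OF fr[of "em m", folded q_def]])
    moreover have "norm (E (t * em m)) \<le> (\<epsilon> * idx) * K"
      using K w_minus_frame[OF L fr, folded t_def] \<epsilon> idx0
      by (intro order_trans[OF E_norm] order_trans[OF norm_mult_ineq] mult_mono) auto
    ultimately have "norm (g m) \<le> norm w * (K * (\<epsilon> * K)) + (\<epsilon> * idx) * K"
      unfolding g_def
      by (intro order_trans[OF norm_triangle_ineq4] add_mono order_trans[OF norm_mult_ineq] mult_left_mono) auto
    also have "\<dots> = C * \<epsilon>" by (simp add: C_def algebra_simps)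
    finally show ?thesis .
  qed
  obtain N where N: "\<And>m. m \<ge> N \<Longrightarrow> norm ((\<Sum>l\<in>L. p l m) - g m) < \<epsilon>"
    using LIMSEQ_D[OF lim \<epsilon>] by auto
  obtain l where l: "l \<in> L" "z l = sqrt rs *\<^sub>R adj (v j)" using zj j by blast
  have pl: "p l m = rs *\<^sub>R E (adj (Tm m (v j)) * Tm m (v j))" for m
  proof -
    have "Tm m (adj (z l)) = sqrt rs *\<^sub>R Tm m (v j)"
      by (simp add: l(2) Tm_def adj_scaleR adj_adj E_scaleR scaleR_diff_right)
    then show ?thesis using rs_pos by (simp add: p_def adj_scaleR E_scaleR)
  qed
  have "norm (E (adj (Tm m (v j)) * Tm m (v j)) - 0) < r" if "m \<ge> N" for m
  proof -
    have "norm (p l m) \<le> norm (\<Sum>l\<in>L. p l m)"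
    proof (rule ple_norm[OF loc])
      show "p l m \<in> Pos" unfolding p_def by (intro E_Pos Pos_square)
      show "p l m \<preceq> (\<Sum>l\<in>L. p l m)"
        by (rule ple_member_sum[OF L l(1), of "\<lambda>l. p l m"]) (simp add: p_def E_Pos Pos_square)
    qed
    also have "\<dots> \<le> norm (g m) + norm ((\<Sum>l\<in>L. p l m) - g m)"
      using norm_triangle_ineq[of "g m" "(\<Sum>l\<in>L. p l m) - g m"] by simp
    also have "\<dots> < C * \<epsilon> + \<epsilon>" using g_le[of m] N[OF that] by simp
    also have "\<dots> = (C + 1) * \<epsilon>" by (simp add: distrib_right)
    also have "\<dots> = rs * r" using C0 by (simp add: \<epsilon>_def)
    finally show ?thesis using rs_pos by (simp add: pl)
  qed
  then show "\<exists>no. \<forall>m\<ge>no. norm (E (adj (Tm m (v j)) * Tm m (v j)) - 0) < r" by blast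
qed

lemma T_quasi_basis:
  assumes "j < n"
  shows "T (seq_const (v j)) = 0"
proof -
  have "(\<lambda>m. idx * sqrt (norm (E (adj (Tm m (v j)) * Tm m (v j))))) \<longlonglongrightarrow> idx * sqrt (norm (0 :: 'a))"
    by (intro tendsto_intros Tm_form_tendsto assms)
  then have lim: "(\<lambda>m. idx * sqrt (norm (E (adj (Tm m (v j)) * Tm m (v j))))) \<longlonglongrightarrow> 0"
    by simp
  have "(\<lambda>m. Tm m (v j)) \<longlonglongrightarrow> 0"
    by (rule Lim_null_comparison[OF _ lim]) (intro always_eventually allI norm_le_E)
  then show ?thesis
    using abs_seq_alg_eq_iff[OF Bseq_Tm[of "v j"], of "\<lambda>_. 0"] by (simp add: T_abs zero_seq_alg.abs_eq)
qed

text \<open>As \<open>e\<close> commutes with constants, \<open>T\<close> commutes with left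
  multiplication by \<open>P\<close>; the vanishing spreads from the \<open>v j\<close> to a, the
  sum of the \<open>E (a * u j) * v j\<close>.\<close>

lemma T_const: "T (seq_const a) = 0"
proof -
  have "T (seq_const (p * v j)) = 0" if "p \<in> P" "j < n" for p j
  proof -
    have "e * seq_const (p * v j) = seq_const p * (e * seq_const (v j))"
      by (simp add: seq_const_mult e_central[symmetric] mult.assoc[symmetric])
    then have "T (seq_const (p * v j)) = seq_const p * T (seq_const (v j))"
      using that(1) by (simp add: T_def EE_const_left right_diff_distrib)
        (metis W_central e_central mult.assoc)
    then show ?thesis using T_quasi_basis[OF that(2)] by simp
  qed
  then have "(\<Sum>j<n. T (seq_const (E (a * u j) * v j))) = 0"
    using E_mem by (intro sum.neutral) auto
  moreover have "T (\<Sum>j<n. seq_const (E (a * u j) * v j)) = (\<Sum>j<n. T (seq_const (E (a * u j) * v j)))"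
    by (simp add: T_def sum_distrib_left sum_subtractf EE_sum)
  ultimately show ?thesis
    by (simp add: seq_const_sum[symmetric] quasi_right)
qed

text \<open>Move \<open>e\<close> between a and b and replace \<open>e * seq_const b\<close> by
  \<open>W * (e * EE (e * seq_const b))\<close>; the factor in the range of \<open>EE\<close> can
  then be pulled out of \<open>EE\<close>.\<close>

lemma rohlin_multiplicative:
  "W * EE (seq_const (a * b) * e) = (W * EE (seq_const a * e)) * (W * EE (seq_const b * e))"
proof -
  have "seq_const (a * b) * e = seq_const a * (e * seq_const b)"
    by (simp add: seq_const_mult e_central mult.assoc)
  also have "e * seq_const b = W * (e * EE (e * seq_const b))"
    using T_const[of b] by (simp add: T_def)
  also have "seq_const a * (W * (e * EE (e * seq_const b))) = W * ((seq_const a * e) * EE (seq_const b * e))"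
    by (simp add: W_left_comm[of "seq_const a"] mult.assoc e_central)
  finally have "EE (seq_const (a * b) * e) = W * (EE (seq_const a * e) * EE (seq_const b * e))"
    by (simp add: W_left EE_right)
  then show ?thesis by (metis W_central mult.assoc)
qed

text \<open>Stage m of a lift of the homomorphism a \<mapsto>
  \<open>W * EE (seq_const a * e)\<close>. Each stage is linear with values in \<open>P\<close>; the
  algebraic identities hold only as m grows.\<close>

definition \<phi> :: "nat \<Rightarrow> 'a \<Rightarrow> 'a" where "\<phi> m x = w * E (x * em m)"

lemma Bseq_\<phi>: "Bseq (\<lambda>m. \<phi> m x)"
  unfolding \<phi>_def by (intro Bseq_times Bseq_E Bseq_em) simp_all

lemma \<phi>_abs: "abs_seq_alg (\<lambda>m. \<phi> m x) = W * EE (seq_const x * e)"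
  unfolding \<phi>_def e_abs seq_const_abs by (simp add: abs_seq_times EE_abs Bseq_em Bseq_times Bseq_E)

lemma \<phi>_mult: "(\<lambda>m. mdef (\<phi> m) x y) \<longlonglongrightarrow> 0"
proof -
  have "abs_seq_alg (\<lambda>m. \<phi> m (x * y)) = abs_seq_alg (\<lambda>m. \<phi> m x * \<phi> m y)"
    by (simp add: abs_seq_times[symmetric] Bseq_\<phi> \<phi>_abs rohlin_multiplicative)
  then show ?thesis
    unfolding mdef_def by (simp add: abs_seq_alg_eq_iff Bseq_\<phi> Bseq_times)
qed

lemma \<phi>_adj: "(\<lambda>m. \<phi> m (adj x) - adj (\<phi> m x)) \<longlonglongrightarrow> 0"
proof -
  have "adj (W * EE (seq_const x * e)) = W * EE (seq_const (adj x) * e)"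
    by (simp add: seq_adj_mult EE_adj[symmetric] seq_const_adj e_adj w_adj e_central W_central)
  then have "abs_seq_alg (\<lambda>m. \<phi> m (adj x)) = abs_seq_alg (\<lambda>m. adj (\<phi> m x))"
    by (simp add: abs_seq_adj[symmetric] Bseq_\<phi> \<phi>_abs)
  then show ?thesis by (simp add: abs_seq_alg_eq_iff Bseq_\<phi> Bseq_adj)
qed

lemma \<phi>_fix:
  assumes "p \<in> P"
  shows "(\<lambda>m. \<phi> m p - p) \<longlonglongrightarrow> 0"
proof -
  have "abs_seq_alg (\<lambda>m. \<phi> m p) = abs_seq_alg (\<lambda>_. p)"
    using assms W_e by (simp add: \<phi>_abs EE_const_left seq_const_abs[symmetric])
      (metis W_central mult.assoc mult_1_right)
  then show ?thesis by (simp add: abs_seq_alg_eq_iff Bseq_\<phi>)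
qed

lemma \<phi>_mem: "\<phi> m x \<in> P"
  unfolding \<phi>_def by (intro PD(3) w_mem E_mem)

lemma \<phi>_lin_on: "lin_on B (\<phi> m)"
  by (simp add: lin_on_def \<phi>_def distrib_right distrib_left E_plus mult_scaleC_left mult_scaleC_right E_scaleC)

lemma \<phi>_diff: "\<phi> m (x - y) = \<phi> m x - \<phi> m y"
  by (simp add: \<phi>_def left_diff_distrib right_diff_distrib E_diff)

lemma \<phi>_bound: obtains M where "0 \<le> M" "\<And>m x. norm (\<phi> m x) \<le> M * norm x"
proof -
  obtain K where K: "0 < K" "\<And>m. norm (em m) \<le> K" using em_bound by blast
  have "norm (\<phi> m x) \<le> (norm w * K) * norm x" for m x
  proof -
    have "norm (\<phi> m x) \<le> norm w * (norm x * K)"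
      unfolding \<phi>_def using K
      by (intro order_trans[OF norm_mult_ineq] mult_left_mono order_trans[OF E_norm]) auto
    then show ?thesis by (simp add: mult_ac)
  qed
  then show ?thesis using that[of "norm w * K"] K by simp
qed

end

section \<open>Approximation by finite-dimensional algebras\<close>

text \<open>The constant does not depend on \<open>g\<close>, so convergence of maps at the finitely
  many basis elements is uniform on the unit ball of \<open>B\<close>.\<close>

lemma lin_on_bound:
  assumes B: "fdalg B"
  obtains C where "0 \<le> C"
    "\<And>g x. lin_on B g \<Longrightarrow> x \<in> B \<Longrightarrow> norm (g x) \<le> C * (\<Sum>s\<in>fb B. norm (g s)) * norm x"
proof -
  obtain C where C: "0 \<le> C" "\<And>s x. s \<in> fb B \<Longrightarrow> x \<in> B \<Longrightarrow> cmod (ftr B (fdual B s * x)) \<le> C * norm x"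
    using coordinate_bound[OF B] by blast
  have "norm (g x) \<le> C * (\<Sum>s\<in>fb B. norm (g s)) * norm x" if g: "lin_on B g" and x: "x \<in> B" for g x
  proof -
    have "g x = (\<Sum>s\<in>fb B. ftr B (fdual B s * x) *\<^sub>C g s)"
      using lin_on_sum[OF fdalgD(1)[OF B] g, of "fb B" "\<lambda>s. s" "\<lambda>s. ftr B (fdual B s * x)"]
      by (simp add: fdual_expand_left[OF B x] fb_mem[OF B])
    also have "norm \<dots> \<le> (\<Sum>s\<in>fb B. (C * norm x) * norm (g s))"
      using C(2) x by (intro sum_norm_le) (simp add: norm_scaleC mult_right_mono)
    finally show ?thesis by (simp add: sum_distrib_left mult_ac)
  qed
  then show ?thesis using that C(1) by blast
qed

text \<open>The multiplicative defect is bilinear, so two uses of \<open>lin_on_bound\<close>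
  control it by its values at pairs of basis elements: finitely many limits.\<close>

lemma eventually_near_shom:
  assumes B: "fdalg B" and lin: "\<And>m. lin_on B (f m)" and mem: "\<And>m x. x \<in> B \<Longrightarrow> f m x \<in> D"
    and bound: "\<And>m x. x \<in> B \<Longrightarrow> norm (f m x) \<le> M * norm x"
    and mult: "\<And>x y. x \<in> B \<Longrightarrow> y \<in> B \<Longrightarrow> (\<lambda>m. mdef (f m) x y) \<longlonglongrightarrow> 0"
    and adj: "\<And>x. x \<in> B \<Longrightarrow> (\<lambda>m. f m (adj x) - adj (f m x)) \<longlonglongrightarrow> 0"
    and one: "(\<lambda>m. f m 1 - 1) \<longlonglongrightarrow> 0" and \<delta>: "0 < \<delta>"
  shows "\<forall>\<^sub>F m in sequentially. near_shom B D M \<delta> (f m)"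
proof -
  note BD = fdalgD[OF B] and sB = fb_mem[OF B]
  obtain C where C: "0 \<le> C"
    "\<And>g x. lin_on B g \<Longrightarrow> x \<in> B \<Longrightarrow> norm (g x) \<le> C * (\<Sum>s\<in>fb B. norm (g s)) * norm x"
    using lin_on_bound[OF B] by blast
  define a where "a m = C * (\<Sum>t\<in>fb B. C * (\<Sum>s\<in>fb B. norm (mdef (f m) s t)))" for m
  define b where "b m = C * (\<Sum>s\<in>fb B. norm (f m (adj s) - adj (f m s)))" for m
  have "a \<longlonglongrightarrow> C * (\<Sum>t\<in>fb B. C * (\<Sum>s\<in>fb B. norm (0 :: 'a)))"
    unfolding a_def by (intro tendsto_intros mult sB)
  then have a: "a \<longlonglongrightarrow> 0" by simp
  have "b \<longlonglongrightarrow> C * (\<Sum>s\<in>fb B. norm (0 :: 'a))"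
    unfolding b_def by (intro tendsto_intros adj sB)
  then have b: "b \<longlonglongrightarrow> 0" by simp
  have a_le: "norm (mdef (f m) x y) \<le> a m * norm x * norm y" if x: "x \<in> B" and y: "y \<in> B" for m x y
  proof -
    have "norm (mdef (f m) x y) \<le> C * (\<Sum>t\<in>fb B. norm (mdef (f m) x t)) * norm y"
      by (rule C(2)[OF lin_on_mdef_right[OF B lin x] y])
    also have "\<dots> \<le> C * (\<Sum>t\<in>fb B. C * (\<Sum>s\<in>fb B. norm (mdef (f m) s t)) * norm x) * norm y"
      using C(1) by (intro mult_right_mono mult_left_mono sum_mono
          C(2)[OF lin_on_mdef_left[OF B lin sB] x]) auto
    finally show ?thesis by (simp add: a_def sum_distrib_right mult.assoc)
  qed
  have b_le: "norm (f m (adj x) - adj (f m x)) \<le> b m * norm x" if x: "x \<in> B" for m x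
  proof -
    have n: "norm (f m x - adj (f m (adj x))) = norm (f m (adj x) - adj (f m x))" for x
      by (metis adj_adj adj_diff norm_adj norm_minus_commute)
    \<comment> \<open>The defect of the involution is conjugate linear; this map, its adjoint up to
      sign, is linear and has the same norm.\<close>
    have "lin_on B (\<lambda>x. f m x - adj (f m (adj x)))"
      using lin[of m] BD(3)
      by (auto simp: lin_on_def adj_add adj_scaleC cvec.scale_right_diff_distrib)
    from C(2)[OF this x] show ?thesis by (simp add: n b_def)
  qed
  have "\<forall>\<^sub>F m in sequentially. a m < \<delta>" "\<forall>\<^sub>F m in sequentially. b m < \<delta>"
      "\<forall>\<^sub>F m in sequentially. norm (f m 1 - 1) < \<delta>"
    using order_tendstoD(2)[OF a \<delta>] order_tendstoD(2)[OF b \<delta>]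
      order_tendstoD(2)[OF tendsto_norm_zero[OF one] \<delta>] by auto
  then show ?thesis
  proof eventually_elim
    case (elim m)
    show ?case
      unfolding near_shom_def
    proof (intro conjI ballI)
      show "norm (mdef (f m) x y) \<le> \<delta> * norm x * norm y" if "x \<in> B" "y \<in> B" for x y
        using elim by (intro order_trans[OF a_le[OF that]] mult_right_mono) auto
      show "norm (f m (adj x) - adj (f m x)) \<le> \<delta> * norm x" if "x \<in> B" for x
        using elim by (intro order_trans[OF b_le[OF that]] mult_right_mono) auto
    qed (use lin mem bound elim in auto)
  qed
qed

lemma shom_image_fdalg:
  assumes B: "fdalg B" and g: "shom B D g"
  shows "fdalg (g ` B)" "g ` B \<subseteq> D"
proof -
  note BD = fdalgD[OF B] and G = shomD[OF g]
  have sub: "cvec.subspace (g ` B)"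
  proof (rule cvec.subspaceI)
    show "0 \<in> g ` B"
      using lin_onD(2)[OF G(1) BD(6), of 0] BD(6) by (metis cvec.scale_zero_left imageI)
    show "x + y \<in> g ` B" if "x \<in> g ` B" "y \<in> g ` B" for x y
      using that BD(7) by (auto simp: lin_onD(1)[OF G(1), symmetric])
    show "c *\<^sub>C x \<in> g ` B" if "x \<in> g ` B" for c x
      using that BD(9) by (auto simp: lin_onD(2)[OF G(1), symmetric])
  qed
  have "g ` B = cvec.span (g ` fb B)"
  proof
    show "cvec.span (g ` fb B) \<subseteq> g ` B"
      using fb_mem[OF B] by (intro cvec.span_minimal sub) auto
    show "g ` B \<subseteq> cvec.span (g ` fb B)"
    proof
      fix y assume "y \<in> g ` B"
      then obtain x where x: "x \<in> B" "y = g x" by blast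
      have "g x = (\<Sum>s\<in>fb B. ftr B (fdual B s * x) *\<^sub>C g s)"
        using lin_on_sum[OF BD(1) G(1), of "fb B" "\<lambda>s. s" "\<lambda>s. ftr B (fdual B s * x)"]
        by (simp add: fdual_expand_left[OF B x(1)] fb_mem[OF B])
      then show "y \<in> cvec.span (g ` fb B)"
        unfolding x(2) by (simp only:) (intro cvec.span_sum cvec.span_scale cvec.span_base imageI)
    qed
  qed
  then have "finite_dim (g ` B)"
    using fb(1)[OF B] unfolding finite_dim_def by blast
  moreover have "x * y \<in> g ` B" if "x \<in> g ` B" "y \<in> g ` B" for x y
    using that BD(2) by (auto simp: G(5)[symmetric])
  moreover have "adj x \<in> g ` B" if "x \<in> g ` B" for x
    using that BD(3) by (auto simp: G(4)[symmetric])
  moreover have "1 \<in> g ` B" using G(3) BD(4) by (metis imageI)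
  ultimately show "fdalg (g ` B)" using sub by (simp add: fdalg_def)
  show "g ` B \<subseteq> D" using G(2) by blast
qed

text \<open>The order of choices matters: \<open>M\<close> bounds all stages, then B is chosen, then
  the tolerance for B, and only then the stage m.\<close>

lemma (in rohlin_expectation) P_locally_fd: "locally_fd P"
  unfolding locally_fd_def
proof (intro allI impI, elim conjE)
  fix X and \<epsilon> :: real
  assume X: "finite X" "X \<subseteq> P" and \<epsilon>: "0 < \<epsilon>"
  obtain M where M: "0 \<le> M" "\<And>m x. norm (\<phi> m x) \<le> M * norm x" using \<phi>_bound by blast
  \<comment> \<open>The constants split x - g b into three errors of at most \<epsilon>/4: d makes
    \<phi> m (x - b) small and keeps norm b below R + 1, and \<eta> (R + 1) = \<epsilon>/4 bounds
    the correction at b. The third is the distance of \<phi> m x from x.\<close>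
  define d where "d = min 1 (\<epsilon> / (4 * (M + 1)))"
  define R where "R = (\<Sum>x\<in>X. norm x)"
  define \<eta> where "\<eta> = \<epsilon> / 4 / (R + 1)"
  have R0: "0 \<le> R" by (simp add: R_def sum_nonneg)
  have d: "0 < d" and \<eta>: "0 < \<eta>" using \<epsilon> M R0 by (simp_all add: d_def \<eta>_def)
  obtain B where B: "fdalg B" "\<And>x. x \<in> X \<Longrightarrow> \<exists>b\<in>B. norm (x - b) < d"
    using loc X(1) d unfolding locally_fd_def by (metis subset_UNIV)
  obtain \<delta> where \<delta>: "0 < \<delta>" "\<And>D f. unital_cstar_subalgebra D \<Longrightarrow> near_shom B D M \<delta> f \<Longrightarrow>
      \<exists>g. shom B D g \<and> (\<forall>x\<in>B. norm (g x - f x) \<le> \<eta> * norm x)"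
    using shom_stability[OF B(1) M(1) \<eta>] by blast
  have "\<forall>\<^sub>F m in sequentially. near_shom B P M \<delta> (\<phi> m)"
    using eventually_near_shom[OF B(1), of \<phi> P M \<delta>] \<phi>_lin_on \<phi>_mem M(2) \<phi>_mult \<phi>_adj
      \<phi>_fix[OF PD(5)] \<delta>(1) by blast
  moreover have "\<forall>\<^sub>F m in sequentially. \<forall>x\<in>X. norm (\<phi> m x - x) < \<epsilon> / 4"
  proof (rule eventually_ball_finite[OF X(1)], rule ballI)
    fix x assume "x \<in> X"
    then have "(\<lambda>m. norm (\<phi> m x - x)) \<longlonglongrightarrow> 0"
      using \<phi>_fix X(2) by (intro tendsto_norm_zero) blast
    then show "\<forall>\<^sub>F m in sequentially. norm (\<phi> m x - x) < \<epsilon> / 4"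
      using \<epsilon> by (intro order_tendstoD(2)) auto
  qed
  ultimately have "\<forall>\<^sub>F m in sequentially. near_shom B P M \<delta> (\<phi> m) \<and> (\<forall>x\<in>X. norm (\<phi> m x - x) < \<epsilon> / 4)"
    by (rule eventually_conj)
  then obtain m where m: "near_shom B P M \<delta> (\<phi> m)" "\<And>x. x \<in> X \<Longrightarrow> norm (\<phi> m x - x) < \<epsilon> / 4"
    using eventually_happens'[OF sequentially_bot] by blast
  obtain g where g: "shom B P g" "\<And>x. x \<in> B \<Longrightarrow> norm (g x - \<phi> m x) \<le> \<eta> * norm x"
    using \<delta>(2)[OF P m(1)] by blast
  have "\<exists>y\<in>g ` B. norm (x - y) < \<epsilon>" if x: "x \<in> X" for x
  proof -
    obtain b where b: "b \<in> B" "norm (x - b) < d" using B(2)[OF x] by blast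
    have "norm x \<le> R"
      unfolding R_def using X(1) x by (intro member_le_sum) auto
    moreover have "norm b \<le> norm x + norm (x - b)"
      using norm_triangle_ineq4[of x "x - b"] by simp
    moreover have "d \<le> 1" by (simp add: d_def)
    ultimately have nb: "norm b \<le> R + 1" using b(2) by simp
    have 1: "norm (\<phi> m x - x) < \<epsilon> / 4" using m(2)[OF x] .
    have 2: "norm (\<phi> m x - \<phi> m b) \<le> \<epsilon> / 4"
    proof -
      have "norm (\<phi> m x - \<phi> m b) \<le> M * norm (x - b)"
        using M(2)[of m "x - b"] by (simp add: \<phi>_diff)
      also have "\<dots> \<le> M * (\<epsilon> / (4 * (M + 1)))"
        using b(2) M(1) by (intro mult_left_mono) (auto simp: d_def)
      also have "\<dots> \<le> \<epsilon> / 4" using M(1) \<epsilon> by (simp add: field_simps)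
      finally show ?thesis .
    qed
    have 3: "norm (g b - \<phi> m b) \<le> \<epsilon> / 4"
    proof -
      have "norm (g b - \<phi> m b) \<le> \<eta> * (R + 1)"
        using g(2)[OF b(1)] mult_left_mono[OF nb less_imp_le[OF \<eta>]] by simp
      also have "\<dots> = \<epsilon> / 4"
      proof -
        have "R + 1 \<noteq> 0" using R0 by simp
        then show ?thesis by (metis \<eta>_def eq_divide_eq)
      qed
      finally show ?thesis .
    qed
    have "norm (x - g b) \<le> norm (\<phi> m x - x) + norm (\<phi> m x - \<phi> m b) + norm (g b - \<phi> m b)"
    proof -
      have eq: "x - g b = (\<phi> m x - \<phi> m b) - (\<phi> m x - x) - (g b - \<phi> m b)" by simp
      show ?thesis
        unfolding eq
        using norm_triangle_ineq4[of "(\<phi> m x - \<phi> m b) - (\<phi> m x - x)" "g b - \<phi> m b"]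
          norm_triangle_ineq4[of "\<phi> m x - \<phi> m b" "\<phi> m x - x"] by linarith
    qed
    then have "norm (x - g b) < \<epsilon>" using 1 2 3 \<epsilon> by linarith
    then show ?thesis using b(1) by blast
  qed
  then show "\<exists>B. fdalg B \<and> B \<subseteq> P \<and> (\<forall>x\<in>X. \<exists>b\<in>B. norm (x - b) < \<epsilon>)"
    using shom_image_fdalg[OF B(1) g(1)] by blast
qed

section \<open>Perturbation of inclusions and intertwining\<close>

lemma near_inclusion:
  assumes F: "fdalg F" and \<eta>: "0 < \<eta>"
  obtains \<delta> where "0 < \<delta>" "\<And>G. fdalg G \<Longrightarrow> (\<forall>s\<in>fb F. \<exists>g\<in>G. norm (s - g) < \<delta>) \<Longrightarrow>
    \<exists>h. shom F G h \<and> (\<forall>x\<in>F. norm (h x - x) \<le> \<eta> * norm x)"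
proof -
  note FD = fdalgD[OF F] and sF = fb_mem[OF F] and dF = fdual(1)[OF F]
  obtain \<delta>0 where \<delta>0: "0 < \<delta>0" "\<And>D f. unital_cstar_subalgebra D \<Longrightarrow> near_shom F D 2 \<delta>0 f \<Longrightarrow>
      \<exists>g. shom F D g \<and> (\<forall>x\<in>F. norm (g x - f x) \<le> \<eta> / 2 * norm x)"
    using shom_stability[OF F, of 2 "\<eta> / 2"] \<eta> by auto
  obtain C where C: "0 \<le> C" "\<And>s x. s \<in> fb F \<Longrightarrow> x \<in> F \<Longrightarrow> cmod (ftr F (fdual F s * x)) \<le> C * norm x"
    using coordinate_bound[OF F] by blast
  define N where "N = real (card (fb F))"
  \<comment> \<open>The map \<open>f\<close> below moves x by at most
    \<open>\<kappa> * norm x\<close>. Its multiplicative defect collects \<kappa> + \<kappa> + 2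
    \<kappa>, whence \<delta>0 / 4; \<eta> / 2 leaves the other half for the correction.\<close>
  define \<kappa> where "\<kappa> = min 1 (min (\<delta>0 / 4) (\<eta> / 2))"
  define \<delta> where "\<delta> = \<kappa> / (C * N + 1)"
  have \<kappa>: "0 < \<kappa>" "\<kappa> \<le> 1" "4 * \<kappa> \<le> \<delta>0" "\<kappa> \<le> \<eta> / 2"
    using \<delta>0(1) \<eta> by (auto simp: \<kappa>_def)
  have N0: "0 \<le> N" by (simp add: N_def)
  have CN: "0 < C * N + 1" using C(1) N0 by (simp add: add_nonneg_pos)
  have \<delta>: "0 < \<delta>" using \<kappa> CN by (simp add: \<delta>_def)
  moreover have "\<exists>h. shom F G h \<and> (\<forall>x\<in>F. norm (h x - x) \<le> \<eta> * norm x)"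
    if G: "fdalg G" and near: "\<forall>s\<in>fb F. \<exists>g\<in>G. norm (s - g) < \<delta>" for G
  proof -
    obtain \<gamma> where \<gamma>: "\<And>s. s \<in> fb F \<Longrightarrow> \<gamma> s \<in> G" "\<And>s. s \<in> fb F \<Longrightarrow> norm (s - \<gamma> s) < \<delta>"
      using near by metis
    \<comment> \<open>Replacing the basis of \<open>F\<close> by nearby elements of \<open>G\<close>
      gives a linear map that almost fixes \<open>F\<close> and is therefore almost multiplicative;
      stability makes it a homomorphism into \<open>G\<close>.\<close>
    define f where "f x = (\<Sum>s\<in>fb F. ftr F (fdual F s * x) *\<^sub>C \<gamma> s)" for x
    have close: "norm (f x - x) \<le> \<kappa> * norm x" if x: "x \<in> F" for x
    proof -
      have "f x - (\<Sum>s\<in>fb F. ftr F (fdual F s * x) *\<^sub>C s) =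
          (\<Sum>s\<in>fb F. ftr F (fdual F s * x) *\<^sub>C (\<gamma> s - s))"
        by (simp add: f_def sum_subtractf cvec.scale_right_diff_distrib)
      then have "norm (f x - x) = norm (\<Sum>s\<in>fb F. ftr F (fdual F s * x) *\<^sub>C (\<gamma> s - s))"
        by (simp add: fdual_expand_left[OF F x])
      also have "\<dots> \<le> (\<Sum>s\<in>fb F. (C * norm x) * \<delta>)"
        using C \<gamma>(2) x by (intro sum_norm_le) (auto simp: norm_scaleC norm_minus_commute less_imp_le
            intro!: mult_mono)
      also have "\<dots> = (C * N) * \<delta> * norm x" by (simp add: N_def mult_ac)
      also have "\<dots> \<le> (C * N + 1) * \<delta> * norm x"
        using \<delta> by (intro mult_right_mono) auto
      also have "\<dots> = \<kappa> * norm x" using CN by (simp add: \<delta>_def)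
      finally show ?thesis .
    qed
    have f2: "norm (f x) \<le> 2 * norm x" if x: "x \<in> F" for x
    proof -
      have "norm (f x) \<le> norm x + norm (f x - x)"
        using norm_triangle_ineq[of x "f x - x"] by simp
      also have "\<dots> \<le> norm x + 1 * norm x"
        using \<kappa>(2) by (intro add_left_mono order_trans[OF close[OF x]] mult_right_mono) auto
      finally show ?thesis by simp
    qed
    have "near_shom F G 2 \<delta>0 f"
      unfolding near_shom_def
    proof (intro conjI ballI)
      show "lin_on F f"
        using dF FD(2)
        by (auto simp: lin_on_def f_def distrib_left mult_scaleC_right ftr_add[OF F] ftr_scaleC[OF F]
            scaleC_add_left sum.distrib cvec.scale_sum_right)
      show "f x \<in> G" for x
        unfolding f_def by (intro fdalgD(11,9)[OF G] \<gamma>(1))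
      show "norm (f 1 - 1) \<le> \<delta>0" using close[OF FD(4)] \<kappa> by simp
      show "norm (f x) \<le> 2 * norm x" if "x \<in> F" for x using f2[OF that] .
      show "norm (f (adj x) - adj (f x)) \<le> \<delta>0 * norm x" if x: "x \<in> F" for x
      proof -
        have "norm (f (adj x) - adj (f x)) = norm ((f (adj x) - adj x) - adj (f x - x))"
          by (simp add: adj_diff)
        also have "\<dots> \<le> norm (f (adj x) - adj x) + norm (f x - x)"
          using norm_triangle_ineq4[of "f (adj x) - adj x" "adj (f x - x)"] by simp
        also have "\<dots> \<le> (4 * \<kappa>) * norm x"
        proof -
          have "0 \<le> \<kappa> * norm x" using \<kappa>(1) by simp
          then show ?thesis using close[OF x] close[OF FD(3)[OF x]] by simp
        qed
        also have "\<dots> \<le> \<delta>0 * norm x" using \<kappa> by (intro mult_right_mono) auto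
        finally show ?thesis .
      qed
      fix x y assume x: "x \<in> F" and y: "y \<in> F"
      have "mdef f x y = (f (x * y) - x * y) - ((f x - x) * y + f x * (f y - y))"
        by (simp add: mdef_def algebra_simps)
      then have "norm (mdef f x y) \<le> norm (f (x * y) - x * y) + (norm (f x - x) * norm y + norm (f x) * norm (f y - y))"
        by (simp only:) (intro order_trans[OF norm_triangle_ineq4] add_mono order_refl
            order_trans[OF norm_triangle_ineq] norm_mult_ineq)
      also have "\<dots> \<le> \<kappa> * (norm x * norm y) + ((\<kappa> * norm x) * norm y + (2 * norm x) * (\<kappa> * norm y))"
        using \<kappa>(1) by (intro add_mono mult_mono close f2 x y order_trans[OF close[OF FD(2)[OF x y]]]
            mult_left_mono norm_mult_ineq) auto
      also have "\<dots> = (4 * \<kappa>) * norm x * norm y" by simp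
      also have "\<dots> \<le> \<delta>0 * norm x * norm y" using \<kappa> by (intro mult_right_mono) auto
      finally show "norm (mdef f x y) \<le> \<delta>0 * norm x * norm y" .
    qed
    from \<delta>0(2)[OF fdalg_unital_cstar_subalgebra[OF G] this]
    obtain h where h: "shom F G h" "\<And>x. x \<in> F \<Longrightarrow> norm (h x - f x) \<le> \<eta> / 2 * norm x" by blast
    have "norm (h x - x) \<le> \<eta> * norm x" if x: "x \<in> F" for x
    proof -
      have "norm (h x - x) \<le> norm (h x - f x) + norm (f x - x)"
        using norm_triangle_ineq[of "h x - f x" "f x - x"] by simp
      also have "\<dots> \<le> \<eta> / 2 * norm x + \<eta> / 2 * norm x"
        using \<kappa>(4) by (intro add_mono h(2) x order_trans[OF close[OF x]] mult_right_mono) auto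
      finally show ?thesis by simp
    qed
    with h(1) show ?thesis by blast
  qed
  ultimately show ?thesis using that by blast
qed

text \<open>Finite dimension gives some bound \<open>M\<close>; applied to powers of
  \<open>adj x * x\<close> it improves to 1 by \<open>le_of_power_bound\<close>. In
  \<open>intertwining\<close> this keeps the errors of long composites summable.\<close>

lemma shom_contractive:
  assumes B: "fdalg B" and g: "shom B D g" and x: "x \<in> B"
  shows "norm (g x) \<le> norm x"
proof -
  note BD = fdalgD[OF B] and G = shomD[OF g]
  obtain C where C: "0 \<le> C"
    "\<And>g x. lin_on B g \<Longrightarrow> x \<in> B \<Longrightarrow> norm (g x) \<le> C * (\<Sum>s\<in>fb B. norm (g s)) * norm x"
    using lin_on_bound[OF B] by blast
  define M where "M = C * (\<Sum>s\<in>fb B. norm (g s))"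
  define h where "h = adj x * x"
  have h: "h \<in> B" "adj h = h" using x BD(2,3) by (simp_all add: h_def adj_mult adj_adj)
  have gh: "adj (g h) = g h" using G(4)[OF h(1)] h(2) by simp
  have pow: "g (h ^ k) = g h ^ k" for k
    by (induction k) (simp_all add: G(3,5) h fdalg_power[OF B])
  have "norm (g h) \<le> norm h"
  proof (rule le_of_power_bound)
    fix k
    have "norm (g h) ^ 2 ^ k = norm (g (h ^ 2 ^ k))"
      by (simp add: pow norm_selfadj_power[OF gh])
    also have "\<dots> \<le> M * norm (h ^ 2 ^ k)"
      unfolding M_def by (intro C(2) G(1) fdalg_power B h)
    finally show "norm (g h) ^ 2 ^ k \<le> M * norm h ^ 2 ^ k"
      by (simp add: norm_selfadj_power[OF h(2)])
  qed simp_all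
  moreover have "norm (g h) = (norm (g x))\<^sup>2"
    using x BD(3) by (simp add: h_def G(4,5) norm_adj_mult_self)
  moreover have "norm h = (norm x)\<^sup>2" by (simp add: h_def norm_adj_mult_self)
  ultimately show ?thesis by (simp add: power2_le_iff_abs_le)
qed

text \<open>Elliott's intertwining: maps \<open>\<psi>\<^sub>k\<close> close to the inclusions become inclusions after passing to
  the limits of \<open>\<psi>\<^sub>n\<^sub>+\<^sub>k \<circ> \<dots> \<circ> \<psi>\<^sub>n\<close>, so no conjugation by unitaries is needed.\<close>

lemma intertwining:
  fixes G :: "nat \<Rightarrow> 'a::cstar_algebra set"
  assumes P: "unital_cstar_subalgebra P" and G: "\<And>k. fdalg (G k)" "\<And>k. G k \<subseteq> P"
    and \<psi>: "\<And>k. shom (G k) (G (Suc k)) (\<psi> k)"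
    and close: "\<And>k x. x \<in> G k \<Longrightarrow> norm (\<psi> k x - x) \<le> (1/2) ^ k * norm x"
  obtains \<theta> where "\<And>k. shom (G k) P (\<theta> k)"
    "\<And>k x. x \<in> G k \<Longrightarrow> norm (\<theta> k x - x) \<le> 2 * (1/2) ^ k * norm x"
    "\<And>k x. x \<in> G k \<Longrightarrow> \<theta> k x = \<theta> (Suc k) (\<psi> k x)"
proof -
  \<comment> \<open>\<open>c n k\<close> composes the k maps \<psi> n, ..., \<psi> (n + k - 1), so
    \<open>c n 0\<close> is the identity.\<close>
  define c where "c n = rec_nat (\<lambda>x. x) (\<lambda>k f x. \<psi> (n + k) (f x))" for n
  have c0: "c n 0 x = x" and cS: "c n (Suc k) x = \<psi> (n + k) (c n k x)" for n k x
    by (simp_all add: c_def)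
  have c_shom: "shom (G n) (G (n + k)) (c n k)" for n k
  proof (induction k)
    case 0
    then show ?case by (simp add: shom_def lin_on_def c0)
  next
    case (Suc k)
    note a = shomD[OF Suc] and b = shomD[OF \<psi>[of "n + k"]]
    note la = lin_onD[OF a(1)] and lb = lin_onD[OF b(1)]
    show ?case
      unfolding shom_def lin_on_def
      by (simp add: cS la lb a(2-5) b(2-5))
  qed
  have c_norm: "norm (c n k x) \<le> norm x" if "x \<in> G n" for n k x
    by (rule shom_contractive[OF G(1) c_shom that])
  \<comment> \<open>Exact homomorphisms are the case of defect 0, and contractivity supplies the
    norm bound.\<close>
  have c_ahom: "ahom (G n) P 1 0 (c n k)" for n k
    using shomD[OF c_shom[of n k]] G(2)[of "n + k"] c_norm
    by (auto simp: ahom_def mdef_def)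
  have c_step: "norm (c n (Suc k) x - c n k x) \<le> ((1/2) ^ n * norm x) * (1/2) ^ k"
    if x: "x \<in> G n" for n k x
  proof -
    have "norm (c n (Suc k) x - c n k x) \<le> (1/2) ^ (n + k) * norm (c n k x)"
      unfolding cS using shomD(2)[OF c_shom x] by (rule close)
    also have "\<dots> \<le> (1/2) ^ (n + k) * norm x"
      using c_norm[OF x] by (intro mult_left_mono) auto
    finally show ?thesis by (simp add: power_add mult_ac)
  qed
  define \<theta> where "\<theta> n x = x + (\<Sum>k. c n (Suc k) x - c n k x)" for n x
  have geo: "summable (\<lambda>k. ((1/2) ^ n * norm x) * (1/2) ^ k)" for n and x :: 'a
    by (intro summable_mult summable_geometric) simp
  have summ: "summable (\<lambda>k. norm (c n (Suc k) x - c n k x))" if "x \<in> G n" for n x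
    by (rule summable_comparison_test'[OF geo[of n x], of 0]) (use c_step[OF that] in simp)
  have lim: "(\<lambda>k. c n k x) \<longlonglongrightarrow> \<theta> n x" if x: "x \<in> G n" for n x
  proof -
    have "(\<lambda>k. x + (\<Sum>i<k. c n (Suc i) x - c n i x)) \<longlonglongrightarrow> \<theta> n x"
      unfolding \<theta>_def
      by (intro tendsto_add tendsto_const summable_LIMSEQ[OF summable_norm_cancel[OF summ[OF x]]])
    moreover have "(\<lambda>k. x + (\<Sum>i<k. c n (Suc i) x - c n i x)) = (\<lambda>k. c n k x)"
      by (simp add: sum_lessThan_telescope[of "\<lambda>i. c n i x"] c0)
    ultimately show ?thesis by simp
  qed
  have 1: "shom (G n) P (\<theta> n)" for n
    by (rule ahom_limit[OF G(1) P c_ahom tendsto_const lim])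
  have 2: "norm (\<theta> n x - x) \<le> 2 * (1/2) ^ n * norm x" if x: "x \<in> G n" for n x
  proof -
    have "norm (\<theta> n x - x) = norm (\<Sum>k. c n (Suc k) x - c n k x)" by (simp add: \<theta>_def)
    also have "\<dots> \<le> (\<Sum>k. norm (c n (Suc k) x - c n k x))"
      by (rule summable_norm[OF summ[OF x]])
    also have "\<dots> \<le> (\<Sum>k. ((1/2) ^ n * norm x) * (1/2) ^ k)"
      by (intro suminf_le c_step x summ geo)
    also have "\<dots> = 2 * (1/2) ^ n * norm x"
      by (subst suminf_mult) (simp_all add: suminf_geometric)
    finally show ?thesis .
  qed
  have 3: "\<theta> n x = \<theta> (Suc n) (\<psi> n x)" if x: "x \<in> G n" for n x
  proof -
    \<comment> \<open>Splitting off the first map instead of the last one relates the limits for n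
      and n + 1; this makes the images nested.\<close>
    have eq: "c n (Suc k) x = c (Suc n) k (\<psi> n x)" for k
      by (induction k) (simp_all add: cS c0)
    have "(\<lambda>k. c n (Suc k) x) \<longlonglongrightarrow> \<theta> n x"
      using lim[OF x] by (rule LIMSEQ_Suc)
    moreover have "(\<lambda>k. c (Suc n) k (\<psi> n x)) \<longlonglongrightarrow> \<theta> (Suc n) (\<psi> n x)"
      by (rule lim[OF shomD(2)[OF \<psi> x]])
    ultimately show ?thesis unfolding eq by (rule LIMSEQ_unique)
  qed
  show ?thesis using that 1 2 3 by blast
qed

lemma separable_dense_sequence:
  fixes P :: "'a::real_normed_vector set"
  assumes "separable_space (top_of_set P)" "P \<noteq> {}"
  shows "\<exists>d :: nat \<Rightarrow> 'a. range d \<subseteq> P \<and> (\<forall>p\<in>P. \<forall>e>0. \<exists>i. norm (p - d i) < e)"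
proof -
  obtain C where C: "countable C" "C \<subseteq> P" "top_of_set P closure_of C = P"
    using assms(1) unfolding separable_space_def by auto
  have dense: "\<exists>c\<in>C. norm (p - c) < e" if "p \<in> P" "0 < e" for p e
  proof -
    have "p \<in> closure C"
      using that(1) C(2,3) by (auto simp: closure_of_subtopology Int_absorb1)
    then show ?thesis
      using that(2) unfolding closure_approachable by (auto simp: dist_norm norm_minus_commute)
  qed
  then have "C \<noteq> {}" using assms(2) zero_less_one by blast
  then have range: "range (from_nat_into C) = C" using C(1) by (rule range_from_nat_into)
  show ?thesis
  proof (intro exI[of _ "from_nat_into C"] conjI ballI allI impI)
    show "range (from_nat_into C) \<subseteq> P" using range C(2) by simp
    show "\<exists>i. norm (p - from_nat_into C i) < e" if p: "p \<in> P" and e: "0 < e" for p e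
    proof -
      obtain c where "c \<in> range (from_nat_into C)" "norm (p - c) < e"
        unfolding range using dense[OF p e] by blast
      then show ?thesis by blast
    qed
  qed
qed

text \<open>Local approximants need not be nested. They are chosen so that each almost embeds into
  the next; the limit maps turn these embeddings into inclusions and move a unit vector of
  \<open>G k\<close> by at most 2 (1/2)^k, which preserves density.\<close>

theorem locally_fd_separable_AF:
  assumes P: "unital_cstar_subalgebra P" and loc: "locally_fd P" and sep: "separable_space (top_of_set P)"
  shows "AF_algebra P"
proof -
  note PD = unital_cstar_subalgebraD[OF P]
  have "P \<noteq> {}" using PD(5) by blast
  from separable_dense_sequence[OF sep this] obtain d :: "nat \<Rightarrow> 'a" where
    "range d \<subseteq> P" and dense: "\<forall>p\<in>P. \<forall>e>0. \<exists>i. norm (p - d i) < e"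
    by blast
  then have d: "\<And>i. d i \<in> P" "\<And>p e. p \<in> P \<Longrightarrow> 0 < e \<Longrightarrow> \<exists>i. norm (p - d i) < e"
    by auto
  let ?Q = "\<lambda>k G G'. (\<forall>i\<le>k. \<exists>g\<in>G'. norm (d i - g) < (1/2) ^ k) \<and>
    (\<exists>h. shom G G' h \<and> (\<forall>x\<in>G. norm (h x - x) \<le> (1/2) ^ k * norm x))"
  have "\<exists>G. \<forall>k. (fdalg (G k) \<and> G k \<subseteq> P) \<and> ?Q k (G k) (G (Suc k))"
  proof (rule dependent_nat_choice)
    show "\<exists>G. fdalg G \<and> G \<subseteq> P"
      using loc[unfolded locally_fd_def, rule_format, of "{}" 1] by auto
    fix G k assume G: "fdalg G \<and> G \<subseteq> P"
    obtain \<delta> where \<delta>: "0 < \<delta>" "\<And>G'. fdalg G' \<Longrightarrow> (\<forall>s\<in>fb G. \<exists>g\<in>G'. norm (s - g) < \<delta>) \<Longrightarrow>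
        \<exists>h. shom G G' h \<and> (\<forall>x\<in>G. norm (h x - x) \<le> (1/2) ^ k * norm x)"
      using near_inclusion[of G "(1/2) ^ k"] G by auto
    \<comment> \<open>The next algebra must approximate a basis of G, for the embedding, and the
      points d 0, ..., d k, for density.\<close>
    have "finite (fb G \<union> d ` {..k})" "fb G \<union> d ` {..k} \<subseteq> P" "0 < min \<delta> ((1/2) ^ k)"
      using fb(1) fb_mem G d(1) \<delta>(1) by auto
    then obtain G' where "fdalg G'" "G' \<subseteq> P"
        "\<forall>x\<in>fb G \<union> d ` {..k}. \<exists>b\<in>G'. norm (x - b) < min \<delta> ((1/2) ^ k)"
      using loc unfolding locally_fd_def by meson
    then have G': "fdalg G'" "G' \<subseteq> P" "\<forall>s\<in>fb G. \<exists>g\<in>G'. norm (s - g) < \<delta>"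
        "\<forall>i\<le>k. \<exists>g\<in>G'. norm (d i - g) < (1/2) ^ k"
      by (auto simp: Ball_def) (metis+)?
    then show "\<exists>G'. (fdalg G' \<and> G' \<subseteq> P) \<and> ?Q k G G'"
      using \<delta>(2)[OF G'(1,3)] by blast
  qed
  then obtain G where G: "\<And>k. fdalg (G k)" "\<And>k. G k \<subseteq> P"
      "\<And>k i. i \<le> k \<Longrightarrow> \<exists>g\<in>G (Suc k). norm (d i - g) < (1/2) ^ k"
      "\<And>k. \<exists>h. shom (G k) (G (Suc k)) h \<and> (\<forall>x\<in>G k. norm (h x - x) \<le> (1/2) ^ k * norm x)"
    by blast
  obtain \<psi> where \<psi>: "\<And>k. shom (G k) (G (Suc k)) (\<psi> k)"
      "\<And>k x. x \<in> G k \<Longrightarrow> norm (\<psi> k x - x) \<le> (1/2) ^ k * norm x"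
    using G(4) by metis
  obtain \<theta> where \<theta>: "\<And>k. shom (G k) P (\<theta> k)"
      "\<And>k x. x \<in> G k \<Longrightarrow> norm (\<theta> k x - x) \<le> 2 * (1/2) ^ k * norm x"
      "\<And>k x. x \<in> G k \<Longrightarrow> \<theta> k x = \<theta> (Suc k) (\<psi> k x)"
    using intertwining[OF P G(1,2) \<psi>] by blast
  define F where "F k = \<theta> k ` G k" for k
  have F: "fdalg (F k)" "F k \<subseteq> P" for k
    unfolding F_def by (rule shom_image_fdalg[OF G(1) \<theta>(1)])+
  have "F k \<subseteq> F (Suc k)" for k
  proof
    fix y assume "y \<in> F k"
    then obtain x where x: "x \<in> G k" "y = \<theta> k x" unfolding F_def by blast
    then show "y \<in> F (Suc k)"
      unfolding F_def using \<theta>(3)[OF x(1)] shomD(2)[OF \<psi>(1) x(1)] by (metis imageI)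
  qed
  then have inc: "incseq F" by (rule incseq_SucI)
  have "P \<subseteq> closure (\<Union>k. F k)"
  proof
    fix p assume p: "p \<in> P"
    show "p \<in> closure (\<Union>k. F k)"
      unfolding closure_approachable
    proof (intro allI impI)
      fix e :: real assume e: "0 < e"
      obtain i where i: "norm (p - d i) < e / 2"
        using d(2)[OF p, of "e / 2"] e by auto
      \<comment> \<open>In units of (1/2)^k, the distance from d i to g contributes 1 and the move
        of g contributes its norm, at most norm (d i) + 1.\<close>
      have "(\<lambda>k. (1/2) ^ k * (norm (d i) + 2)) \<longlonglongrightarrow> 0"
        by (intro tendsto_mult_left_zero LIMSEQ_power_zero) simp
      then have "\<forall>\<^sub>F k in sequentially. (1/2) ^ k * (norm (d i) + 2) < e / 2"
        using e by (intro order_tendstoD(2)) auto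
      then have "\<forall>\<^sub>F k in sequentially. (1/2) ^ k * (norm (d i) + 2) < e / 2 \<and> i \<le> k"
        using eventually_ge_at_top by (rule eventually_conj)
      then obtain k where k: "(1/2) ^ k * (norm (d i) + 2) < e / 2" "i \<le> k"
        using eventually_happens'[OF sequentially_bot] by blast
      obtain g where g: "g \<in> G (Suc k)" "norm (d i - g) < (1/2) ^ k"
        using G(3)[OF k(2)] by blast
      have "(1/2 :: real) ^ k \<le> 1" by (rule power_le_one) auto
      then have "norm g \<le> norm (d i) + 1"
        using norm_triangle_ineq4[of "d i" "d i - g"] g(2) by simp
      \<comment> \<open>The index \<open>Suc k\<close> absorbs the factor 2 of the general
        bound.\<close>
      have "norm (\<theta> (Suc k) g - g) \<le> (1/2) ^ k * norm g"
        using \<theta>(2)[OF g(1)] by simp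
      also have "\<dots> \<le> (1/2) ^ k * (norm (d i) + 1)"
        using \<open>norm g \<le> norm (d i) + 1\<close> by (intro mult_left_mono) auto
      finally have 1: "norm (\<theta> (Suc k) g - g) \<le> (1/2) ^ k * (norm (d i) + 1)" .
      have "norm (p - \<theta> (Suc k) g) \<le> norm (p - d i) + norm (d i - g) + norm (\<theta> (Suc k) g - g)"
      proof -
        have eq: "p - \<theta> (Suc k) g = (p - d i) + (d i - g) - (\<theta> (Suc k) g - g)" by simp
        show ?thesis
          unfolding eq
          using norm_triangle_ineq4[of "(p - d i) + (d i - g)" "\<theta> (Suc k) g - g"]
            norm_triangle_ineq[of "p - d i" "d i - g"] by linarith
      qed
      also have "\<dots> < e / 2 + ((1/2) ^ k + (1/2) ^ k * (norm (d i) + 1))"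
        using i g(2) 1 by linarith
      also have "\<dots> = e / 2 + (1/2) ^ k * (norm (d i) + 2)" by (simp add: algebra_simps)
      also have "\<dots> < e" using k(1) by simp
      finally have "dist (\<theta> (Suc k) g) p < e" by (simp add: dist_norm norm_minus_commute)
      then show "\<exists>y\<in>\<Union>k. F k. dist y p < e"
        using g(1) unfolding F_def by blast
    qed
  qed
  moreover have "closure (\<Union>k. F k) \<subseteq> P"
    using F(2) PD(2) by (intro closure_minimal) auto
  ultimately have "P = closure (\<Union>k. F k)" by (rule equalityI)
  moreover have "cstar_subalgebra (F k) \<and> finite_dim (F k)" for k
    using fdalg_unital_cstar_subalgebra[OF F(1)] fdalgD(5)[OF F(1)]
    by (simp add: unital_cstar_subalgebra_def)
  ultimately show ?thesis
    using inc P unfolding AF_algebra_def unital_cstar_subalgebra_def by blast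
qed

theorem theorem5p3:
  fixes P :: "'a::cstar_algebra set" and E :: "'a \<Rightarrow> 'a"
  assumes "unital_cstar_subalgebra P"
    and "separable_space (euclidean :: 'a topology)"
    and "separable_space (top_of_set P)"
    and "conditional_expectation P E"
    and "finite_index E"
    and "AF_algebra (UNIV :: 'a set)"
    and "rohlin_property E"
  shows "AF_algebra P"
proof -
  obtain n u v where qb: "quasi_basis E n u v"
    using assms(5) unfolding finite_index_def by blast
  interpret X: finite_index_expectation P E n u v
    using AF_algebra_locally_fd[OF assms(6)] assms(1,4) qb by unfold_locales
  obtain e c where e: "e \<in> central_seq" "projection e" "c * index_of E = 1" "index_of E * c = 1"
      "seq_map E e = seq_const c"
    using assms(7) unfolding rohlin_property_def by blast
  obtain em where em: "Bseq em" "e = abs_seq_alg em"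
    using seq_alg_cases by blast
  have w: "index_of E = X.w"
    using index_of_eq[OF qb] by (simp add: X.w_def)
  interpret Y: rohlin_expectation P E n u v em c
    using e em by unfold_locales (simp_all add: w)
  show ?thesis
    by (rule locally_fd_separable_AF[OF assms(1) Y.P_locally_fd assms(3)])
qed

end
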